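(* Assume that $N = 2$ or $N = 3$, and $p = 1$. Let $v \in Y$ be a solitary-wave solution of speed $1$ of the Kadomtsev-Petviashvili equation, and let, for $\sigma \in \mathbb{S}^{N-1}$, $$v_\infty(\sigma) = \frac{\Gamma(\frac{N}{2})}{2\pi^{\frac{N}{2}}(p+1)} (1 - N\sigma_1^2) \int_{\mathbb{R}^N} v(x)^{p+1}\,dx = \frac{\Gamma(\frac{N}{2})}{4\pi^{\frac{N}{2}}} (1 - N\sigma_1^2) \int_{\mathbb{R}^N} v(x)^{2}\,dx .$$ Then, for every $\sigma \in \mathbb{S}^{N-1}$, $$v_\infty(\sigma) = \frac{(7-2N)\Gamma(\frac{N}{2})}{2(2N-5)\pi^{\frac{N}{2}}} (1 - N\sigma_1^2)\, E(v) = \frac{(7-2N)\Gamma(\frac{N}{2})}{4\pi^{\frac{N}{2}}} (1 - N\sigma_1^2)\, S(v).$$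
   Context: $x = (x_1, x_\perp) \in \mathbb{R}^N$ with $x_\perp = (x_2,\ldots,x_N)$. $Y$ is the closure of the space $\partial_1 C_0^\infty(\mathbb{R}^N)$ for the norm $\|\partial_1 \phi\|_Y = \big( \|\nabla \phi\|_{L^2(\mathbb{R}^N)}^2 + \|\partial_{1,1}^2 \phi\|_{L^2(\mathbb{R}^N)}^2 \big)^{1/2}$, $\phi \in C_0^\infty(\mathbb{R}^N)$. For $v \in Y$ obtained as the limit of $\partial_1 \phi_n$, $v_j \in L^2(\mathbb{R}^N)$ denotes the limit of $\partial_j \phi_n$ for $j \in \{2,\ldots,N\}$, so that $\partial_1 v_j = \partial_j v$. For $p=1$ the Kadomtsev-Petviashvili equation is $\partial_t u + u \partial_1 u + \partial_1^3 u - \sum_{j=2}^N \partial_j u_j = 0$, $\partial_1 u_j = \partial_j u$ for $j \in \{2,\ldots,N\}$. A solitary-wave solution of speed $1$ in $Y$ is a (real-valued) $v \in Y$ such that $u(t,x) = v(x_1 - t, x_\perp)$ solves it, i.e. (in the sense of distributions) $$-\partial_1 v + v \partial_1 v + \partial_1^3 v - \sum_{j=2}^N \partial_j v_j = 0, \qquad \partial_1 v_j = \partial_j v \ \ (2 \leq j \leq N).$$ The energy and the action (for $p=1$ and speed $c=1$) are $$E(v) = \frac{1}{2}\int_{\mathbb{R}^N}\Big( (\partial_1 v)^2 + \sum_{j=2}^N v_j^2 \Big)dx - \frac{1}{6}\int_{\mathbb{R}^N} v^3\,dx, \qquad S(v) = E(v) + \frac{1}{2}\int_{\mathbb{R}^N}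 v^2\,dx .$$ *)

theory Defs
  imports "HOL-Analysis.Analysis"
begin

text \<open>
  The space is \<open>real ^ 'n\<close> with \<open>N = CARD('n)\<close>. The class \<open>one\<close> on the index type only
  serves to name the distinguished coordinate \<open>x $ 1\<close>; the transverse coordinates are the
  \<open>x $ j\<close> with \<open>j \<noteq> 1\<close>. The types \<open>real ^ 2\<close> and \<open>real ^ 3\<close> are instances.
\<close>

definition partial :: "'n::finite \<Rightarrow> (real ^ 'n \<Rightarrow> real) \<Rightarrow> real ^ 'n \<Rightarrow> real" where
  "partial j f x = frechet_derivative f (at x) (axis j 1)"

primrec Ck :: "nat \<Rightarrow> (real ^ 'n::finite \<Rightarrow> real) \<Rightarrow> bool" where
  "Ck 0 f \<longleftrightarrow> continuous_on UNIV f"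
| "Ck (Suc k) f \<longleftrightarrow> (\<forall>x. f differentiable (at x)) \<and> (\<forall>j. Ck k (partial j f))"

definition test_function :: "(real ^ 'n::finite \<Rightarrow> real) \<Rightarrow> bool" where
  "test_function \<phi> \<longleftrightarrow> (\<forall>k. Ck k \<phi>) \<and> compact (closure {x. \<phi> x \<noteq> 0})"

definition L2 :: "(real ^ 'n::finite \<Rightarrow> real) set" where
  "L2 = {f \<in> borel_measurable lebesgue. integrable lebesgue (\<lambda>x. (f x)\<^sup>2)}"

definition L2_norm :: "(real ^ 'n::finite \<Rightarrow> real) \<Rightarrow> real" where
  "L2_norm f = sqrt (\<integral>x. (f x)\<^sup>2 \<partial>lebesgue)"

text \<open>Functions in \<^term>\<open>L2\<close> are not identified almost everywhere, so limits are unique only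
  up to null sets.\<close>

definition L2_tendsto ::
  "(nat \<Rightarrow> real ^ 'n::finite \<Rightarrow> real) \<Rightarrow> (real ^ 'n \<Rightarrow> real) \<Rightarrow> bool" where
  "L2_tendsto f g \<longleftrightarrow> (\<forall>n. f n \<in> L2) \<and> g \<in> L2 \<and>
     (\<lambda>n. L2_norm (\<lambda>x. f n x - g x)) \<longlonglongrightarrow> 0"

subsection \<open>Distributions\<close>

text \<open>Functionals on all functions are used; only their values on test functions matter.\<close>

type_synonym 'n distribution = "(real ^ 'n \<Rightarrow> real) \<Rightarrow> real"

definition distr_of :: "(real ^ 'n::finite \<Rightarrow> real) \<Rightarrow> 'n distribution" where
  "distr_of f = (\<lambda>\<psi>. \<integral>x. f x * \<psi> x \<partial>lebesgue)"

definition distr_partial :: "'n::finite \<Rightarrow> 'n distribution \<Rightarrow> 'n distribution" where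
  "distr_partial j T = (\<lambda>\<psi>. - T (partial j \<psi>))"

text \<open>Some representative of the distributional derivative, when it is square integrable; it is
  determined almost everywhere. For \<open>v\<close> in the space \<open>KP_space\<close> below, the derivative in
  direction \<open>1\<close> is of this kind.\<close>

definition weak_partial ::
  "'n::finite \<Rightarrow> (real ^ 'n \<Rightarrow> real) \<Rightarrow> real ^ 'n \<Rightarrow> real" where
  "weak_partial j v = (SOME w. w \<in> L2 \<and>
     (\<forall>\<psi>. test_function \<psi> \<longrightarrow> distr_of w \<psi> = distr_partial j (distr_of v) \<psi>))"

subsection \<open>The energy space\<close>

text \<open>The norm of \<open>\<partial>\<^sub>1 \<phi>\<close>, written as a function of the test function \<open>\<phi>\<close> (which is determined
  by \<open>\<partial>\<^sub>1 \<phi>\<close>).\<close>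

definition KP_norm :: "(real ^ 'n::{finite,one} \<Rightarrow> real) \<Rightarrow> real" where
  "KP_norm \<phi> = sqrt ((\<Sum>j\<in>UNIV. (L2_norm (partial j \<phi>))\<^sup>2)
     + (L2_norm (partial 1 (partial 1 \<phi>)))\<^sup>2)"

text \<open>The closure is the completion, realised as a space of functions: this norm dominates the
  \<open>L\<^sup>2\<close> norm of \<open>\<partial>\<^sub>1 \<phi>\<close>, so a Cauchy sequence has an \<open>L\<^sup>2\<close> limit, which determines it up to
  sequences of norm tending to zero.\<close>

definition KP_approx ::
  "(nat \<Rightarrow> real ^ 'n::{finite,one} \<Rightarrow> real) \<Rightarrow> (real ^ 'n::{finite,one} \<Rightarrow> real) \<Rightarrow> bool" where
  "KP_approx \<phi> v \<longleftrightarrow> (\<forall>n. test_function (\<phi> n)) \<and>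
     (\<forall>\<epsilon>>0. \<exists>M. \<forall>m\<ge>M. \<forall>n\<ge>M. KP_norm (\<lambda>x. \<phi> m x - \<phi> n x) < \<epsilon>) \<and>
     L2_tendsto (\<lambda>n. partial 1 (\<phi> n)) v"

definition KP_space :: "(real ^ 'n::{finite,one} \<Rightarrow> real) set" where
  "KP_space = {v. \<exists>\<phi>. KP_approx \<phi> v}"

text \<open>The component \<open>v\<^sub>j\<close>, for \<open>j \<noteq> 1\<close>; up to null sets it depends neither on the choice of
  the limit nor on that of the approximating sequence.\<close>

definition KP_comp ::
  "(real ^ 'n::{finite,one} \<Rightarrow> real) \<Rightarrow> 'n::{finite,one} \<Rightarrow> real ^ 'n::{finite,one} \<Rightarrow> real" where
  "KP_comp v j = (SOME g. \<exists>\<phi>. KP_approx \<phi> v \<and> L2_tendsto (\<lambda>n. partial j (\<phi> n)) g)"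

subsection \<open>Solitary waves of speed 1 for the quadratic nonlinearity\<close>

definition KP_solitary_wave :: "(real ^ 'n::{finite,one} \<Rightarrow> real) \<Rightarrow> bool" where
  "KP_solitary_wave v \<longleftrightarrow> v \<in> KP_space \<and>
     (\<forall>\<psi>. test_function \<psi> \<longrightarrow>
        - distr_partial 1 (distr_of v) \<psi>
        + distr_of (\<lambda>x. v x * weak_partial 1 v x) \<psi>
        + distr_partial 1 (distr_partial 1 (distr_partial 1 (distr_of v))) \<psi>
        - (\<Sum>j\<in>UNIV - {1}. distr_partial j (distr_of (KP_comp v j)) \<psi>) = 0) \<and>
     (\<forall>j. j \<noteq> 1 \<longrightarrow> (\<forall>\<psi>. test_function \<psi> \<longrightarrow>
        distr_partial 1 (distr_of (KP_comp v j)) \<psi> = distr_partial j (distr_of v) \<psi>))"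

definition KP_energy :: "(real ^ 'n::{finite,one} \<Rightarrow> real) \<Rightarrow> real" where
  "KP_energy v =
     1/2 * (\<integral>x. (weak_partial 1 v x)\<^sup>2 + (\<Sum>j\<in>UNIV - {1}. (KP_comp v j x)\<^sup>2) \<partial>lebesgue)
     - 1/6 * (\<integral>x. v x ^ 3 \<partial>lebesgue)"

definition KP_action :: "(real ^ 'n::{finite,one} \<Rightarrow> real) \<Rightarrow> real" where
  "KP_action v = KP_energy v + 1/2 * (\<integral>x. (v x)\<^sup>2 \<partial>lebesgue)"

definition v_infty ::
  "nat \<Rightarrow> (real ^ 'n::{finite,one} \<Rightarrow> real) \<Rightarrow> real ^ 'n::{finite,one} \<Rightarrow> real" where
  "v_infty p v \<sigma> =
     Gamma (real CARD('n) / 2) / (2 * pi powr (real CARD('n) / 2) * (real p + 1))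
     * (1 - real CARD('n) * (\<sigma> $ 1)\<^sup>2) * (\<integral>x. v x ^ (p + 1) \<partial>lebesgue)"

lemma v_infty_1:
  fixes v :: "real ^ 'n::{finite,one} \<Rightarrow> real"
  shows "v_infty 1 v \<sigma> = Gamma (real CARD('n) / 2) / (4 * pi powr (real CARD('n) / 2))
     * (1 - real CARD('n) * (\<sigma> $ 1)\<^sup>2) * (\<integral>x. (v x)\<^sup>2 \<partial>lebesgue)"
  by (simp add: v_infty_def power2_eq_square)

end

theory Submission
  imports Defs "HOL-Computational_Algebra.Polynomial"
begin

text \<open>The theorem is algebra once three identities for a solitary wave are known. Write
  \<open>a = \<integral>v\<^sup>2\<close>, \<open>D = \<integral>(\<partial>\<^sub>1v)\<^sup>2\<close>, \<open>P\<^sub>j = \<integral>v\<^sub>j\<^sup>2\<close>, \<open>P = \<Sum>P\<^sub>j\<close> and \<open>T = \<integral>v\<^sup>3\<close>. Testing the equation, integrated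
  once in direction 1, with \<open>v\<close> gives \<open>a + D + P = T/2\<close>. The Pohozaev multipliers, namely \<open>x\<^sub>i\<close> times the
  \<open>i\<close>-th derivative of the primitive of \<open>v\<close>, give
  \<open>-(a + D + P)/2 + a + T/6 + 2D - T/2 = 0\<close> for \<open>i = 1\<close> and
  \<open>-(a + D + P)/2 + P\<^sub>i + T/6 = 0\<close> for \<open>i \<noteq> 1\<close>. Hence \<open>P\<^sub>i = T/12\<close>, \<open>D = N T/12\<close> and
  \<open>a = (7 - 2N) T/12\<close>, so that \<open>E = (2N - 5) T/24\<close> and \<open>S = T/12\<close>, which is the claim.

  The work lies in justifying the multipliers for a function that is only known to lie in \<open>Y\<close>. There
  is no regularity theory here: every computation is done on the test functions \<open>\<phi>\<^sub>n\<close> with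
  \<open>\<partial>\<^sub>1\<phi>\<^sub>n \<rightarrow> v\<close>, which solve the equation up to a residual that is small against the energy norm
  (\<open>residual_diff_bound\<close>). Because \<open>N \<le> 3\<close>, the anisotropic inequality \<open>Gagliardo_Nirenberg\<close> makes the
  nonlinearity subcritical, so the difference between a translate of \<open>\<phi>\<^sub>n\<close> and \<open>\<phi>\<^sub>n\<close> itself is controlled
  in the energy norm by the \<open>L\<^sup>2\<close> norm of its \<open>\<partial>\<^sub>1\<close> (\<open>translation_estimate\<close>). That norm is Lipschitz in
  the translation length, in direction 1 by the energy norm and then in direction \<open>j\<close> by the bound on
  \<open>\<partial>\<^sub>1v\<^sub>j = \<partial>\<^sub>jv\<close> which the first step provides; so difference quotients in all directions are bounded in
  the energy norm, up to the residual (\<open>incr_bound\<close>).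

  The multiplier \<open>x\<^sub>i \<partial>\<^sub>i\<close> is replaced by
  \<open>R sin(x\<^sub>i/R)\<close> times a difference quotient of step \<open>h\<close>, and the identities hold for \<open>\<phi>\<^sub>n\<close> with an error of
  order \<open>h\<close>, for fixed \<open>R\<close>, plus one of order \<open>1/R\<close> (\<open>Pohozaev_almost\<close>). Letting \<open>n \<rightarrow> \<infinity>\<close>, then \<open>h \<rightarrow> 0\<close> and
  \<open>R \<rightarrow> \<infinity>\<close> gives the exact identities (\<open>solitary_wave_identities\<close>). The limits of \<open>\<partial>\<^sub>j\<phi>\<^sub>n\<close> and
  \<open>\<partial>\<^sub>1\<partial>\<^sub>1\<phi>\<^sub>n\<close> are the chosen \<open>v\<^sub>j\<close> and the weak derivative of \<open>v\<close> because weak derivatives are unique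
  almost everywhere (\<open>KP_limits\<close>).\<close>

section \<open>Calculus of partial derivatives and test functions\<close>

lemma partial_eqI:
  assumes "(f has_derivative f') (at x)"
  shows "partial j f x = f' (axis j 1)"
  unfolding partial_def using frechet_derivative_at[OF assms] by simp

lemma Ck_differentiable: "Ck (Suc k) f \<Longrightarrow> f differentiable (at x)"
  by simp

lemma Ck_partial: "Ck (Suc k) f \<Longrightarrow> Ck k (partial j f)"
  by simp

lemma Ck_Suc_imp: "Ck (Suc k) f \<Longrightarrow> Ck k f"
proof (induction k arbitrary: f)
  case 0
  then have "\<And>x. f differentiable (at x)" by simp
  then show ?case
    by (auto intro!: continuous_at_imp_continuous_on differentiable_imp_continuous_within)
next
  case (Suc k)
  then have "\<And>x. f differentiable (at x)" "\<And>j. Ck (Suc k) (partial j f)" by auto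
  with Suc.IH show ?case by simp
qed

lemma Ck_continuous: "Ck k f \<Longrightarrow> continuous_on UNIV f"
  by (induction k) (use Ck_Suc_imp in auto)

lemma partial_add:
  assumes "f differentiable (at x)" "g differentiable (at x)"
  shows "partial j (\<lambda>x. f x + g x) x = partial j f x + partial j g x"
proof -
  obtain f' g' where D: "(f has_derivative f') (at x)" "(g has_derivative g') (at x)"
    using assms by (auto simp: differentiable_def)
  show ?thesis
    using partial_eqI[OF has_derivative_add[OF D], of j] partial_eqI[OF D(1), of j]
      partial_eqI[OF D(2), of j] by simp
qed

lemma partial_mult:
  assumes "f differentiable (at x)" "g differentiable (at x)"
  shows "partial j (\<lambda>x. f x * g x) x = f x * partial j g x + partial j f x * g x"
proof -
  obtain f' g' where D: "(f has_derivative f') (at x)" "(g has_derivative g') (at x)"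
    using assms by (auto simp: differentiable_def)
  show ?thesis
    using partial_eqI[OF has_derivative_mult[OF D], of j] partial_eqI[OF D(1), of j]
      partial_eqI[OF D(2), of j] by simp
qed

lemma partial_const: "partial j (\<lambda>x. c) x = 0"
  by (subst partial_eqI[of _ "\<lambda>_. 0"]) auto

lemma partial_comp_real:
  assumes "(G has_real_derivative d) (at (f x))" "f differentiable (at x)"
  shows "partial j (\<lambda>x. G (f x)) x = d * partial j f x"
proof -
  obtain f' where D: "(f has_derivative f') (at x)"
    using assms by (auto simp: differentiable_def)
  have "((\<lambda>x. G (f x)) has_derivative (\<lambda>z. d * f' z)) (at x)"
    using has_derivative_compose[OF D, of G "(*) d"] assms(1)
    by (simp add: has_field_derivative_def)
  then show ?thesis
    using partial_eqI[OF D, of j] partial_eqI[of "\<lambda>x. G (f x)" _ x j] by fastforce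
qed

lemma differentiable_comp_real:
  assumes "(G has_real_derivative d) (at (f x))" "f differentiable (at x)"
  shows "(\<lambda>x. G (f x)) differentiable (at x)"
  using differentiable_chain_at[OF assms(2), of G] assms(1)
  by (auto simp: o_def differentiable_def has_field_derivative_def)

lemma Ck_add: "Ck k f \<Longrightarrow> Ck k g \<Longrightarrow> Ck k (\<lambda>x. f x + g x)"
proof (induction k arbitrary: f g)
  case 0
  then show ?case by (auto intro: continuous_on_add)
next
  case (Suc k)
  have "partial j (\<lambda>x. f x + g x) = (\<lambda>x. partial j f x + partial j g x)" for j
    using Suc.prems by (auto simp: partial_add)
  with Suc show ?case by auto
qed

lemma Ck_mult: "Ck k f \<Longrightarrow> Ck k g \<Longrightarrow> Ck k (\<lambda>x. f x * g x)"
proof (induction k arbitrary: f g)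
  case 0
  then show ?case by (auto intro: continuous_on_mult)
next
  case (Suc k)
  have *: "partial j (\<lambda>x. f x * g x) = (\<lambda>x. f x * partial j g x + partial j f x * g x)" for j
    using Suc.prems by (auto simp: partial_mult)
  have "Ck k (partial j (\<lambda>x. f x * g x))" for j
    unfolding * using Suc.prems
    by (intro Ck_add Suc.IH) (auto dest: Ck_Suc_imp Ck_partial simp del: Ck.simps)
  with Suc.prems show ?case by auto
qed

lemma Ck_const: "Ck k (\<lambda>x::real^'n::finite. c)"
proof (induction k arbitrary: c)
  case (Suc k)
  have "partial j (\<lambda>x. c) = (\<lambda>x. 0)" for j :: 'n and c :: real by (auto simp: partial_const)
  with Suc show ?case by simp
qed auto

lemma partial_component: "partial j (\<lambda>x::real^'n. x $ i) x = (if i = j then 1 else 0)"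
proof -
  have "((\<lambda>x::real^'n. x $ i) has_derivative (\<lambda>x. x $ i)) (at x)"
    by (intro bounded_linear_imp_has_derivative bounded_linear_vec_nth)
  from partial_eqI[OF this, of j] show ?thesis by (auto simp: axis_def)
qed

lemma differentiable_component: "(\<lambda>x::real^'n. x $ i) differentiable (at x)"
  by (intro bounded_linear_imp_differentiable bounded_linear_vec_nth)

lemma Ck_component: "Ck k (\<lambda>x::real^'n::finite. x $ i)"
proof (cases k)
  case 0
  then show ?thesis by (simp add: linear_continuous_on bounded_linear_vec_nth)
next
  case (Suc k)
  have "partial j (\<lambda>x::real^'n. x $ i) = (\<lambda>x. if i = j then 1 else 0)" for j
    by (auto simp: partial_component)
  then show ?thesis using Suc by (simp add: differentiable_component Ck_const)
qed

text \<open>The sequence \<^term>\<open>G\<close> carries all derivatives of \<^term>\<open>G 0\<close>, so that the induction can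
  shift along it.\<close>

lemma Ck_comp_real:
  assumes G: "\<And>m t. (G m has_real_derivative G (Suc m) t) (at t)"
  shows "Ck k f \<Longrightarrow> Ck k (\<lambda>x. G m (f x))"
proof (induction k arbitrary: f m)
  case 0
  have "continuous_on UNIV (G m)"
    using G by (meson DERIV_isCont continuous_at_imp_continuous_on)
  with 0 show ?case
    using continuous_on_compose2[of UNIV "G m" UNIV f] by simp
next
  case (Suc k)
  have "partial j (\<lambda>x. G m (f x)) = (\<lambda>x. G (Suc m) (f x) * partial j f x)" for j
    by (intro ext partial_comp_real[OF G] Ck_differentiable[OF Suc.prems])
  moreover have "Ck k (\<lambda>x. G (Suc m) (f x) * partial j f x)" for j
    using Suc.prems Suc.IH[of f "Suc m"]
    by (intro Ck_mult) (auto dest: Ck_Suc_imp Ck_partial simp del: Ck.simps)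
  moreover have "(\<lambda>x. G m (f x)) differentiable (at x)" for x
    by (rule differentiable_comp_real[OF G Ck_differentiable[OF Suc.prems]])
  ultimately show ?case by simp
qed

definition shift :: "'a \<Rightarrow> ('a::plus \<Rightarrow> 'b) \<Rightarrow> 'a \<Rightarrow> 'b" where
  "shift y f x = f (x + y)"

lemma partial_shift:
  assumes "\<And>x. f differentiable (at x)"
  shows "partial j (shift y f) = shift y (partial j f)"
proof
  fix x
  obtain f' where D: "(f has_derivative f') (at (x + y))"
    using assms by (auto simp: differentiable_def)
  have "((\<lambda>x. x + y) has_derivative (\<lambda>x. x)) (at x)"
    by (auto intro!: derivative_eq_intros)
  from has_derivative_compose[OF this D]
  have "((\<lambda>x. f (x + y)) has_derivative f') (at x)" .
  then show "partial j (shift y f) x = shift y (partial j f) x"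
    using partial_eqI[OF D, of j] partial_eqI[of "\<lambda>x. f (x + y)" f' x j]
    by (simp add: shift_def[abs_def])
qed

lemma differentiable_shift:
  fixes f :: "'a::real_normed_vector \<Rightarrow> 'b::real_normed_vector"
  assumes "f differentiable (at (x + y))"
  shows "shift y f differentiable (at x)"
proof -
  obtain f' where D: "(f has_derivative f') (at (x + y))"
    using assms by (auto simp: differentiable_def)
  have "((\<lambda>x. x + y) has_derivative (\<lambda>x. x)) (at x)"
    by (auto intro!: derivative_eq_intros)
  from has_derivative_compose[OF this D]
  have "((\<lambda>x. f (x + y)) has_derivative f') (at x)" .
  then show ?thesis by (auto simp: differentiable_def shift_def[abs_def])
qed

lemma continuous_on_shift:
  fixes f :: "'a::real_normed_vector \<Rightarrow> 'b::topological_space"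
  assumes "continuous_on UNIV f"
  shows "continuous_on UNIV (shift y f)"
  unfolding shift_def[abs_def]
  by (rule continuous_on_compose2[OF assms]) (auto intro!: continuous_intros)

lemma Ck_shift: "Ck k f \<Longrightarrow> Ck k (shift y f)"
proof (induction k arbitrary: f)
  case 0
  then show ?case by (simp add: continuous_on_shift)
next
  case (Suc k)
  then show ?case by (auto simp: partial_shift intro!: differentiable_shift)
qed

definition smooth :: "(real ^ 'n::finite \<Rightarrow> real) \<Rightarrow> bool" where
  "smooth f \<longleftrightarrow> (\<forall>k. Ck k f)"

lemma smooth_partial: "smooth f \<Longrightarrow> smooth (partial j f)"
  unfolding smooth_def using Ck_partial by blast

lemma smooth_differentiable: "smooth f \<Longrightarrow> f differentiable (at x)"
  unfolding smooth_def using Ck_differentiable by blast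

lemma smooth_continuous: "smooth f \<Longrightarrow> continuous_on UNIV f"
  unfolding smooth_def using Ck_continuous by blast

lemma smooth_const: "smooth (\<lambda>x. c)" and smooth_component: "smooth (\<lambda>x. x $ i)"
  by (auto simp: smooth_def Ck_const Ck_component)

lemma smooth_add: "smooth f \<Longrightarrow> smooth g \<Longrightarrow> smooth (\<lambda>x. f x + g x)"
  and smooth_mult: "smooth f \<Longrightarrow> smooth g \<Longrightarrow> smooth (\<lambda>x. f x * g x)"
  and smooth_shift: "smooth f \<Longrightarrow> smooth (shift y f)"
  by (auto simp: smooth_def Ck_add Ck_mult Ck_shift)

lemma smooth_scale: "smooth f \<Longrightarrow> smooth (\<lambda>x. c * f x)"
  by (simp add: smooth_mult smooth_const)

lemma smooth_diff: "smooth f \<Longrightarrow> smooth g \<Longrightarrow> smooth (\<lambda>x. f x - g x)"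
  using smooth_add[of f "\<lambda>x. (-1) * g x"] smooth_scale[of g "-1"] by simp

lemma smooth_prod: "(\<And>i. i \<in> A \<Longrightarrow> smooth (f i)) \<Longrightarrow> smooth (\<lambda>x. \<Prod>i\<in>A. f i x)"
  by (induction A rule: infinite_finite_induct) (auto intro: smooth_const smooth_mult)

lemma smooth_comp_real:
  assumes "\<And>m t. (G m has_real_derivative G (Suc m) t) (at t)" "smooth f"
  shows "smooth (\<lambda>x. G m (f x))"
  unfolding smooth_def
proof
  fix k show "Ck k (\<lambda>x. G m (f x))"
    by (rule Ck_comp_real[of G, OF assms(1)]) (use assms(2) in \<open>simp add: smooth_def\<close>)
qed

lemma test_function_iff: "test_function f \<longleftrightarrow> smooth f \<and> bounded {x. f x \<noteq> 0}"
  by (simp add: test_function_def smooth_def compact_closure)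

lemma partial_scale:
  "f differentiable (at x) \<Longrightarrow> partial j (\<lambda>x. c * f x) x = c * partial j f x"
  using partial_mult[of "\<lambda>_. c" x f j] by (simp add: partial_const)

lemma partial_diff:
  assumes "f differentiable (at x)" "g differentiable (at x)"
  shows "partial j (\<lambda>x. f x - g x) x = partial j f x - partial j g x"
proof -
  obtain f' g' where D: "(f has_derivative f') (at x)" "(g has_derivative g') (at x)"
    using assms by (auto simp: differentiable_def)
  show ?thesis
    using partial_eqI[OF has_derivative_diff[OF D], of j] partial_eqI[OF D(1), of j]
      partial_eqI[OF D(2), of j] by simp
qed

lemma has_real_derivative_line:
  assumes "\<And>x. f differentiable (at x)"
  shows "((\<lambda>t. f (x + axis j t)) has_real_derivative partial j f (x + axis j s)) (at s)"
proof -
  obtain f' where D: "(f has_derivative f') (at (x + axis j s))"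
    using assms by (auto simp: differentiable_def)
  have ax: "axis j t = t *\<^sub>R axis j (1::real)" for t :: real
    by (auto simp: axis_def vec_eq_iff)
  have "((\<lambda>t. x + t *\<^sub>R axis j (1::real)) has_derivative (\<lambda>t. t *\<^sub>R axis j 1)) (at s)"
    by (auto intro!: derivative_eq_intros)
  then have "((\<lambda>t. x + axis j t) has_derivative (\<lambda>t. axis j t)) (at s)"
    by (simp only: ax[symmetric])
  from has_derivative_compose[OF this D]
  have "((\<lambda>t. f (x + axis j t)) has_derivative (\<lambda>t. f' (axis j t))) (at s)" .
  moreover have "f' (axis j t) = partial j f (x + axis j s) * t" for t
    using partial_eqI[OF D, of j] linear_scale[OF has_derivative_linear[OF D], of t "axis j 1"]
    by (simp only: ax[of t] real_scaleR_def mult.commute)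
  ultimately show ?thesis
    by (simp add: has_field_derivative_def)
qed

lemma mean_value_line:
  assumes "\<And>x. f differentiable (at x)"
  obtains s where "\<bar>s\<bar> \<le> \<bar>t\<bar>" "f (x + axis j t) - f x = t * partial j f (x + axis j s)"
proof -
  have d: "((\<lambda>t. f (x + axis j t)) has_real_derivative partial j f (x + axis j s)) (at s)" for s
    using has_real_derivative_line[OF assms] .
  have ax0: "axis j (0::real) = 0" by (auto simp: axis_def vec_eq_iff)
  consider "t = 0" | "t > 0" | "t < 0" by linarith
  then show ?thesis
  proof cases
    case 1
    then show ?thesis using that[of 0] by (simp add: ax0)
  next
    case 2
    obtain z where "z > 0" "z < t"
      "f (x + axis j t) - f (x + axis j 0) = (t - 0) * partial j f (x + axis j z)"
      using MVT2[OF 2, of "\<lambda>t. f (x + axis j t)" "\<lambda>s. partial j f (x + axis j s)"] d by blast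
    then show ?thesis using that[of z] by (simp add: ax0)
  next
    case 3
    obtain z where "z > t" "z < 0"
      "f (x + axis j 0) - f (x + axis j t) = (0 - t) * partial j f (x + axis j z)"
      using MVT2[OF 3, of "\<lambda>t. f (x + axis j t)" "\<lambda>s. partial j f (x + axis j s)"] d by blast
    then show ?thesis using that[of z] by (simp add: ax0 algebra_simps)
  qed
qed

text \<open>Both mixed derivatives are limits of the same second difference: apply the mean value
  theorem to it in the two possible orders.\<close>

lemma partial_commute:
  fixes f :: "real ^ 'n::finite \<Rightarrow> real"
  assumes f: "smooth f"
  shows "partial i (partial j f) = partial j (partial i f)"
proof
  fix x
  note df = smooth_differentiable[OF f] and di = smooth_differentiable[OF smooth_partial[OF f]]
  define D where "D t = f (x + axis i t + axis j t) - f (x + axis i t) - f (x + axis j t) + f x" for t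
  have key: "\<exists>a b. \<bar>a\<bar> \<le> \<bar>t\<bar> \<and> \<bar>b\<bar> \<le> \<bar>t\<bar> \<and>
      f (x + axis i t + axis j t) - f (x + axis i t) - f (x + axis j t) + f x =
      t * t * partial j (partial i f) (x + axis i a + axis j b)" for t i j
  proof -
    let ?g = "\<lambda>z. shift (axis j t) f z - f z"
    have dg: "?g differentiable (at z)" for z
      by (intro differentiable_diff differentiable_shift df)
    obtain a where a: "\<bar>a\<bar> \<le> \<bar>t\<bar>" "?g (x + axis i t) - ?g x = t * partial i ?g (x + axis i a)"
      using mean_value_line[of ?g t x i] dg by blast
    have "partial i ?g z = partial i f (z + axis j t) - partial i f z" for z
      by (subst partial_diff) (auto intro: differentiable_shift df simp: partial_shift[OF df] shift_def)
    moreover obtain b where "\<bar>b\<bar> \<le> \<bar>t\<bar>" "partial i f (x + axis i a + axis j t) - partial i f (x + axis i a)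
        = t * partial j (partial i f) (x + axis i a + axis j b)"
      using mean_value_line[of "partial i f" t "x + axis i a" j] di by blast
    ultimately have "f (x + axis i t + axis j t) - f (x + axis i t) - f (x + axis j t) + f x =
        t * t * partial j (partial i f) (x + axis i a + axis j b)"
      using a(2) by (simp add: shift_def)
    with a(1) \<open>\<bar>b\<bar> \<le> \<bar>t\<bar>\<close> show ?thesis by blast
  qed
  have lim: "((\<lambda>t. D t / (t * t)) \<longlongrightarrow> partial j (partial i f) x) (at 0)"
    if D: "\<And>t. \<exists>a b. \<bar>a\<bar> \<le> \<bar>t\<bar> \<and> \<bar>b\<bar> \<le> \<bar>t\<bar> \<and>
      D t = t * t * partial j (partial i f) (x + axis i a + axis j b)" for i j
  proof -
    from D obtain a where "\<forall>t. \<exists>b. \<bar>a t\<bar> \<le> \<bar>t\<bar> \<and> \<bar>b\<bar> \<le> \<bar>t\<bar> \<and>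
        D t = t * t * partial j (partial i f) (x + axis i (a t) + axis j b)"
      using choice[of "\<lambda>t a. \<exists>b. \<bar>a\<bar> \<le> \<bar>t\<bar> \<and> \<bar>b\<bar> \<le> \<bar>t\<bar> \<and>
        D t = t * t * partial j (partial i f) (x + axis i a + axis j b)"] by blast
    from choice[OF this] obtain b where ab: "\<And>t. \<bar>a t\<bar> \<le> \<bar>t\<bar>" "\<And>t. \<bar>b t\<bar> \<le> \<bar>t\<bar>"
      "\<And>t. D t = t * t * partial j (partial i f) (x + axis i (a t) + axis j (b t))"
      by blast
    have t0: "((\<lambda>t::real. \<bar>t\<bar>) \<longlongrightarrow> 0) (at 0)" by (auto intro!: tendsto_eq_intros)
    have ab0: "(a \<longlongrightarrow> 0) (at 0)" "(b \<longlongrightarrow> 0) (at 0)"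
      using ab by (auto intro!: Lim_null_comparison[OF _ t0] always_eventually)
    have ax0: "axis k (0::real) = 0" for k :: 'n
      by (auto simp: axis_def vec_eq_iff)
    have ax: "axis k t = t *\<^sub>R axis k (1::real)" for t :: real and k :: 'n
      by (auto simp: axis_def vec_eq_iff)
    have "((\<lambda>t. x + axis i (a t) + axis j (b t)) \<longlongrightarrow> x) (at 0)"
    proof -
      have "((\<lambda>t. x + a t *\<^sub>R axis i (1::real) + b t *\<^sub>R axis j 1) \<longlongrightarrow>
          x + 0 *\<^sub>R axis i 1 + 0 *\<^sub>R axis j 1) (at 0)"
        by (intro tendsto_intros ab0)
      then show ?thesis by (simp only: ax[symmetric]) (simp add: ax0)
    qed
    moreover have "isCont (partial j (partial i f)) x"
      using smooth_continuous[OF smooth_partial[OF smooth_partial[OF f]]]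
      by (simp add: continuous_on_eq_continuous_at)
    ultimately have "((\<lambda>t. partial j (partial i f) (x + axis i (a t) + axis j (b t)))
        \<longlongrightarrow> partial j (partial i f) x) (at 0)"
      by (rule isCont_tendsto_compose[rotated])
    then show ?thesis
      by (rule Lim_transform_eventually) (simp add: ab(3) eventually_at_filter)
  qed
  have Dc: "D t = f (x + axis j t + axis i t) - f (x + axis j t) - f (x + axis i t) + f x" for t
    unfolding D_def by (simp add: add.commute add.left_commute)
  have "\<exists>a b. \<bar>a\<bar> \<le> \<bar>t\<bar> \<and> \<bar>b\<bar> \<le> \<bar>t\<bar> \<and>
      D t = t * t * partial i (partial j f) (x + axis j a + axis i b)" for t
    unfolding Dc by (rule key)
  from lim[OF this] have "((\<lambda>t. D t / (t * t)) \<longlongrightarrow> partial i (partial j f) x) (at 0)" .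
  moreover have "((\<lambda>t. D t / (t * t)) \<longlongrightarrow> partial j (partial i f) x) (at 0)"
    by (rule lim) (unfold D_def, rule key)
  ultimately show "partial i (partial j f) x = partial j (partial i f) x"
    by (rule tendsto_unique[OF trivial_limit_at])
qed

subsection \<open>Continuous functions of compact support\<close>

definition Cc :: "('a::euclidean_space \<Rightarrow> real) \<Rightarrow> bool" where
  "Cc f \<longleftrightarrow> continuous_on UNIV f \<and> bounded {x. f x \<noteq> 0}"

lemma Cc_continuous: "Cc f \<Longrightarrow> continuous_on UNIV f"
  by (simp add: Cc_def)

lemma Cc_radius:
  assumes "Cc f"
  obtains r where "r > 0" "\<And>x. norm x > r \<Longrightarrow> f x = 0"
proof -
  have "bounded {x. f x \<noteq> 0}" using assms by (simp add: Cc_def)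
  then obtain r where r: "r > 0" "\<forall>x\<in>{x. f x \<noteq> 0}. norm x \<le> r"
    unfolding bounded_pos by blast
  have *: "f x = 0" if "norm x > r" for x
    using r(2) that not_less by blast
  show ?thesis by (rule that[OF r(1) *])
qed

lemma CcI:
  assumes "continuous_on UNIV f" "\<And>x. norm x > r \<Longrightarrow> f x = 0"
  shows "Cc f"
proof -
  have "norm x \<le> r" if "x \<in> {x. f x \<noteq> 0}" for x
    using assms(2)[of x] that by (cases "norm x > r") auto
  then show ?thesis
    unfolding Cc_def using assms(1) boundedI[of "{x. f x \<noteq> 0}" r] by blast
qed

lemma Cc_bounded:
  assumes "Cc f"
  obtains M where "M > 0" "\<And>x. \<bar>f x\<bar> \<le> M"
proof -
  obtain r where r: "\<And>x. norm x > r \<Longrightarrow> f x = 0" using Cc_radius[OF assms] by blast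
  have "compact (f ` cball 0 r)"
    using assms by (auto intro!: compact_continuous_image continuous_on_subset[OF Cc_continuous])
  then obtain M where "M > 0" "\<forall>x\<in>f ` cball 0 r. norm x \<le> M"
    using compact_imp_bounded bounded_pos by blast
  then have "\<bar>f x\<bar> \<le> M" for x
    using r[of x] by (cases "norm x > r") auto
  with \<open>M > 0\<close> show ?thesis using that by blast
qed

lemma Cc_mult_left: "Cc f \<Longrightarrow> continuous_on UNIV g \<Longrightarrow> Cc (\<lambda>x. f x * g x)"
  and Cc_mult_right: "Cc f \<Longrightarrow> continuous_on UNIV g \<Longrightarrow> Cc (\<lambda>x. g x * f x)"
  unfolding Cc_def by (auto intro!: continuous_on_mult elim: bounded_subset)

lemma Cc_mult: "Cc f \<Longrightarrow> Cc g \<Longrightarrow> Cc (\<lambda>x. f x * g x)"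
  by (rule Cc_mult_left) (auto simp: Cc_continuous)

lemma Cc_scale: "Cc f \<Longrightarrow> Cc (\<lambda>x. c * f x)"
  by (rule Cc_mult_right) auto

lemma Cc_divide: "Cc f \<Longrightarrow> Cc (\<lambda>x. f x / c)"
  using Cc_scale[of f "1 / c"] by simp

lemma Cc_uminus: "Cc f \<Longrightarrow> Cc (\<lambda>x. - f x)"
  using Cc_scale[of f "-1"] by simp

lemma Cc_add: "Cc f \<Longrightarrow> Cc g \<Longrightarrow> Cc (\<lambda>x. f x + g x)"
  unfolding Cc_def
  by (auto intro!: continuous_on_add intro: bounded_subset[of "{x. f x \<noteq> 0} \<union> {x. g x \<noteq> 0}"])

lemma Cc_diff: "Cc f \<Longrightarrow> Cc g \<Longrightarrow> Cc (\<lambda>x. f x - g x)"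
  using Cc_add[of f "\<lambda>x. - g x"] Cc_uminus[of g] by simp

lemma Cc_zero: "Cc (\<lambda>x. 0)"
  by (simp add: Cc_def)

lemma Cc_sum: "(\<And>i. i \<in> A \<Longrightarrow> Cc (f i)) \<Longrightarrow> Cc (\<lambda>x. \<Sum>i\<in>A. f i x)"
  by (induction A rule: infinite_finite_induct) (auto intro: Cc_zero Cc_add)

lemma Cc_power: "Cc f \<Longrightarrow> n > 0 \<Longrightarrow> Cc (\<lambda>x. f x ^ n)"
  unfolding Cc_def by (auto intro!: continuous_on_power)

lemma Cc_abs: "Cc f \<Longrightarrow> Cc (\<lambda>x. \<bar>f x\<bar>)"
  unfolding Cc_def by (auto intro!: continuous_on_rabs)

lemma Cc_shift: "Cc f \<Longrightarrow> Cc (shift y f)"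
proof -
  assume "Cc f"
  then obtain r where r: "\<And>x. norm x > r \<Longrightarrow> f x = 0" using Cc_radius by blast
  have "shift y f x = 0" if "norm x > r + norm y" for x
    using norm_triangle_ineq4[of "x + y" y] that by (auto simp: shift_def intro!: r)
  then show "Cc (shift y f)" using \<open>Cc f\<close>
    by (intro CcI[of _ "r + norm y"]) (auto intro: continuous_on_shift Cc_continuous)
qed

lemmas Cc_intros = Cc_mult Cc_scale Cc_divide Cc_uminus Cc_add Cc_diff Cc_sum Cc_power Cc_abs Cc_shift

lemma Cc_borel: "Cc f \<Longrightarrow> f \<in> borel_measurable borel"
  by (simp add: Cc_def borel_measurable_continuous_onI)

lemma Cc_lborel: "Cc f \<Longrightarrow> f \<in> borel_measurable lborel"
  by (simp add: Cc_borel)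

lemma Cc_integrable_lborel:
  assumes "Cc f" shows "integrable lborel f"
proof -
  obtain r where r: "\<And>x. norm x > r \<Longrightarrow> f x = 0" using Cc_radius[OF assms] by blast
  have "integrable lborel (\<lambda>x. indicator (cball 0 r) x *\<^sub>R f x)"
    by (intro borel_integrable_compact continuous_on_subset[OF Cc_continuous[OF assms]]) auto
  also have "(\<lambda>x. indicator (cball 0 r) x *\<^sub>R f x) = f"
    by (auto simp: indicator_def r not_le intro!: ext)
  finally show ?thesis .
qed

lemma Cc_integrable: "Cc f \<Longrightarrow> integrable lebesgue f"
  by (simp add: Cc_integrable_lborel integrable_completion[OF Cc_lborel])

lemma Cc_integral_lborel: "Cc f \<Longrightarrow> integral\<^sup>L lebesgue f = integral\<^sup>L lborel f"
  by (rule integral_completion[OF Cc_lborel])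

lemma Cc_integral_shift:
  assumes "Cc f"
  shows "integral\<^sup>L lebesgue (shift y f) = integral\<^sup>L lebesgue f"
proof -
  have [measurable]: "f \<in> borel_measurable borel" by (rule Cc_borel[OF assms])
  have "integral\<^sup>L lborel f = integral\<^sup>L (distr lborel borel ((+) y)) f"
    by (simp add: lborel_distr_plus)
  also have "\<dots> = (\<integral>x. f (y + x) \<partial>lborel)"
    by (subst integral_distr) auto
  also have "\<dots> = integral\<^sup>L lborel (shift y f)"
    by (simp add: shift_def[abs_def] add.commute)
  finally show ?thesis
    using assms by (simp add: Cc_integral_lborel Cc_shift)
qed

lemma test_Cc: "test_function f \<Longrightarrow> Cc f"
  by (simp add: test_function_iff Cc_def smooth_continuous)

lemma test_smooth: "test_function f \<Longrightarrow> smooth f"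
  by (simp add: test_function_iff)

lemma test_differentiable: "test_function f \<Longrightarrow> f differentiable (at x)"
  by (simp add: test_smooth smooth_differentiable)

lemma testI:
  assumes "smooth f" "Cc f" shows "test_function f"
  using assms by (simp add: test_function_iff Cc_def)

lemma partial_zero_outside:
  assumes "\<And>x. norm x > r \<Longrightarrow> f x = 0" "norm x > r"
  shows "partial j f x = 0"
proof -
  have "(f has_derivative (\<lambda>_. 0)) (at x)"
  proof (rule has_derivative_transform_within_open[of "\<lambda>_. 0" _ _ _ "{x. r < norm x}"])
    show "open {x::real^'n. r < norm x}"
      by (intro open_Collect_less continuous_intros)
  qed (use assms in auto)
  from partial_eqI[OF this, of j] show ?thesis by simp
qed

lemma test_partial:
  assumes "test_function f" shows "test_function (partial j f)"
proof (rule testI)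
  show s: "smooth (partial j f)" by (intro smooth_partial test_smooth assms)
  obtain r where r: "\<And>x. norm x > r \<Longrightarrow> f x = 0" using Cc_radius[OF test_Cc[OF assms]] by blast
  show "Cc (partial j f)"
    by (rule CcI[of _ r]) (simp_all add: smooth_continuous[OF s] partial_zero_outside[OF r])
qed

lemma test_shift: "test_function f \<Longrightarrow> test_function (shift y f)"
  by (rule testI[OF smooth_shift Cc_shift]) (simp_all add: test_smooth test_Cc)

lemma test_diff: "test_function f \<Longrightarrow> test_function g \<Longrightarrow> test_function (\<lambda>x. f x - g x)"
  by (rule testI[OF smooth_diff Cc_diff]) (simp_all add: test_smooth test_Cc)

lemma test_scale: "test_function f \<Longrightarrow> test_function (\<lambda>x. c * f x)"
  by (rule testI[OF smooth_scale Cc_scale]) (simp_all add: test_smooth test_Cc)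

lemma test_mult_smooth: "test_function f \<Longrightarrow> smooth g \<Longrightarrow> test_function (\<lambda>x. g x * f x)"
  by (rule testI[OF smooth_mult Cc_mult_right]) (simp_all add: test_smooth test_Cc smooth_continuous)

lemma test_partial_shift: "test_function f \<Longrightarrow> partial j (shift y f) = shift y (partial j f)"
  by (simp add: partial_shift test_differentiable)

lemma test_partial_diff:
  "test_function f \<Longrightarrow> test_function g \<Longrightarrow>
    partial j (\<lambda>x. f x - g x) = (\<lambda>x. partial j f x - partial j g x)"
  by (auto simp: partial_diff test_differentiable)

lemma test_partial_scale:
  "test_function f \<Longrightarrow> partial j (\<lambda>x. c * f x) = (\<lambda>x. c * partial j f x)"
  by (auto simp: partial_scale test_differentiable)

section \<open>Integral inequalities\<close>

lemma Cauchy_Schwarz_geometric: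
  fixes h a b :: "'a \<Rightarrow> real"
  assumes h: "h \<in> borel_measurable M" and a: "integrable M a" and b: "integrable M b"
    and ab: "\<And>x. 0 \<le> a x" "\<And>x. 0 \<le> b x" "\<And>x. (h x)\<^sup>2 \<le> a x * b x"
  shows "integrable M h" "(\<integral>x. \<bar>h x\<bar> \<partial>M)\<^sup>2 \<le> (\<integral>x. a x \<partial>M) * (\<integral>x. b x \<partial>M)"
proof -
  have amgm: "2 * t * \<bar>h x\<bar> \<le> t\<^sup>2 * a x + b x" if "t > 0" for t x
  proof (rule power2_le_imp_le)
    have "(2 * t * \<bar>h x\<bar>)\<^sup>2 = 4 * t\<^sup>2 * (h x)\<^sup>2" by (simp add: power_mult_distrib)
    also have "\<dots> \<le> 4 * t\<^sup>2 * (a x * b x)" by (intro mult_left_mono ab) auto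
    also have "\<dots> = (t\<^sup>2 * a x + b x)\<^sup>2 - (t\<^sup>2 * a x - b x)\<^sup>2"
      by (simp add: power2_eq_square algebra_simps)
    also have "\<dots> \<le> (t\<^sup>2 * a x + b x)\<^sup>2" by simp
    finally show "(2 * t * \<bar>h x\<bar>)\<^sup>2 \<le> (t\<^sup>2 * a x + b x)\<^sup>2" .
    show "0 \<le> t\<^sup>2 * a x + b x" using ab by simp
  qed
  show int: "integrable M h"
  proof (rule Bochner_Integration.integrable_bound[of M "\<lambda>x. a x + b x"])
    show "AE x in M. norm (h x) \<le> norm (a x + b x)"
    proof (rule AE_I2)
      fix x
      show "norm (h x) \<le> norm (a x + b x)" using amgm[of 1 x] ab(1,2)[of x] by simp
    qed
  qed (use a b h in auto)
  define A B X where "A = (\<integral>x. a x \<partial>M)" and "B = (\<integral>x. b x \<partial>M)" and "X = (\<integral>x. \<bar>h x\<bar> \<partial>M)"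
  have nn: "A \<ge> 0" "B \<ge> 0" "X \<ge> 0" unfolding A_def B_def X_def by (simp_all add: ab)
  have q: "2 * t * X \<le> t\<^sup>2 * A + B" if "t > 0" for t
  proof -
    have "(\<integral>x. 2 * t * \<bar>h x\<bar> \<partial>M) \<le> (\<integral>x. t\<^sup>2 * a x + b x \<partial>M)"
      using int a b by (intro integral_mono amgm that) auto
    then show ?thesis using a b int unfolding A_def B_def X_def by simp
  qed
  have "X\<^sup>2 \<le> A * B"
  proof (cases "X = 0")
    case False
    with nn have X: "X > 0" by simp
    show ?thesis
    proof (cases "A = 0")
      case True
      have "2 * ((B + 1) / (2 * X)) * X \<le> B"
        using q[of "(B + 1) / (2 * X)"] X nn True by simp
      then show ?thesis using X by simp
    next
      case False
      then have A: "A > 0" using nn by simp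
      have "2 * (X / A) * X \<le> (X / A)\<^sup>2 * A + B" using q[of "X / A"] A X by simp
      then have "X\<^sup>2 / A \<le> B" using A by (simp add: power2_eq_square field_simps)
      then show ?thesis using A by (simp add: field_simps)
    qed
  qed (use nn in auto)
  then show "(\<integral>x. \<bar>h x\<bar> \<partial>M)\<^sup>2 \<le> (\<integral>x. a x \<partial>M) * (\<integral>x. b x \<partial>M)"
    unfolding A_def B_def X_def .
qed

lemma Cauchy_Schwarz_integral:
  fixes f g :: "'a \<Rightarrow> real"
  assumes m: "f \<in> borel_measurable M" "g \<in> borel_measurable M"
    and i: "integrable M (\<lambda>x. (f x)\<^sup>2)" "integrable M (\<lambda>x. (g x)\<^sup>2)"
  shows "integrable M (\<lambda>x. f x * g x)"
    "(\<integral>x. \<bar>f x * g x\<bar> \<partial>M)\<^sup>2 \<le> (\<integral>x. (f x)\<^sup>2 \<partial>M) * (\<integral>x. (g x)\<^sup>2 \<partial>M)"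
  using Cauchy_Schwarz_geometric[of "\<lambda>x. f x * g x" M "\<lambda>x. (f x)\<^sup>2" "\<lambda>x. (g x)\<^sup>2"] m i
  by (simp_all add: power_mult_distrib)

lemma cube_interpolate:
  fixes a b :: real
  assumes "a \<ge> 0" "b \<ge> 0"
  shows "a * b\<^sup>2 \<le> a ^ 3 + b ^ 3"
proof (cases "a \<le> b")
  case True
  then have "a * b\<^sup>2 \<le> b * b\<^sup>2" by (intro mult_right_mono) auto
  also have "b * b\<^sup>2 = b ^ 3" by (simp add: power3_eq_cube power2_eq_square)
  finally show ?thesis using zero_le_power[OF assms(1), of 3] by linarith
next
  case False
  then have "a * b\<^sup>2 \<le> a * a\<^sup>2" using assms by (intro mult_left_mono power_mono) auto
  also have "a * a\<^sup>2 = a ^ 3" by (simp add: power3_eq_cube power2_eq_square)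
  finally show ?thesis using zero_le_power[OF assms(2), of 3] by linarith
qed

text \<open>The cubic Hoelder inequality follows from two uses of Cauchy--Schwarz: with
  \<open>X = \<integral>\<bar>f\<bar>g\<^sup>2\<close> and \<open>Z = \<integral>f\<^sup>2\<bar>g\<bar>\<close> one has \<open>X\<^sup>2 \<le> Z \<integral>\<bar>g\<bar>\<^sup>3\<close> and \<open>Z\<^sup>2 \<le> X \<integral>\<bar>f\<bar>\<^sup>3\<close>.\<close>

lemma Hoelder_cube:
  fixes f g :: "'a \<Rightarrow> real"
  assumes m: "f \<in> borel_measurable M" "g \<in> borel_measurable M"
    and i: "integrable M (\<lambda>x. \<bar>f x\<bar> ^ 3)" "integrable M (\<lambda>x. \<bar>g x\<bar> ^ 3)"
  shows "integrable M (\<lambda>x. \<bar>f x\<bar> * (g x)\<^sup>2)"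
    "(\<integral>x. \<bar>f x\<bar> * (g x)\<^sup>2 \<partial>M) ^ 3 \<le> (\<integral>x. \<bar>f x\<bar> ^ 3 \<partial>M) * (\<integral>x. \<bar>g x\<bar> ^ 3 \<partial>M)\<^sup>2"
proof -
  have int: "integrable M (\<lambda>x. \<bar>f x\<bar> * (g x)\<^sup>2)"
    if "f \<in> borel_measurable M" "g \<in> borel_measurable M"
      "integrable M (\<lambda>x. \<bar>f x\<bar> ^ 3)" "integrable M (\<lambda>x. \<bar>g x\<bar> ^ 3)" for f g :: "'a \<Rightarrow> real"
  proof (rule Bochner_Integration.integrable_bound[of M "\<lambda>x. \<bar>f x\<bar> ^ 3 + \<bar>g x\<bar> ^ 3"])
    show "AE x in M. norm (\<bar>f x\<bar> * (g x)\<^sup>2) \<le> norm (\<bar>f x\<bar> ^ 3 + \<bar>g x\<bar> ^ 3)"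
    proof (rule AE_I2)
      fix x show "norm (\<bar>f x\<bar> * (g x)\<^sup>2) \<le> norm (\<bar>f x\<bar> ^ 3 + \<bar>g x\<bar> ^ 3)"
        using cube_interpolate[of "\<bar>f x\<bar>" "\<bar>g x\<bar>"] by (simp add: abs_mult)
    qed
  qed (use that in auto)
  define X Z F G where "X = (\<integral>x. \<bar>f x\<bar> * (g x)\<^sup>2 \<partial>M)" and "Z = (\<integral>x. \<bar>g x\<bar> * (f x)\<^sup>2 \<partial>M)"
    and "F = (\<integral>x. \<bar>f x\<bar> ^ 3 \<partial>M)" and "G = (\<integral>x. \<bar>g x\<bar> ^ 3 \<partial>M)"
  show 1: "integrable M (\<lambda>x. \<bar>f x\<bar> * (g x)\<^sup>2)" by (rule int) (use m i in auto)
  have 2: "integrable M (\<lambda>x. \<bar>g x\<bar> * (f x)\<^sup>2)" by (rule int) (use m i in auto)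
  have nn: "X \<ge> 0" "Z \<ge> 0" "F \<ge> 0" "G \<ge> 0" unfolding X_def Z_def F_def G_def by auto
  have eq: "(\<bar>a\<bar> * b\<^sup>2)\<^sup>2 = (\<bar>b\<bar> * a\<^sup>2) * \<bar>b\<bar> ^ 3" for a b :: real
    by (simp add: power2_eq_square power3_eq_cube abs_mult_self_eq algebra_simps)
  have "(\<integral>x. \<bar>\<bar>f x\<bar> * (g x)\<^sup>2\<bar> \<partial>M)\<^sup>2 \<le> Z * G" unfolding Z_def G_def
    by (rule Cauchy_Schwarz_geometric(2)) (use m i 2 in \<open>simp_all add: eq\<close>)
  then have XZ: "X\<^sup>2 \<le> Z * G" by (simp add: X_def abs_mult)
  have "(\<integral>x. \<bar>\<bar>g x\<bar> * (f x)\<^sup>2\<bar> \<partial>M)\<^sup>2 \<le> X * F" unfolding X_def F_def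
    by (rule Cauchy_Schwarz_geometric(2)) (use m i 1 in \<open>simp_all add: eq\<close>)
  then have ZX: "Z\<^sup>2 \<le> X * F" by (simp add: Z_def abs_mult)
  have "X ^ 3 \<le> F * G\<^sup>2"
  proof (cases "X = 0")
    case False
    have "X * X ^ 3 = (X\<^sup>2)\<^sup>2" by (simp add: power2_eq_square power3_eq_cube)
    also have "\<dots> \<le> (Z * G)\<^sup>2" using XZ by (intro power_mono) auto
    also have "\<dots> = Z\<^sup>2 * G\<^sup>2" by (simp add: power_mult_distrib)
    also have "\<dots> \<le> X * F * G\<^sup>2" using ZX by (intro mult_right_mono) auto
    finally have "X * X ^ 3 \<le> X * (F * G\<^sup>2)" by (simp add: mult.assoc)
    then show ?thesis using False nn by (simp add: mult_le_cancel_left)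
  qed (use nn in auto)
  then show "(\<integral>x. \<bar>f x\<bar> * (g x)\<^sup>2 \<partial>M) ^ 3 \<le> (\<integral>x. \<bar>f x\<bar> ^ 3 \<partial>M) * (\<integral>x. \<bar>g x\<bar> ^ 3 \<partial>M)\<^sup>2"
    by (simp add: X_def F_def G_def)
qed

lemma power_sum_le:
  fixes a :: "nat \<Rightarrow> real"
  assumes "p \<ge> 1"
  shows "\<bar>\<Sum>i<m. a i\<bar> ^ p \<le> real m ^ (p - 1) * (\<Sum>i<m. \<bar>a i\<bar> ^ p)"
proof (cases "m = 0")
  case False
  then have m: "real m > 0" by simp
  have cv: "convex_on {0..} (\<lambda>x::real. x ^ p)"
    using convex_power_even[of p] convex_power_odd[of p]
    by (cases "even p") (auto intro: convex_on_subset)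
  have "(\<Sum>i<m. (1 / real m) *\<^sub>R \<bar>a i\<bar>) ^ p \<le> (\<Sum>i<m. (1 / real m) * \<bar>a i\<bar> ^ p)"
    using m by (intro convex_on_sum[OF _ _ cv]) (auto simp: lessThan_empty_iff)
  then have "((\<Sum>i<m. \<bar>a i\<bar>) / real m) ^ p \<le> (\<Sum>i<m. \<bar>a i\<bar> ^ p) / real m"
    by (simp add: sum_divide_distrib)
  then have "(\<Sum>i<m. \<bar>a i\<bar>) ^ p \<le> (\<Sum>i<m. \<bar>a i\<bar> ^ p) * (real m ^ p / real m)"
    using m by (simp add: power_divide field_simps)
  also have "real m ^ p / real m = real m ^ (p - 1)"
    using m assms by (simp add: power_diff)
  finally have "(\<Sum>i<m. \<bar>a i\<bar>) ^ p \<le> real m ^ (p - 1) * (\<Sum>i<m. \<bar>a i\<bar> ^ p)"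
    by (simp add: mult.commute)
  moreover have "\<bar>\<Sum>i<m. a i\<bar> ^ p \<le> (\<Sum>i<m. \<bar>a i\<bar>) ^ p"
    by (intro power_mono sum_abs) auto
  ultimately show ?thesis by linarith
qed (use assms in \<open>simp add: power_0_left\<close>)

lemma power_add_le:
  fixes a b :: real
  assumes "p \<ge> 1"
  shows "\<bar>a + b\<bar> ^ p \<le> 2 ^ (p - 1) * (\<bar>a\<bar> ^ p + \<bar>b\<bar> ^ p)"
  using power_sum_le[OF assms, of "\<lambda>i. if i = 0 then a else b" 2] by (simp add: numeral_2_eq_2)

definition pint :: "nat \<Rightarrow> ('a::euclidean_space \<Rightarrow> real) \<Rightarrow> real" where
  "pint p f = (\<integral>x. \<bar>f x\<bar> ^ p \<partial>lebesgue)"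

lemma pint_nonneg: "pint p f \<ge> 0"
  by (simp add: pint_def)

lemma Cc_abs_power: "Cc f \<Longrightarrow> p \<ge> 1 \<Longrightarrow> Cc (\<lambda>x. \<bar>f x\<bar> ^ p)"
  by (rule Cc_power[OF Cc_abs]) auto

lemma pint_shift: "Cc f \<Longrightarrow> p \<ge> 1 \<Longrightarrow> pint p (shift y f) = pint p f"
  using Cc_integral_shift[OF Cc_abs_power, of f p y] by (simp add: pint_def shift_def[abs_def])

lemma pint_scale: "pint p (\<lambda>x. c * f x) = \<bar>c\<bar> ^ p * pint p f"
  by (simp add: pint_def abs_mult power_mult_distrib)

lemma pint_sum_le:
  assumes "p \<ge> 1" "\<And>i. Cc (f i)"
  shows "pint p (\<lambda>x. \<Sum>i<m. f i x) \<le> real m ^ (p - 1) * (\<Sum>i<m. pint p (f i))"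
proof -
  note i = Cc_integrable[OF Cc_abs_power[OF _ assms(1)]]
  have "pint p (\<lambda>x. \<Sum>i<m. f i x) \<le> (\<integral>x. real m ^ (p - 1) * (\<Sum>i<m. \<bar>f i x\<bar> ^ p) \<partial>lebesgue)"
    unfolding pint_def
    by (intro integral_mono power_sum_le assms i Cc_sum integrable_mult_right Bochner_Integration.integrable_sum)
  also have "\<dots> = real m ^ (p - 1) * (\<Sum>i<m. pint p (f i))"
    unfolding pint_def by (simp add: i assms Bochner_Integration.integral_sum)
  finally show ?thesis .
qed

lemma pint_add_le:
  assumes "p \<ge> 1" "Cc f" "Cc g"
  shows "pint p (\<lambda>x. f x + g x) \<le> 2 ^ (p - 1) * (pint p f + pint p g)"
proof -
  note i = Cc_integrable[OF Cc_abs_power[OF _ assms(1)]]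
  have "pint p (\<lambda>x. f x + g x) \<le> (\<integral>x. 2 ^ (p - 1) * (\<bar>f x\<bar> ^ p + \<bar>g x\<bar> ^ p) \<partial>lebesgue)"
    unfolding pint_def
    by (intro integral_mono power_add_le assms i Cc_add integrable_mult_right Bochner_Integration.integrable_add)
  also have "\<dots> = 2 ^ (p - 1) * (pint p f + pint p g)"
    unfolding pint_def by (simp add: i assms)
  finally show ?thesis .
qed

lemma axis_add: "axis i (a + b) = axis i a + (axis i b :: real ^ 'n)"
  and axis_zero: "axis i 0 = (0 :: real ^ 'n)"
  by (auto simp: axis_def vec_eq_iff)

lemma norm_axis_real: "norm (axis i (a::real)) = \<bar>a\<bar>"
proof -
  have "axis i a = a *\<^sub>R axis i (1::real)" by (auto simp: axis_def vec_eq_iff)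
  then show ?thesis by simp
qed

text \<open>Difference quotients of a test function converge to its derivative in every
  \<open>L\<^sup>p\<close>, by dominated convergence.\<close>

lemma diff_quotient_tendsto:
  assumes f: "test_function f" and k: "k \<longlonglongrightarrow> 0" "\<And>m. k m \<noteq> 0" and p: "p \<ge> 1"
  shows "(\<lambda>m. pint p (\<lambda>x. (f (x + axis i (k m)) - f x) / k m - partial i f x)) \<longlonglongrightarrow> 0"
proof -
  let ?d = "\<lambda>m x. (f (x + axis i (k m)) - f x) / k m - partial i f x"
  have pf: "Cc (partial i f)" by (intro test_Cc test_partial f)
  obtain r where r: "\<And>x. norm x > r \<Longrightarrow> partial i f x = 0" using Cc_radius[OF pf] by blast
  obtain M where M: "M > 0" "\<And>x. \<bar>partial i f x\<bar> \<le> M" using Cc_bounded[OF pf] by blast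
  obtain K where K: "\<And>m. \<bar>k m\<bar> \<le> K"
    using Bseq_def[of k] convergent_imp_Bseq[of k] k(1) by (auto simp: convergent_def)
  have mv: "\<exists>s. \<bar>s\<bar> \<le> K \<and> ?d m x = partial i f (x + axis i s) - partial i f x" for m x
  proof -
    obtain s where "\<bar>s\<bar> \<le> \<bar>k m\<bar>" "f (x + axis i (k m)) - f x = k m * partial i f (x + axis i s)"
      using mean_value_line[of f "k m" x i] test_differentiable[OF f] by blast
    then show ?thesis using k(2)[of m] K[of m] by (intro exI[of _ s]) auto
  qed
  have bound: "\<bar>?d m x\<bar> ^ p \<le> (2 * M) ^ p * indicator (cball 0 (r + K)) x" for m x
  proof -
    obtain s where s: "\<bar>s\<bar> \<le> K" "?d m x = partial i f (x + axis i s) - partial i f x"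
      using mv by blast
    show ?thesis
    proof (cases "norm x \<le> r + K")
      case True
      have "\<bar>?d m x\<bar> \<le> 2 * M" unfolding s(2)
        using M(2)[of x] M(2)[of "x + axis i s"] by linarith
      then have "\<bar>?d m x\<bar> ^ p \<le> (2 * M) ^ p" by (rule power_mono) simp
      then show ?thesis using True by (simp del: power_mult_distrib)
    next
      case False
      have "norm (x + axis i s) > r" "norm x > r"
        using False s(1) norm_triangle_ineq4[of "x + axis i s" "axis i s"] norm_ge_zero[of "axis i s"]
        by (auto simp: norm_axis_real)
      then have "?d m x = 0" unfolding s(2) by (simp add: r)
      then show ?thesis using p M(1) by (simp add: indicator_def power_0_left)
    qed
  qed
  have lim: "(\<lambda>m. \<bar>?d m x\<bar> ^ p) \<longlonglongrightarrow> 0" for x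
  proof -
    have "((\<lambda>t. f (x + axis i t)) has_real_derivative partial i f (x + axis i 0)) (at 0)"
      by (rule has_real_derivative_line) (rule test_differentiable[OF f])
    then have "((\<lambda>h. (f (x + axis i (0 + h)) - f (x + axis i 0)) / h) \<longlongrightarrow> partial i f (x + axis i 0)) (at 0)"
      unfolding DERIV_def .
    then have D: "((\<lambda>h. (f (x + axis i h) - f x) / h) \<longlongrightarrow> partial i f x) (at 0)"
      by (simp add: axis_zero)
    have k0: "filterlim k (at 0) sequentially"
      using k by (simp add: filterlim_at)
    have "(\<lambda>m. ?d m x) \<longlonglongrightarrow> partial i f x - partial i f x"
      by (intro tendsto_diff tendsto_const filterlim_compose[OF D k0])
    then have "(\<lambda>m. ?d m x) \<longlonglongrightarrow> 0" by simp
    then have "(\<lambda>m. \<bar>?d m x\<bar> ^ p) \<longlonglongrightarrow> \<bar>0\<bar> ^ p" by (intro tendsto_intros)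
    moreover have "\<bar>0::real\<bar> ^ p = 0" using p by (simp add: power_0_left)
    ultimately show ?thesis by (simp only:)
  qed
  have cd: "Cc (?d m)" for m
    using Cc_diff[OF Cc_divide[OF Cc_diff[OF Cc_shift[OF test_Cc[OF f], of "axis i (k m)"] test_Cc[OF f]], of "k m"] pf]
    by (simp add: shift_def)
  have "(\<lambda>m. (\<integral>x. \<bar>?d m x\<bar> ^ p \<partial>lebesgue)) \<longlonglongrightarrow> (\<integral>x. 0 \<partial>(lebesgue :: (real ^ 'a) measure))"
  proof (rule integral_dominated_convergence[where w="\<lambda>x. (2 * M) ^ p * indicator (cball 0 (r + K)) x"])
    show "integrable lebesgue (\<lambda>x::(real ^ 'a). (2 * M) ^ p * indicator (cball 0 (r + K)) x)"
      by (intro integrable_mult_right integrable_real_indicator) (use emeasure_bounded_finite[of "cball (0::real ^ 'a) (r + K)"] in auto)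
    show "(\<lambda>x. \<bar>?d m x\<bar> ^ p) \<in> borel_measurable lebesgue" for m
      using Cc_integrable[OF Cc_abs_power[OF cd p]] by (rule borel_measurable_integrable)
    show "AE x in lebesgue. norm (\<bar>?d m x\<bar> ^ p) \<le> (2 * M) ^ p * indicator (cball 0 (r + K)) x" for m
    proof (rule AE_I2)
      fix x
      show "norm (\<bar>?d m x\<bar> ^ p) \<le> (2 * M) ^ p * indicator (cball 0 (r + K)) x"
        using bound[where m=m and x=x] by (simp only: norm_power real_norm_def abs_idempotent power_abs)
    qed
    show "AE x in lebesgue. (\<lambda>m. \<bar>?d m x\<bar> ^ p) \<longlonglongrightarrow> 0"
      by (rule AE_I2) (rule lim)
  qed simp
  then show ?thesis by (simp add: pint_def)
qed

lemma integral_partial_eq_0: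
  assumes f: "test_function f"
  shows "(\<integral>x. partial i f x \<partial>lebesgue) = 0"
proof -
  define k where "k m = 1 / real (Suc m)" for m
  have k: "k \<longlonglongrightarrow> 0" "k m \<noteq> 0" for m
    unfolding k_def using LIMSEQ_inverse_real_of_nat by (auto simp: inverse_eq_divide)
  let ?d = "\<lambda>m x. (f (x + axis i (k m)) - f x) / k m"
  have cs: "Cc (shift y f)" for y using f by (intro Cc_shift test_Cc)
  have cf: "Cc f" and cp: "Cc (partial i f)" by (intro test_Cc test_partial f)+
  have cd: "Cc (?d m)" for m
    using Cc_divide[OF Cc_diff[OF cs[of "axis i (k m)"] cf], of "k m"] by (simp add: shift_def)
  have d0: "(\<integral>x. ?d m x \<partial>lebesgue) = 0" for m
  proof -
    have "(\<integral>x. shift (axis i (k m)) f x - f x \<partial>lebesgue) = 0"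
      using Cc_integral_shift[OF cf, of "axis i (k m)"] Cc_integrable[OF cf] Cc_integrable[OF cs[of "axis i (k m)"]]
      by simp
    then show ?thesis by (simp add: shift_def)
  qed
  have "\<bar>\<integral>x. partial i f x \<partial>lebesgue\<bar> \<le> pint 1 (\<lambda>x. ?d m x - partial i f x)" for m
  proof -
    have "(\<integral>x. ?d m x - partial i f x \<partial>lebesgue) = - (\<integral>x. partial i f x \<partial>lebesgue)"
      using d0[of m] Cc_integrable[OF cd[of m]] Cc_integrable[OF cp] by simp
    moreover have "\<bar>\<integral>x. ?d m x - partial i f x \<partial>lebesgue\<bar> \<le> (\<integral>x. \<bar>?d m x - partial i f x\<bar> \<partial>lebesgue)"
      by (rule integral_abs_bound)
    ultimately show ?thesis by (simp add: pint_def)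
  qed
  moreover have "(\<lambda>m. pint 1 (\<lambda>x. ?d m x - partial i f x)) \<longlonglongrightarrow> 0"
    by (rule diff_quotient_tendsto[OF f k]) simp
  ultimately have "\<bar>\<integral>x. partial i f x \<partial>lebesgue\<bar> \<le> 0"
    by (intro LIMSEQ_le_const) auto
  then show ?thesis by simp
qed

lemma integration_by_parts:
  assumes f: "test_function f" and g: "smooth g"
  shows "(\<integral>x. g x * partial i f x \<partial>lebesgue) = - (\<integral>x. partial i g x * f x \<partial>lebesgue)"
proof -
  have p: "partial i (\<lambda>x. g x * f x) x = g x * partial i f x + partial i g x * f x" for x
    by (rule partial_mult) (auto intro: smooth_differentiable[OF g] test_differentiable[OF f])
  have c: "integrable lebesgue (\<lambda>x. g x * partial i f x)" "integrable lebesgue (\<lambda>x. partial i g x * f x)"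
    by (intro Cc_integrable Cc_mult_right test_Cc test_partial f smooth_continuous smooth_partial g)+
  have "(\<integral>x. partial i (\<lambda>x. g x * f x) x \<partial>lebesgue) = 0"
    by (intro integral_partial_eq_0 test_mult_smooth f g)
  then show ?thesis unfolding p using c by simp
qed

text \<open>A quantitative Taylor formula in \<open>L\<^sup>p\<close>. Dividing the step into \<open>m\<close> equal pieces
  reduces it, by translation invariance, to the previous convergence as \<open>m\<close> grows; no
  integration along the segment is needed.\<close>

lemma taylor_pint:
  assumes f: "test_function f" and q: "Cc q" and p: "p \<ge> 1"
    and M: "\<And>s. \<bar>s\<bar> \<le> \<bar>h\<bar> \<Longrightarrow> pint p (\<lambda>x. partial i f (x + axis i s) - q x) \<le> M"
  shows "pint p (\<lambda>x. f (x + axis i h) - f x - h * q x) \<le> 2 ^ (p - 1) * \<bar>h\<bar> ^ p * M"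
proof (cases "h = 0")
  case True
  have "(\<lambda>x. f (x + axis i h) - f x - h * q x) = (\<lambda>x. 0 * q x)"
    using True by (simp add: axis_zero)
  then show ?thesis using p True by (simp only: pint_scale) (simp add: power_0_left)
next
  case False
  have cf: "Cc f" and cp: "Cc (partial i f)" by (intro test_Cc test_partial f)+
  define k where "k m = h / real (Suc m)" for m
  define r where "r m x = f (x + axis i (k m)) - f x - k m * partial i f x" for m x
  have kn: "k m \<noteq> 0" for m using False by (simp add: k_def)
  have k: "k \<longlonglongrightarrow> 0"
    unfolding k_def using tendsto_mult_right_zero[OF LIMSEQ_inverse_real_of_nat, of h]
    by (simp add: divide_inverse)
  have cr: "Cc (r m)" for m
    using Cc_diff[OF Cc_diff[OF Cc_shift[OF cf, of "axis i (k m)"] cf] Cc_scale[OF cp, of "k m"]]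
    by (simp add: r_def[abs_def] shift_def)
  have cq: "Cc (\<lambda>x. partial i f (x + axis i s) - q x)" for s
    using Cc_diff[OF Cc_shift[OF cp, of "axis i s"] q] by (simp add: shift_def)
  have step: "pint p (\<lambda>x. f (x + axis i h) - f x - h * q x)
      \<le> 2 ^ (p - 1) * (\<bar>h\<bar> ^ p * pint p (\<lambda>x. (f (x + axis i (k m)) - f x) / k m - partial i f x) + \<bar>h\<bar> ^ p * M)" for m
  proof -
    let ?n = "Suc m"
    let ?y = "\<lambda>j. axis i (real j * k m)"
    have h: "h = real ?n * k m" by (simp add: k_def)
    have "f (x + axis i h) - f x - h * q x
      = (\<Sum>j<?n. shift (?y j) (r m) x) + (\<Sum>j<?n. k m * (partial i f (x + ?y j) - q x))" for x
    proof -
      have "f (x + axis i h) - f x = (\<Sum>j<?n. f (x + ?y (Suc j)) - f (x + ?y j))"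
        by (subst sum_lessThan_telescope) (simp add: h axis_zero)
      moreover have "h * q x = (\<Sum>j<?n. k m * q x)" by (simp add: h)
      ultimately show ?thesis
        by (simp only: sum_subtractf[symmetric] sum.distrib[symmetric])
           (rule sum.cong, auto simp: shift_def r_def algebra_simps axis_add)
    qed
    then have "pint p (\<lambda>x. f (x + axis i h) - f x - h * q x)
      = pint p (\<lambda>x. (\<Sum>j<?n. shift (?y j) (r m) x) + (\<Sum>j<?n. k m * (partial i f (x + ?y j) - q x)))"
      by simp
    also have "\<dots> \<le> 2 ^ (p - 1) * (pint p (\<lambda>x. \<Sum>j<?n. shift (?y j) (r m) x)
        + pint p (\<lambda>x. \<Sum>j<?n. k m * (partial i f (x + ?y j) - q x)))"
      by (intro pint_add_le p Cc_sum Cc_shift cr Cc_scale cq)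
    also have "\<dots> \<le> 2 ^ (p - 1) * (\<bar>h\<bar> ^ p * pint p (\<lambda>x. (f (x + axis i (k m)) - f x) / k m - partial i f x) + \<bar>h\<bar> ^ p * M)"
    proof (intro mult_left_mono add_mono)
      have np: "real ?n ^ (p - 1) * real ?n = real ?n ^ p"
        using p power_minus_mult[of p "real ?n"] by simp
      have hk: "real ?n ^ p * \<bar>k m\<bar> ^ p = \<bar>h\<bar> ^ p"
        by (simp only: h abs_mult power_mult_distrib abs_of_nat)
      have "pint p (\<lambda>x. \<Sum>j<?n. shift (?y j) (r m) x) \<le> real ?n ^ (p - 1) * (\<Sum>j<?n. pint p (shift (?y j) (r m)))"
        by (intro pint_sum_le p Cc_shift cr)
      also have "\<dots> = real ?n ^ p * pint p (r m)"
        using np by (simp add: pint_shift[OF cr p])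
      also have "pint p (r m) = \<bar>k m\<bar> ^ p * pint p (\<lambda>x. (f (x + axis i (k m)) - f x) / k m - partial i f x)"
      proof -
        have "r m = (\<lambda>x. k m * ((f (x + axis i (k m)) - f x) / k m - partial i f x))"
          using kn by (auto simp: r_def field_simps)
        then show ?thesis by (simp only: pint_scale)
      qed
      finally show "pint p (\<lambda>x. \<Sum>j<?n. shift (?y j) (r m) x) \<le>
          \<bar>h\<bar> ^ p * pint p (\<lambda>x. (f (x + axis i (k m)) - f x) / k m - partial i f x)"
        by (simp only: mult.assoc[symmetric] hk)
      have "pint p (\<lambda>x. \<Sum>j<?n. k m * (partial i f (x + ?y j) - q x))
          \<le> real ?n ^ (p - 1) * (\<Sum>j<?n. pint p (\<lambda>x. k m * (partial i f (x + ?y j) - q x)))"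
        by (intro pint_sum_le p Cc_scale cq)
      also have "\<dots> \<le> real ?n ^ (p - 1) * (\<Sum>j<?n. \<bar>k m\<bar> ^ p * M)"
      proof (intro mult_left_mono sum_mono)
        fix j assume "j \<in> {..<?n}"
        then have "\<bar>real j * k m\<bar> \<le> \<bar>h\<bar>" unfolding h abs_mult
          by (intro mult_right_mono) auto
        from M[OF this] show "pint p (\<lambda>x. k m * (partial i f (x + ?y j) - q x)) \<le> \<bar>k m\<bar> ^ p * M"
          unfolding pint_scale by (intro mult_left_mono) auto
      qed simp
      also have "\<dots> = (real ?n ^ (p - 1) * real ?n) * \<bar>k m\<bar> ^ p * M" by simp
      also have "\<dots> = \<bar>h\<bar> ^ p * M" by (simp only: np hk)
      finally show "pint p (\<lambda>x. \<Sum>j<?n. k m * (partial i f (x + ?y j) - q x)) \<le> \<bar>h\<bar> ^ p * M" .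
    qed simp
    finally show ?thesis .
  qed
  have "(\<lambda>m. 2 ^ (p - 1) * (\<bar>h\<bar> ^ p * pint p (\<lambda>x. (f (x + axis i (k m)) - f x) / k m - partial i f x) + \<bar>h\<bar> ^ p * M))
     \<longlonglongrightarrow> 2 ^ (p - 1) * (\<bar>h\<bar> ^ p * 0 + \<bar>h\<bar> ^ p * M)"
    by (intro tendsto_intros diff_quotient_tendsto f k kn p)
  from LIMSEQ_le_const[OF this, of "pint p (\<lambda>x. f (x + axis i h) - f x - h * q x)"] step
  show ?thesis by simp
qed

section \<open>An anisotropic Gagliardo--Nirenberg inequality\<close>

lemma Cc_line_bound:
  fixes F G :: "real \<Rightarrow> real"
  assumes F: "Cc F" and G: "Cc G" and D: "\<And>t. (F has_real_derivative G t) (at t)"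
  shows "F s = (\<integral>t. indicator {..s} t * G t \<partial>lborel)"
    "\<bar>F s\<bar> \<le> (\<integral>t. \<bar>G t\<bar> \<partial>lborel)" "(\<integral>t. G t \<partial>lborel) = 0"
proof -
  obtain r where r: "r > 0" "\<And>t. norm t > r \<Longrightarrow> F t = 0" using Cc_radius[OF F] by blast
  obtain r' where r': "r' > 0" "\<And>t. norm t > r' \<Longrightarrow> G t = 0" using Cc_radius[OF G] by blast
  have Gc: "isCont G t" for t
    using Cc_continuous[OF G] by (simp add: continuous_on_eq_continuous_at)
  have eq: "F s = (\<integral>t. indicator {..s} t * G t \<partial>lborel)" for s
  proof -
    define a where "a = - (\<bar>s\<bar> + r + r' + 1)"
    have as: "a \<le> s" and a: "a < - r" "a < - r'" using r(1) r'(1) by (auto simp: a_def)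
    have "F s - F a = (\<integral>t. G t * indicator {a..s} t \<partial>lborel)"
      by (rule integral_FTC_Icc_real[symmetric]) (auto simp: as D Gc)
    also have "(\<lambda>t. G t * indicator {a..s} t) = (\<lambda>t. indicator {..s} t * G t)"
      using r'(2) a by (force simp: indicator_def)
    finally show ?thesis using r(2)[of a] a(1) by simp
  qed
  show "F s = (\<integral>t. indicator {..s} t * G t \<partial>lborel)" by (rule eq)
  have iG: "integrable lborel G" by (rule Cc_integrable_lborel[OF G])
  have iI: "integrable lborel (\<lambda>t. indicator {..s} t * G t)"
    using integrable_mult_indicator[OF _ iG, of "{..s}"] by simp
  have "\<bar>F s\<bar> \<le> (\<integral>t. \<bar>indicator {..s} t * G t\<bar> \<partial>lborel)"
    unfolding eq by (rule integral_abs_bound)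
  also have "\<dots> \<le> (\<integral>t. \<bar>G t\<bar> \<partial>lborel)"
    by (intro integral_mono integrable_abs iG iI) (auto simp: indicator_def)
  finally show "\<bar>F s\<bar> \<le> (\<integral>t. \<bar>G t\<bar> \<partial>lborel)" .
  define b where "b = r + r' + 1"
  have b: "b > r" "b > r'" using r(1) r'(1) by (auto simp: b_def)
  have "(\<lambda>t. indicator {..b} t * G t) = G"
    using r'(2) b by (force simp: indicator_def)
  then show "(\<integral>t. G t \<partial>lborel) = 0" using eq[of b] r(2)[of b] b by simp
qed

lemma Cc_compose_isometry:
  fixes L :: "'a::euclidean_space \<Rightarrow> 'b::euclidean_space"
  assumes f: "Cc f" and L: "continuous_on UNIV L" "\<And>x. norm (L x) = norm x"
  shows "Cc (\<lambda>x. f (z + L x))"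
proof -
  obtain r where r: "\<And>t. norm t > r \<Longrightarrow> f t = 0" using Cc_radius[OF f] by blast
  have zero: "f (z + L x) = 0" if "norm x > r + norm z" for x
  proof (rule r)
    show "norm (z + L x) > r"
      using norm_triangle_ineq4[of "z + L x" z] that L(2)[of x] by simp
  qed
  have "continuous_on UNIV (\<lambda>x. f (z + L x))"
    by (rule continuous_on_compose2[OF Cc_continuous[OF f]])
       (intro continuous_on_add continuous_on_const L(1), simp)
  from CcI[OF this zero] show ?thesis by blast
qed

lemma continuous_on_axis: "continuous_on UNIV (\<lambda>t::real. axis i t :: real ^ 'n::finite)"
proof -
  have eq: "(\<lambda>t. t *\<^sub>R (axis i 1 :: real ^ 'n)) = (\<lambda>t. axis i t)" by (auto simp: axis_def vec_eq_iff)
  have "continuous_on UNIV (\<lambda>t. t *\<^sub>R (axis i 1 :: real ^ 'n))"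
    by (intro continuous_on_scaleR continuous_on_id continuous_on_const)
  then show ?thesis by (simp only: eq)
qed

lemma Cc_line:
  fixes f :: "real ^ 'n::finite \<Rightarrow> real"
  assumes "Cc f" shows "Cc (\<lambda>t. f (z + axis i t))"
  using Cc_compose_isometry[OF assms continuous_on_axis, of i z] by (simp add: norm_axis_real)

lemma norm_axis_pair:
  assumes "i \<noteq> j"
  shows "norm (axis i a + axis j b :: real ^ 'n) = norm (a, b)"
proof -
  have "(norm (axis i a + axis j b :: real ^ 'n))\<^sup>2 = a\<^sup>2 + b\<^sup>2"
    using assms unfolding power2_norm_eq_inner
    by (simp add: inner_add_left inner_add_right inner_axis_axis power2_eq_square)
  then show ?thesis by (simp add: norm_Pair real_sqrt_unique)
qed

lemma Cc_plane:
  fixes f :: "real ^ 'n::finite \<Rightarrow> real"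
  assumes "i \<noteq> j" "Cc f" shows "Cc (\<lambda>p. f (z + axis i (fst p) + axis j (snd p)))"
proof -
  have "continuous_on UNIV (\<lambda>p::real \<times> real. axis i (fst p) + axis j (snd p) :: real ^ 'n)"
    by (intro continuous_on_add continuous_on_compose2[OF continuous_on_axis] continuous_on_fst continuous_on_snd continuous_on_id) auto
  from Cc_compose_isometry[OF assms(2) this, of z] assms(1) show ?thesis
    by (simp add: norm_axis_pair add.assoc)
qed

text \<open>Since \<open>f\<close> vanishes at infinity, \<open>f\<^sup>2\<close> is at most the integral of \<open>\<bar>2 f f'\<bar>\<close> over the line, and
  Cauchy--Schwarz applies; the fourth power keeps square roots out of the statement.\<close>

lemma line_sup_bound:
  assumes f: "test_function f"
  shows "(f (z + axis i s)) ^ 4 \<le>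
    4 * (\<integral>t. (f (z + axis i t))\<^sup>2 \<partial>lborel) * (\<integral>t. (partial i f (z + axis i t))\<^sup>2 \<partial>lborel)"
proof -
  let ?f = "\<lambda>t. f (z + axis i t)" and ?g = "\<lambda>t. partial i f (z + axis i t)"
  have c: "Cc ?f" "Cc ?g" by (intro Cc_line test_Cc test_partial f)+
  have D: "((\<lambda>t. (?f t)\<^sup>2) has_real_derivative 2 * (?f t * ?g t)) (at t)" for t
    by (rule DERIV_cong[OF DERIV_power[OF has_real_derivative_line]])
       (auto intro: test_differentiable f)
  have "\<bar>(?f s)\<^sup>2\<bar> \<le> (\<integral>t. \<bar>2 * (?f t * ?g t)\<bar> \<partial>lborel)"
    using Cc_line_bound(2)[OF Cc_power[OF c(1)] Cc_scale[OF Cc_mult[OF c]] D] by simp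
  then have 1: "(?f s)\<^sup>2 \<le> 2 * (\<integral>t. \<bar>?f t * ?g t\<bar> \<partial>lborel)"
    by (simp add: abs_mult)
  have 2: "(\<integral>t. \<bar>?f t * ?g t\<bar> \<partial>lborel)\<^sup>2 \<le> (\<integral>t. (?f t)\<^sup>2 \<partial>lborel) * (\<integral>t. (?g t)\<^sup>2 \<partial>lborel)"
    by (rule Cauchy_Schwarz_integral) (simp_all add: Cc_integrable_lborel[OF Cc_power] Cc_borel c)
  have "(?f s) ^ 4 = ((?f s)\<^sup>2)\<^sup>2" by simp
  also have "\<dots> \<le> (2 * (\<integral>t. \<bar>?f t * ?g t\<bar> \<partial>lborel))\<^sup>2"
    by (rule power_mono[OF 1]) simp
  finally show ?thesis using 2 by (simp add: power_mult_distrib mult.assoc)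
qed

text \<open>The key point: for \<open>u = \<partial>\<^sub>i\<phi>\<close>, the function \<open>\<integral>u\<^sup>2 dx\<^sub>i\<close> of the other variables has
  \<open>x\<^sub>j\<close>-derivative \<open>2\<integral>u \<partial>\<^sub>i\<partial>\<^sub>j\<phi> dx\<^sub>i = -2\<integral>\<partial>\<^sub>iu \<partial>\<^sub>j\<phi> dx\<^sub>i\<close>, which is controlled although \<open>\<partial>\<^sub>ju\<close> is not.\<close>

lemma line_mass_bound:
  assumes \<phi>: "test_function \<phi>" and ij: "i \<noteq> j"
  shows "(\<integral>t. (partial i \<phi> (z + axis i t))\<^sup>2 \<partial>lborel) \<le>
    2 * (\<integral>p. \<bar>partial i (partial i \<phi>) (z + axis i (fst p) + axis j (snd p)) *
                partial j \<phi> (z + axis i (fst p) + axis j (snd p))\<bar> \<partial>lborel)"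
proof -
  define u where "u = partial i \<phi>"
  define w where "w = partial i u"
  define r where "r = partial j \<phi>"
  have t: "test_function u" "test_function w" "test_function r" "test_function (partial j u)"
    unfolding u_def w_def r_def by (intro test_partial \<phi>)+
  have comm: "partial j u = partial i r"
    unfolding u_def r_def by (rule partial_commute[OF test_smooth[OF \<phi>]])
  let ?P = "\<lambda>t s. z + axis i t + axis j s"
  have cp: "Cc (\<lambda>p. f (?P (fst p) (snd p)))" if "Cc f" for f :: "real ^ 'a \<Rightarrow> real"
    by (rule Cc_plane[OF ij that])
  let ?g = "\<lambda>p. indicator {..0::real} (snd p) * (2 * (partial j u (?P (fst p) (snd p)) * u (?P (fst p) (snd p))))"
  have aux: "indicator A c * (- 2 * X) \<le> 2 * \<bar>X\<bar>" for A :: "real set" and c X :: real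
  proof (cases "c \<in> A")
    case True
    then have "indicator A c * (- 2 * X) = - 2 * X" by simp
    then show ?thesis by linarith
  qed simp
  have meas: "{p::real \<times> real. snd p \<le> 0} \<in> sets borel"
    by (intro borel_closed closed_Collect_le continuous_on_snd continuous_on_id continuous_on_const)
  have ig: "integrable lborel (\<lambda>p::real\<times>real. indicator {..0::real} (snd p) * F p)" if "Cc F" for F
  proof -
    have "integrable lborel (\<lambda>p. indicator {p::real \<times> real. snd p \<le> 0} p *\<^sub>R F p)"
      using meas by (intro integrable_mult_indicator Cc_integrable_lborel that) simp
    then show ?thesis by (simp add: indicator_def)
  qed
  have c1: "Cc (\<lambda>p. 2 * (partial j u (?P (fst p) (snd p)) * u (?P (fst p) (snd p))))"
    by (intro Cc_scale Cc_mult cp test_Cc t)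
  have "(u (z + axis i t))\<^sup>2 = (\<integral>s. ?g (t, s) \<partial>lborel)" for t
  proof -
    let ?F = "\<lambda>s. (u (?P t s))\<^sup>2" and ?G = "\<lambda>s. 2 * (partial j u (?P t s) * u (?P t s))"
    have "(?F has_real_derivative ?G s) (at s)" for s
      by (rule DERIV_cong[OF DERIV_power[OF has_real_derivative_line]])
         (auto intro: test_differentiable t)
    moreover have "Cc ?F" by (rule Cc_power[OF Cc_line[OF test_Cc]]) (simp_all add: t)
    moreover have "Cc ?G" by (intro Cc_scale Cc_mult Cc_line test_Cc t)
    ultimately have "?F 0 = (\<integral>s. indicator {..0} s * ?G s \<partial>lborel)"
      using Cc_line_bound(1)[of ?F ?G 0] by blast
    then show ?thesis by (simp add: axis_zero)
  qed
  then have "(\<integral>t. (u (z + axis i t))\<^sup>2 \<partial>lborel) = (\<integral>t. (\<integral>s. ?g (t, s) \<partial>lborel) \<partial>lborel)"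
    by simp
  also have "\<dots> = (\<integral>s. (\<integral>t. ?g (t, s) \<partial>lborel) \<partial>lborel)"
    using ig[OF c1] by (intro lborel_pair.Fubini_integral[symmetric]) (simp add: lborel_prod case_prod_beta')
  also have "\<dots> = (\<integral>s. (\<integral>t. indicator {..0} s * (- 2 * (w (?P t s) * r (?P t s))) \<partial>lborel) \<partial>lborel)"
  proof (rule Bochner_Integration.integral_cong[OF refl])
    fix s
    have sw: "?P t s = (z + axis j s) + axis i t" for t by (simp add: algebra_simps)
    let ?F = "\<lambda>t. u (?P t s) * r (?P t s)"
    let ?G = "\<lambda>t. w (?P t s) * r (?P t s) + partial i r (?P t s) * u (?P t s)"
    have "(?F has_real_derivative ?G t) (at t)" for t
      unfolding sw w_def
      by (intro DERIV_mult has_real_derivative_line test_differentiable t)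
    moreover have cc: "Cc (\<lambda>t. w (?P t s) * r (?P t s))" "Cc (\<lambda>t. partial i r (?P t s) * u (?P t s))" "Cc ?F"
      unfolding sw by (intro Cc_mult Cc_line test_Cc t test_partial)+
    moreover have "Cc ?G" by (rule Cc_add[OF cc(1,2)])
    ultimately have "(\<integral>t. ?G t \<partial>lborel) = 0"
      using Cc_line_bound(3)[of ?F ?G] by blast
    then have "(\<integral>t. partial i r (?P t s) * u (?P t s) \<partial>lborel) = - (\<integral>t. w (?P t s) * r (?P t s) \<partial>lborel)"
      using Cc_integrable_lborel[OF cc(1)] Cc_integrable_lborel[OF cc(2)] by simp
    then show "(\<integral>t. ?g (t, s) \<partial>lborel) = (\<integral>t. indicator {..0} s * (- 2 * (w (?P t s) * r (?P t s))) \<partial>lborel)"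
      by (simp add: comm)
  qed
  also have "\<dots> = (\<integral>p. indicator {..0} (snd p) * (- 2 * (w (?P (fst p) (snd p)) * r (?P (fst p) (snd p)))) \<partial>lborel)"
  proof -
    have "Cc (\<lambda>p. - 2 * (w (?P (fst p) (snd p)) * r (?P (fst p) (snd p))))"
      by (intro Cc_scale Cc_mult cp test_Cc t)
    from lborel_pair.integral_snd[of "\<lambda>t s. indicator {..0} s * (- 2 * (w (?P t s) * r (?P t s)))"] ig[OF this]
    show ?thesis by (simp add: lborel_prod case_prod_beta')
  qed
  also have "\<dots> \<le> (\<integral>p. 2 * \<bar>w (?P (fst p) (snd p)) * r (?P (fst p) (snd p))\<bar> \<partial>lborel)"
  proof (intro integral_mono ig Cc_integrable_lborel)
    show "Cc (\<lambda>p. - 2 * (w (?P (fst p) (snd p)) * r (?P (fst p) (snd p))))"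
      by (intro Cc_scale Cc_mult cp test_Cc t)
    show "Cc (\<lambda>p. 2 * \<bar>w (?P (fst p) (snd p)) * r (?P (fst p) (snd p))\<bar>)"
      by (intro Cc_scale Cc_abs Cc_mult cp test_Cc t)
    show "indicator {..0} (snd p) * (- 2 * (w (?P (fst p) (snd p)) * r (?P (fst p) (snd p))))
        \<le> 2 * \<bar>w (?P (fst p) (snd p)) * r (?P (fst p) (snd p))\<bar>" for p :: "real \<times> real"
      by (rule aux)
  qed
  also have "\<dots> = 2 * (\<integral>p. \<bar>w (?P (fst p) (snd p)) * r (?P (fst p) (snd p))\<bar> \<partial>lborel)" by simp
  finally show ?thesis by (simp add: u_def w_def r_def)
qed

definition KP_sq :: "(real ^ 'n::{finite,one} \<Rightarrow> real) \<Rightarrow> real" where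
  "KP_sq \<phi> = (\<Sum>j\<in>UNIV. pint 2 (partial j \<phi>)) + pint 2 (partial 1 (partial 1 \<phi>))"

lemma KP_sq_nonneg: "KP_sq \<phi> \<ge> 0"
  unfolding KP_sq_def by (intro add_nonneg_nonneg sum_nonneg pint_nonneg)

lemma pint_partial_le_KP_sq: "pint 2 (partial j \<phi>) \<le> KP_sq \<phi>"
proof -
  have "pint 2 (partial j \<phi>) \<le> (\<Sum>j\<in>UNIV. pint 2 (partial j \<phi>))"
    by (rule member_le_sum) (simp_all add: pint_nonneg)
  then show ?thesis unfolding KP_sq_def using pint_nonneg[of 2 "partial 1 (partial 1 \<phi>)"] by linarith
qed

lemma pint_partial2_le_KP_sq: "pint 2 (partial 1 (partial 1 \<phi>)) \<le> KP_sq \<phi>"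
  unfolding KP_sq_def by (simp add: sum_nonneg pint_nonneg)

lemma pint_nn_integral:
  assumes "Cc f" "p \<ge> 1"
  shows "(\<integral>\<^sup>+x. ennreal (\<bar>f x\<bar> ^ p) \<partial>lborel) = ennreal (pint p f)"
  using nn_integral_eq_integral[OF Cc_integrable_lborel[OF Cc_abs_power[OF assms]]]
  by (simp add: pint_def Cc_integral_lborel[OF Cc_abs_power[OF assms]])

lemma nn_integral_slices:
  fixes S :: "'e::euclidean_space \<Rightarrow> real ^ 'n::{finite,one}"
  assumes T: "distr (lborel :: (real \<times> 'e) measure) borel (\<lambda>p. axis 1 (fst p) + S (snd p)) = lborel"
    and S: "continuous_on UNIV S" and g: "g \<in> borel_measurable borel"
  shows "(\<integral>\<^sup>+z. g z \<partial>lborel) = (\<integral>\<^sup>+y. (\<integral>\<^sup>+t. g (S y + axis 1 t) \<partial>lborel) \<partial>lborel)"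
proof -
  let ?T = "\<lambda>p::real \<times> 'e. axis 1 (fst p) + S (snd p)"
  have "continuous_on UNIV ?T"
    by (intro continuous_on_add continuous_on_compose2[OF continuous_on_axis]
        continuous_on_compose2[OF S] continuous_on_fst continuous_on_snd continuous_on_id) auto
  then have Tm: "?T \<in> borel_measurable borel" by (rule borel_measurable_continuous_onI)
  have gT: "(\<lambda>p. g (?T p)) \<in> borel_measurable borel"
    using measurable_compose[OF Tm g] .
  have "(\<integral>\<^sup>+z. g z \<partial>lborel) = (\<integral>\<^sup>+z. g z \<partial>distr (lborel :: (real \<times> 'e) measure) borel ?T)"
    by (simp only: T)
  also have "\<dots> = (\<integral>\<^sup>+p. g (?T p) \<partial>lborel)"
    by (rule nn_integral_distr) (use Tm g in simp_all)
  also have "\<dots> = (\<integral>\<^sup>+p. g (?T p) \<partial>(lborel \<Otimes>\<^sub>M lborel))" by (simp only: lborel_prod)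
  also have "\<dots> = (\<integral>\<^sup>+y. (\<integral>\<^sup>+t. g (?T (t, y)) \<partial>lborel) \<partial>lborel)"
    by (rule lborel_pair.nn_integral_snd[symmetric]) (simp only: lborel_prod measurable_lborel2 gT)
  finally show ?thesis by (simp add: add.commute)
qed

lemma borel_measurable_slice_integral:
  fixes S :: "'e::euclidean_space \<Rightarrow> 'b::euclidean_space" and L :: "'d::euclidean_space \<Rightarrow> 'b"
  assumes S: "continuous_on UNIV S" and L: "continuous_on UNIV L" and f: "continuous_on UNIV (f :: 'b \<Rightarrow> real)"
  shows "(\<lambda>y. \<integral>t. f (S y + L t) \<partial>lborel) \<in> borel_measurable lborel"
proof (rule lborel.borel_measurable_lebesgue_integral)
  have "continuous_on UNIV (\<lambda>p. f (S (fst p) + L (snd p)))"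
    by (intro continuous_on_compose2[OF f] continuous_on_add continuous_on_compose2[OF L]
        continuous_on_compose2[OF S] continuous_on_fst continuous_on_snd continuous_on_id) auto
  then have "(\<lambda>p. f (S (fst p) + L (snd p))) \<in> borel_measurable borel"
    by (rule borel_measurable_continuous_onI)
  then show "(\<lambda>(y, t). f (S y + L t)) \<in> borel_measurable (lborel \<Otimes>\<^sub>M lborel)"
    by (simp only: lborel_prod measurable_lborel2 case_prod_beta')
qed

text \<open>On each line the supremum of \<open>u\<^sup>2\<close> is at most \<open>2 sqrt (A B)\<close>, where \<open>A\<close> and \<open>B\<close> are the
  integrals of \<open>u\<^sup>2\<close> and of \<open>(\<partial>\<^sub>1 u)\<^sup>2\<close> over that line. So \<open>\<integral>\<bar>u\<bar>\<^sup>3\<close> is at most the integral of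
  \<open>A (4AB)\<^sup>1\<^sup>/\<^sup>4\<close> over all lines, and two uses of Cauchy--Schwarz reduce this to a bound on the integral of
  \<open>A\<^sup>2\<close>.\<close>

lemma cube_bound_from_mass:
  fixes S :: "'e::euclidean_space \<Rightarrow> real ^ 'n::{finite,one}"
  assumes T: "distr (lborel :: (real \<times> 'e) measure) borel (\<lambda>p. axis 1 (fst p) + S (snd p)) = lborel"
    and S: "continuous_on UNIV S"
    and u: "test_function u" and K: "K \<ge> 0"
    and mass: "(\<integral>\<^sup>+y. (ennreal (\<integral>t. (u (S y + axis 1 t))\<^sup>2 \<partial>lborel))\<^sup>2 \<partial>lborel) \<le> ennreal K"
  shows "pint 3 u ^ 4 \<le> 4 * K\<^sup>2 * pint 2 u * pint 2 (partial 1 u)"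
proof -
  define A B where "A y = (\<integral>t. (u (S y + axis 1 t))\<^sup>2 \<partial>lborel)"
    and "B y = (\<integral>t. (partial 1 u (S y + axis 1 t))\<^sup>2 \<partial>lborel)" for y
  define D where "D y = sqrt (2 * sqrt (A y * B y))" for y
  have cu: "Cc u" and cw: "Cc (partial 1 u)" by (intro test_Cc test_partial u)+
  have sq: "Cc (\<lambda>x. (f x)\<^sup>2)" if "Cc f" for f :: "'x::euclidean_space \<Rightarrow> real" using Cc_power[OF that] by simp
  have AB: "A y \<ge> 0" "B y \<ge> 0" for y by (simp_all add: A_def B_def)
  have mA: "A \<in> borel_measurable lborel" and mB: "B \<in> borel_measurable lborel"
    unfolding A_def[abs_def] B_def[abs_def]
    by (rule borel_measurable_slice_integral[OF S continuous_on_axis Cc_continuous[OF sq]], rule cu)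
       (rule borel_measurable_slice_integral[OF S continuous_on_axis Cc_continuous[OF sq]], rule cw)
  have mD: "D \<in> borel_measurable lborel" unfolding D_def[abs_def] using mA mB by simp
  have slice: "(\<integral>\<^sup>+t. ennreal ((f (S y + axis 1 t))\<^sup>2) \<partial>lborel) = ennreal (\<integral>t. (f (S y + axis 1 t))\<^sup>2 \<partial>lborel)"
    if "Cc f" for f y
    by (rule nn_integral_eq_integral[OF Cc_integrable_lborel[OF sq[OF Cc_line[OF that]]]]) simp
  have tot: "(\<integral>\<^sup>+y. ennreal (\<integral>t. (f (S y + axis 1 t))\<^sup>2 \<partial>lborel) \<partial>lborel) = ennreal (pint 2 f)"
    if f: "Cc f" for f
  proof -
    have "ennreal (pint 2 f) = (\<integral>\<^sup>+z. ennreal ((f z)\<^sup>2) \<partial>lborel)"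
      using pint_nn_integral[OF f, of 2] by simp
    also have "\<dots> = (\<integral>\<^sup>+y. (\<integral>\<^sup>+t. ennreal ((f (S y + axis 1 t))\<^sup>2) \<partial>lborel) \<partial>lborel)"
      by (rule nn_integral_slices[OF T S]) (use Cc_borel[OF f] in simp)
    finally show ?thesis by (simp only: slice[OF f])
  qed
  have uD: "\<bar>u (S y + axis 1 t)\<bar> \<le> D y" for y t
  proof -
    let ?v = "u (S y + axis 1 t)"
    have "?v ^ 4 \<le> 4 * (A y * B y)" using line_sup_bound[OF u, of "S y" 1 t] by (simp add: A_def B_def mult.assoc)
    then have "(?v\<^sup>2)\<^sup>2 \<le> (2 * sqrt (A y * B y))\<^sup>2" using AB[of y] by (simp add: power_mult_distrib)
    then have "?v\<^sup>2 \<le> 2 * sqrt (A y * B y)" by (rule power2_le_imp_le) (simp add: AB)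
    then show ?thesis unfolding D_def by (metis real_sqrt_abs real_sqrt_le_mono)
  qed
  have D0: "D y \<ge> 0" for y by (simp add: D_def AB)
  define X where "X = (\<integral>\<^sup>+y. ennreal (A y) * ennreal (D y) \<partial>lborel)"
  have "ennreal (pint 3 u) = (\<integral>\<^sup>+z. ennreal (\<bar>u z\<bar> ^ 3) \<partial>lborel)"
    using pint_nn_integral[OF cu, of 3] by simp
  also have "\<dots> = (\<integral>\<^sup>+y. (\<integral>\<^sup>+t. ennreal (\<bar>u (S y + axis 1 t)\<bar> ^ 3) \<partial>lborel) \<partial>lborel)"
    by (rule nn_integral_slices[OF T S]) (use Cc_borel[OF cu] in simp)
  also have "\<dots> \<le> X" unfolding X_def
  proof (rule nn_integral_mono)
    fix y
    have "(\<integral>\<^sup>+t. ennreal (\<bar>u (S y + axis 1 t)\<bar> ^ 3) \<partial>lborel) \<le> (\<integral>\<^sup>+t. ennreal (D y) * ennreal ((u (S y + axis 1 t))\<^sup>2) \<partial>lborel)"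
    proof (rule nn_integral_mono)
      fix t
      let ?v = "u (S y + axis 1 t)"
      have "\<bar>?v\<bar> ^ 3 = \<bar>?v\<bar> * ?v\<^sup>2" by (simp add: power3_eq_cube power2_eq_square)
      also have "\<dots> \<le> D y * ?v\<^sup>2" by (intro mult_right_mono uD) simp
      finally show "ennreal (\<bar>?v\<bar> ^ 3) \<le> ennreal (D y) * ennreal (?v\<^sup>2)"
        using D0[of y] by (simp add: ennreal_mult[symmetric] ennreal_leI)
    qed
    also have "\<dots> = ennreal (D y) * (\<integral>\<^sup>+t. ennreal ((u (S y + axis 1 t))\<^sup>2) \<partial>lborel)"
      by (rule nn_integral_cmult) (use Cc_borel[OF Cc_line[OF cu, of "S y" 1]] in simp)
    also have "\<dots> = ennreal (A y) * ennreal (D y)"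
      by (simp only: slice[OF cu] A_def mult.commute)
    finally show "(\<integral>\<^sup>+t. ennreal (\<bar>u (S y + axis 1 t)\<bar> ^ 3) \<partial>lborel) \<le> ennreal (A y) * ennreal (D y)" .
  qed
  finally have x: "ennreal (pint 3 u) \<le> X" .
  define E where "E = (\<integral>\<^sup>+y. ennreal (sqrt (A y)) * ennreal (sqrt (B y)) \<partial>lborel)"
  have E: "E\<^sup>2 \<le> ennreal (pint 2 u) * ennreal (pint 2 (partial 1 u))"
  proof -
    have "E\<^sup>2 \<le> (\<integral>\<^sup>+y. (ennreal (sqrt (A y)))\<^sup>2 \<partial>lborel) * (\<integral>\<^sup>+y. (ennreal (sqrt (B y)))\<^sup>2 \<partial>lborel)"
      unfolding E_def by (rule Cauchy_Schwarz_nn_integral) (use mA mB in simp_all)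
    also have "\<dots> = (\<integral>\<^sup>+y. ennreal (A y) \<partial>lborel) * (\<integral>\<^sup>+y. ennreal (B y) \<partial>lborel)"
      by (simp add: ennreal_power AB)
    also have "\<dots> = ennreal (pint 2 u) * ennreal (pint 2 (partial 1 u))"
      using tot[OF cu] tot[OF cw] by (simp add: A_def B_def)
    finally show ?thesis .
  qed
  have "X\<^sup>2 \<le> (\<integral>\<^sup>+y. (ennreal (A y))\<^sup>2 \<partial>lborel) * (\<integral>\<^sup>+y. (ennreal (D y))\<^sup>2 \<partial>lborel)"
    unfolding X_def by (rule Cauchy_Schwarz_nn_integral) (use mA mD in simp_all)
  also have "(\<integral>\<^sup>+y. (ennreal (D y))\<^sup>2 \<partial>lborel) = (\<integral>\<^sup>+y. 2 * (ennreal (sqrt (A y)) * ennreal (sqrt (B y))) \<partial>lborel)"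
  proof (rule nn_integral_cong)
    fix y
    have "(D y)\<^sup>2 = 2 * sqrt (A y * B y)" by (simp add: D_def AB)
    then have "(D y)\<^sup>2 = 2 * (sqrt (A y) * sqrt (B y))" by (simp add: real_sqrt_mult)
    then show "(ennreal (D y))\<^sup>2 = 2 * (ennreal (sqrt (A y)) * ennreal (sqrt (B y)))"
      using AB[of y] D0[of y] by (simp add: ennreal_power ennreal_mult)
  qed
  also have "\<dots> = 2 * E" unfolding E_def by (rule nn_integral_cmult) (use mA mB in simp)
  also have "(\<integral>\<^sup>+y. (ennreal (A y))\<^sup>2 \<partial>lborel) * (2 * E) \<le> ennreal K * (2 * E)"
    using mass unfolding A_def by (rule mult_right_mono) simp
  finally have X2: "X\<^sup>2 \<le> ennreal K * (2 * E)" .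
  have "(ennreal (pint 3 u)) ^ 4 \<le> X ^ 4" using x by (rule power_mono) simp
  also have "X ^ 4 = (X\<^sup>2)\<^sup>2" by simp
  also have "\<dots> \<le> (ennreal K * (2 * E))\<^sup>2" using X2 by (rule power_mono) simp
  also have "\<dots> = (ennreal K)\<^sup>2 * 4 * E\<^sup>2" by (simp add: power_mult_distrib mult.assoc)
  also have "\<dots> \<le> (ennreal K)\<^sup>2 * 4 * (ennreal (pint 2 u) * ennreal (pint 2 (partial 1 u)))"
    using E by (rule mult_left_mono) simp
  also have "\<dots> = ennreal (4 * K\<^sup>2 * pint 2 u * pint 2 (partial 1 u))"
    using K by (simp add: ennreal_mult pint_nonneg ennreal_power[symmetric] mult_ac)
  finally show ?thesis
    using K by (simp add: ennreal_power pint_nonneg)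
qed

lemma lborel_vec_emeasure_box:
  fixes l u :: "real ^ 'n::finite"
  shows "(\<Prod>b\<in>Basis. (u - l) \<bullet> b) = (\<Prod>i\<in>UNIV. u $ i - l $ i)"
proof -
  have B: "(Basis :: (real ^ 'n) set) = (\<lambda>i. axis i 1) ` UNIV" by (auto simp: Basis_vec_def)
  have inj: "inj (\<lambda>i::'n. axis i (1::real))" by (auto simp: inj_on_def axis_eq_axis)
  show ?thesis unfolding B by (subst prod.reindex[OF inj]) (simp add: inner_axis inner_diff_left)
qed

lemma distr_plane:
  assumes U: "(UNIV :: 'n set) = {1, j}" and j: "j \<noteq> 1"
  shows "distr (lborel :: (real \<times> real) measure) borel (\<lambda>p. axis 1 (fst p) + axis j (snd p) :: real ^ 'n::{finite,one}) = lborel"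
proof (rule lborel_eqI[symmetric])
  let ?T = "\<lambda>p::real \<times> real. axis 1 (fst p) + axis j (snd p) :: real ^ 'n::{finite,one}"
  have "continuous_on UNIV ?T"
    by (intro continuous_on_add continuous_on_compose2[OF continuous_on_axis]
        continuous_on_fst continuous_on_snd continuous_on_id) auto
  then have Tm: "?T \<in> borel_measurable borel" by (rule borel_measurable_continuous_onI)
  fix l u :: "real ^ 'n::{finite,one}"
  assume le: "\<And>b. b \<in> Basis \<Longrightarrow> l \<bullet> b \<le> u \<bullet> b"
  have le': "l $ i \<le> u $ i" for i using le[of "axis i 1"] by (auto simp: inner_axis Basis_vec_def)
  have all: "(\<forall>i::'n. P i) \<longleftrightarrow> P 1 \<and> P j" for P
    using U by (metis UNIV_I insertE singletonD)
  have c: "?T (a, b) $ 1 = a" "?T (a, b) $ j = b" for a b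
    using j by (simp_all add: axis_def)
  have "?T -` box l u = {l $ 1 <..< u $ 1} \<times> {l $ j <..< u $ j}"
  proof (rule set_eqI)
    fix p :: "real \<times> real"
    show "p \<in> ?T -` box l u \<longleftrightarrow> p \<in> {l $ 1 <..< u $ 1} \<times> {l $ j <..< u $ j}"
      using c[of "fst p" "snd p"] by (cases p) (simp add: mem_box_cart all)
  qed
  then have "emeasure (distr lborel borel ?T) (box l u) = emeasure lborel ({l $ 1 <..< u $ 1} \<times> {l $ j <..< u $ j})"
    using Tm by (simp add: emeasure_distr)
  also have "\<dots> = emeasure lborel {l $ 1 <..< u $ 1} * emeasure lborel {l $ j <..< u $ j}"
    unfolding lborel_prod[symmetric] by (rule lborel.emeasure_pair_measure_Times) simp_all
  also have "\<dots> = ennreal ((u $ 1 - l $ 1) * (u $ j - l $ j))"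
    by (simp add: le' ennreal_mult)
  also have "(u $ 1 - l $ 1) * (u $ j - l $ j) = (\<Prod>i\<in>UNIV. u $ i - l $ i)"
    unfolding U using j by simp
  finally show "emeasure (distr lborel borel ?T) (box l u) = (\<Prod>b\<in>Basis. (u - l) \<bullet> b)"
    by (simp only: lborel_vec_emeasure_box)
qed simp

lemma distr_space:
  assumes U: "(UNIV :: 'n set) = {1, j, k}" and j: "j \<noteq> 1" "k \<noteq> 1" "j \<noteq> k"
  shows "distr (lborel :: (real \<times> real \<times> real) measure) borel
    (\<lambda>p. axis 1 (fst p) + (axis j (fst (snd p)) + axis k (snd (snd p))) :: real ^ 'n::{finite,one}) = lborel"
proof (rule lborel_eqI[symmetric])
  let ?T = "\<lambda>p::real \<times> real \<times> real. axis 1 (fst p) + (axis j (fst (snd p)) + axis k (snd (snd p))) :: real ^ 'n::{finite,one}"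
  have "continuous_on UNIV ?T"
    by (intro continuous_on_add continuous_on_compose2[OF continuous_on_axis]
        continuous_on_fst continuous_on_snd continuous_on_id) auto
  then have Tm: "?T \<in> borel_measurable borel" by (rule borel_measurable_continuous_onI)
  fix l u :: "real ^ 'n::{finite,one}"
  assume le: "\<And>b. b \<in> Basis \<Longrightarrow> l \<bullet> b \<le> u \<bullet> b"
  have le': "l $ i \<le> u $ i" for i using le[of "axis i 1"] by (auto simp: inner_axis Basis_vec_def)
  have all: "(\<forall>i::'n. P i) \<longleftrightarrow> P 1 \<and> P j \<and> P k" for P
    using U by (metis UNIV_I insertE singletonD)
  let ?B = "{l $ 1 <..< u $ 1} \<times> {l $ j <..< u $ j} \<times> {l $ k <..< u $ k}"
  have "?T -` box l u = ?B"
  proof (rule set_eqI)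
    fix p :: "real \<times> real \<times> real"
    show "p \<in> ?T -` box l u \<longleftrightarrow> p \<in> ?B"
      using j by (cases p) (auto simp: mem_box_cart all axis_def)
  qed
  then have "emeasure (distr lborel borel ?T) (box l u) = emeasure lborel ?B"
    using Tm by (simp add: emeasure_distr)
  also have "\<dots> = emeasure lborel {l $ 1 <..< u $ 1} * emeasure (lborel :: (real \<times> real) measure) ({l $ j <..< u $ j} \<times> {l $ k <..< u $ k})"
    unfolding lborel_prod[symmetric, where 'b="real \<times> real"]
    by (rule lborel.emeasure_pair_measure_Times) (simp_all add: borel_open open_Times)
  also have "emeasure (lborel :: (real \<times> real) measure) ({l $ j <..< u $ j} \<times> {l $ k <..< u $ k})
     = emeasure lborel {l $ j <..< u $ j} * emeasure lborel {l $ k <..< u $ k}"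
    unfolding lborel_prod[symmetric] by (rule lborel.emeasure_pair_measure_Times) simp_all
  also have "emeasure lborel {l $ 1 <..< u $ 1} * (emeasure lborel {l $ j <..< u $ j} * emeasure lborel {l $ k <..< u $ k})
     = ennreal ((u $ 1 - l $ 1) * ((u $ j - l $ j) * (u $ k - l $ k)))"
    by (simp add: le' ennreal_mult)
  also have "(u $ 1 - l $ 1) * ((u $ j - l $ j) * (u $ k - l $ k)) = (\<Prod>i\<in>UNIV. u $ i - l $ i)"
    unfolding U using j by simp
  finally show "emeasure (distr lborel borel ?T) (box l u) = (\<Prod>b\<in>Basis. (u - l) \<bullet> b)"
    by (simp only: lborel_vec_emeasure_box)
qed simp

lemma product_integral_le_KP_sq:
  assumes \<phi>: "test_function \<phi>"
  shows "(\<integral>x. \<bar>partial 1 (partial 1 \<phi>) x * partial j \<phi> x\<bar> \<partial>lborel) \<le> KP_sq \<phi>"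
proof (rule power2_le_imp_le[OF _ KP_sq_nonneg])
  let ?w = "partial 1 (partial 1 \<phi>)" and ?r = "partial j \<phi>"
  have c: "Cc ?w" "Cc ?r" by (intro test_Cc test_partial \<phi>)+
  have c2: "Cc (\<lambda>x. (?w x)\<^sup>2)" "Cc (\<lambda>x. (?r x)\<^sup>2)" using c by (simp_all add: Cc_power)
  have "(\<integral>x. \<bar>?w x * ?r x\<bar> \<partial>lborel)\<^sup>2 \<le> (\<integral>x. (?w x)\<^sup>2 \<partial>lborel) * (\<integral>x. (?r x)\<^sup>2 \<partial>lborel)"
    by (rule Cauchy_Schwarz_integral) (simp_all add: Cc_borel c Cc_integrable_lborel c2)
  also have "\<dots> = pint 2 ?w * pint 2 ?r"
    by (simp add: pint_def Cc_integral_lborel c2)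
  also have "\<dots> \<le> KP_sq \<phi> * KP_sq \<phi>"
    by (intro mult_mono pint_partial_le_KP_sq pint_partial2_le_KP_sq pint_nonneg KP_sq_nonneg)
  finally show "(\<integral>x. \<bar>?w x * ?r x\<bar> \<partial>lborel)\<^sup>2 \<le> (KP_sq \<phi>)\<^sup>2" by (simp add: power2_eq_square)
qed

lemma mass_bound_plane:
  assumes U: "(UNIV :: 'n set) = {1, j}" and j: "j \<noteq> 1"
    and \<phi>: "test_function (\<phi> :: real ^ 'n::{finite,one} \<Rightarrow> real)"
  shows "(\<integral>\<^sup>+y. (ennreal (\<integral>t. (partial 1 \<phi> (axis j y + axis 1 t))\<^sup>2 \<partial>lborel))\<^sup>2 \<partial>lborel) \<le> ennreal (2 * (KP_sq \<phi>)\<^sup>2)"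
proof -
  define A where "A y = (\<integral>t. (partial 1 \<phi> (axis j y + axis 1 t))\<^sup>2 \<partial>lborel)" for y
  define f where "f x = \<bar>partial 1 (partial 1 \<phi>) x * partial j \<phi> x\<bar>" for x
  have cf: "Cc f" unfolding f_def[abs_def] by (intro Cc_abs Cc_mult test_Cc test_partial \<phi>)
  have cu: "Cc (partial 1 \<phi>)" by (intro test_Cc test_partial \<phi>)
  have cu2: "Cc (\<lambda>x. (partial 1 \<phi> x)\<^sup>2)" using Cc_power[OF cu] by simp
  have plane: "(\<integral>p. f (axis j y + axis 1 (fst p) + axis j (snd p)) \<partial>lborel) = (\<integral>x. f x \<partial>lborel)" for y
  proof -
    have "(\<integral>x. f x \<partial>lborel) = (\<integral>x. shift (axis j y) f x \<partial>lborel)"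
      using Cc_integral_shift[OF cf, of "axis j y"] cf by (simp add: Cc_integral_lborel Cc_shift)
    also have "\<dots> = (\<integral>x. shift (axis j y) f x \<partial>distr (lborel :: (real \<times> real) measure) borel (\<lambda>p. axis 1 (fst p) + axis j (snd p)))"
      by (simp only: distr_plane[OF U j])
    also have "\<dots> = (\<integral>p. shift (axis j y) f (axis 1 (fst p) + axis j (snd p)) \<partial>lborel)"
    proof (rule integral_distr)
      have "continuous_on UNIV (\<lambda>p::real \<times> real. axis 1 (fst p) + axis j (snd p) :: real ^ 'n::{finite,one})"
        by (intro continuous_on_add continuous_on_compose2[OF continuous_on_axis]
            continuous_on_fst continuous_on_snd continuous_on_id) auto
      then show "(\<lambda>p. axis 1 (fst p) + axis j (snd p) :: real ^ 'n::{finite,one}) \<in> measurable lborel borel"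
        by (simp add: borel_measurable_continuous_onI)
    qed (rule Cc_borel[OF Cc_shift[OF cf]])
    finally show ?thesis by (simp add: shift_def add_ac)
  qed
  have A: "0 \<le> A y" "A y \<le> 2 * KP_sq \<phi>" for y
  proof -
    have "A y \<le> 2 * (\<integral>x. f x \<partial>lborel)"
      using line_mass_bound[OF \<phi> j[symmetric], of "axis j y"] plane[of y] by (simp add: A_def f_def)
    also have "\<dots> \<le> 2 * KP_sq \<phi>"
      using product_integral_le_KP_sq[OF \<phi>, of j] by (simp add: f_def)
    finally show "A y \<le> 2 * KP_sq \<phi>" .
  qed (simp add: A_def)
  have mA: "A \<in> borel_measurable lborel"
    unfolding A_def[abs_def] by (rule borel_measurable_slice_integral[OF continuous_on_axis continuous_on_axis Cc_continuous[OF cu2]])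
  have "(\<integral>\<^sup>+y. (ennreal (A y))\<^sup>2 \<partial>lborel) \<le> (\<integral>\<^sup>+y. ennreal (2 * KP_sq \<phi>) * ennreal (A y) \<partial>lborel)"
  proof (rule nn_integral_mono)
    fix y
    show "(ennreal (A y))\<^sup>2 \<le> ennreal (2 * KP_sq \<phi>) * ennreal (A y)"
      unfolding power2_eq_square by (intro mult_right_mono ennreal_leI A) simp
  qed
  also have "\<dots> = ennreal (2 * KP_sq \<phi>) * (\<integral>\<^sup>+y. ennreal (A y) \<partial>lborel)"
    by (rule nn_integral_cmult) (use mA in simp)
  also have "(\<integral>\<^sup>+y. ennreal (A y) \<partial>lborel) = (\<integral>\<^sup>+y. (\<integral>\<^sup>+t. ennreal ((partial 1 \<phi> (axis j y + axis 1 t))\<^sup>2) \<partial>lborel) \<partial>lborel)"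
    unfolding A_def
    by (intro nn_integral_cong nn_integral_eq_integral[symmetric] Cc_integrable_lborel Cc_power[OF Cc_line[OF cu]]) simp_all
  also have "\<dots> = (\<integral>\<^sup>+x. ennreal ((partial 1 \<phi> x)\<^sup>2) \<partial>lborel)"
    by (rule nn_integral_slices[OF distr_plane[OF U j] continuous_on_axis, symmetric]) (use Cc_borel[OF cu] in simp)
  also have "\<dots> = ennreal (pint 2 (partial 1 \<phi>))"
    using pint_nn_integral[OF cu, of 2] by simp
  also have "ennreal (2 * KP_sq \<phi>) * ennreal (pint 2 (partial 1 \<phi>)) \<le> ennreal (2 * KP_sq \<phi>) * ennreal (KP_sq \<phi>)"
    by (intro mult_left_mono ennreal_leI pint_partial_le_KP_sq) simp
  also have "\<dots> = ennreal (2 * (KP_sq \<phi>)\<^sup>2)"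
    using KP_sq_nonneg[of \<phi>] by (simp add: ennreal_mult[symmetric] power2_eq_square mult.assoc)
  finally show ?thesis by (simp add: A_def)
qed

text \<open>In dimension three, the integral of \<open>u\<^sup>2\<close> over a line is bounded both by a function of the
  second and by a function of the third coordinate, so that its square has a product bound.\<close>

lemma mass_bound_space:
  assumes U: "(UNIV :: 'n set) = {1, j, k}" and jk: "j \<noteq> 1" "k \<noteq> 1" "j \<noteq> k"
    and \<phi>: "test_function (\<phi> :: real ^ 'n::{finite,one} \<Rightarrow> real)"
  shows "(\<integral>\<^sup>+y. (ennreal (\<integral>t. (partial 1 \<phi> ((axis j (fst y) + axis k (snd y)) + axis 1 t))\<^sup>2 \<partial>lborel))\<^sup>2 \<partial>lborel)
    \<le> ennreal (4 * (KP_sq \<phi>)\<^sup>2)"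
proof -
  define A where "A y = (\<integral>t. (partial 1 \<phi> ((axis j (fst y) + axis k (snd y)) + axis 1 t))\<^sup>2 \<partial>lborel)" for y
  define f where "f i x = \<bar>partial 1 (partial 1 \<phi>) x * partial i \<phi> x\<bar>" for i x
  define G where "G i l b = (\<integral>p. f i (axis l b + (axis 1 (fst p) + axis i (snd p))) \<partial>lborel)" for i l b
  have cf: "Cc (f i)" for i unfolding f_def[abs_def] by (intro Cc_abs Cc_mult test_Cc test_partial \<phi>)
  have cplane: "continuous_on UNIV (\<lambda>p::real \<times> real. axis m (fst p) + axis i (snd p) :: real ^ 'n::{finite,one})" for m i
    by (intro continuous_on_add continuous_on_compose2[OF continuous_on_axis]
        continuous_on_fst continuous_on_snd continuous_on_id) auto
  have G0: "G i l b \<ge> 0" for i l b unfolding G_def f_def by simp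
  have mG: "G i l \<in> borel_measurable lborel" for i l
    unfolding G_def[abs_def]
    by (rule borel_measurable_slice_integral[OF continuous_on_axis cplane Cc_continuous[OF cf]])
  have AG: "A (a, b) \<le> 2 * G i l d"
    if "axis j a + axis k b = axis i c + axis l d" "i \<noteq> 1" for a b i l c d
  proof -
    let ?g = "\<lambda>p. f i (axis l d + axis 1 (fst p) + axis i (snd p))"
    have cg: "Cc ?g" by (rule Cc_plane[OF that(2)[symmetric] cf])
    have "A (a, b) \<le> 2 * (\<integral>p. f i (axis j a + axis k b + axis 1 (fst p) + axis i (snd p)) \<partial>lborel)"
      using line_mass_bound[OF \<phi> that(2)[symmetric], of "axis j a + axis k b"] by (simp add: A_def f_def)
    also have "(\<lambda>p. f i (axis j a + axis k b + axis 1 (fst p) + axis i (snd p))) = shift (0, c) ?g"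
      by (rule ext) (simp add: shift_def that(1) axis_add add_ac)
    also have "(\<integral>p. shift (0, c) ?g p \<partial>lborel) = (\<integral>p. ?g p \<partial>lborel)"
      using Cc_integral_shift[OF cg, of "(0, c)"] cg by (simp add: Cc_integral_lborel Cc_shift)
    also have "\<dots> = G i l d" by (simp add: G_def add.assoc)
    finally show ?thesis .
  qed
  have A0: "A y \<ge> 0" for y by (simp add: A_def)
  have pt: "(ennreal (A (a, b)))\<^sup>2 \<le> ennreal (2 * G j k b) * ennreal (2 * G k j a)" for a b
    unfolding power2_eq_square
    by (intro mult_mono ennreal_leI AG[of a b j a k b] AG[of a b k b j a]) (simp_all add: jk add.commute)
  have tot: "(\<integral>\<^sup>+y. (\<integral>\<^sup>+t. ennreal (f i (axis j (fst y) + axis k (snd y) + axis 1 t)) \<partial>lborel) \<partial>(lborel :: (real \<times> real) measure)) \<le> ennreal (KP_sq \<phi>)" for i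
  proof -
    have cS: "continuous_on UNIV (\<lambda>y::real \<times> real. axis j (fst y) + axis k (snd y) :: real ^ 'n::{finite,one})" by (rule cplane)
    have "(\<integral>\<^sup>+y. (\<integral>\<^sup>+t. ennreal (f i (axis j (fst y) + axis k (snd y) + axis 1 t)) \<partial>lborel) \<partial>(lborel :: (real \<times> real) measure)) = (\<integral>\<^sup>+x. ennreal (f i x) \<partial>lborel)"
      by (rule nn_integral_slices[OF distr_space[OF U jk] cS, symmetric]) (use Cc_borel[OF cf] in simp)
    also have "\<dots> = ennreal (\<integral>x. f i x \<partial>lborel)"
      by (rule nn_integral_eq_integral[OF Cc_integrable_lborel[OF cf]]) (simp add: f_def)
    also have "\<dots> \<le> ennreal (KP_sq \<phi>)"
      unfolding f_def by (intro ennreal_leI product_integral_le_KP_sq \<phi>)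
    finally show ?thesis .
  qed
  have Gnn: "ennreal (G i l b) = (\<integral>\<^sup>+s. (\<integral>\<^sup>+t. ennreal (f i (axis l b + (axis 1 t + axis i s))) \<partial>lborel) \<partial>lborel)"
    if "i \<noteq> 1" for i l b
  proof -
    have cg: "Cc (\<lambda>p. f i (axis l b + (axis 1 (fst p) + axis i (snd p))))"
      using Cc_plane[OF that[symmetric] cf, of i "axis l b"] by (simp add: add.assoc)
    have "ennreal (G i l b) = (\<integral>\<^sup>+p. ennreal (f i (axis l b + (axis 1 (fst p) + axis i (snd p)))) \<partial>lborel)"
      unfolding G_def by (rule nn_integral_eq_integral[OF Cc_integrable_lborel[OF cg], symmetric]) (simp add: f_def)
    also have "\<dots> = (\<integral>\<^sup>+p. ennreal (f i (axis l b + (axis 1 (fst p) + axis i (snd p)))) \<partial>(lborel \<Otimes>\<^sub>M lborel))"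
      by (simp only: lborel_prod)
    also have "\<dots> = (\<integral>\<^sup>+s. (\<integral>\<^sup>+t. ennreal (f i (axis l b + (axis 1 (fst (t, s)) + axis i (snd (t, s))))) \<partial>lborel) \<partial>lborel)"
      by (rule lborel_pair.nn_integral_snd[symmetric]) (use Cc_borel[OF cg] in \<open>simp add: lborel_prod\<close>)
    finally show ?thesis by simp
  qed
  have mH: "(\<lambda>y. \<integral>\<^sup>+t. ennreal (f i (axis j (fst y) + axis k (snd y) + axis 1 t)) \<partial>lborel) \<in> borel_measurable (lborel \<Otimes>\<^sub>M lborel)" for i
  proof -
    have "(\<lambda>y. \<integral>\<^sup>+t. ennreal (f i (axis j (fst y) + axis k (snd y) + axis 1 t)) \<partial>lborel)
      = (\<lambda>y. ennreal (\<integral>t. f i (axis j (fst y) + axis k (snd y) + axis 1 t) \<partial>lborel))"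
      by (intro ext nn_integral_eq_integral Cc_integrable_lborel Cc_line cf) (simp add: f_def)
    moreover have "(\<lambda>y. \<integral>t. f i (axis j (fst y) + axis k (snd y) + axis 1 t) \<partial>lborel) \<in> borel_measurable lborel"
      by (rule borel_measurable_slice_integral[OF cplane continuous_on_axis Cc_continuous[OF cf]])
    ultimately show ?thesis by (simp add: lborel_prod)
  qed
  have Gj: "(\<integral>\<^sup>+b. ennreal (G j k b) \<partial>lborel) \<le> ennreal (KP_sq \<phi>)"
  proof -
    have "(\<integral>\<^sup>+b. ennreal (G j k b) \<partial>lborel) = (\<integral>\<^sup>+b. (\<integral>\<^sup>+a. (\<integral>\<^sup>+t. ennreal (f j (axis j (fst (a, b)) + axis k (snd (a, b)) + axis 1 t)) \<partial>lborel) \<partial>lborel) \<partial>lborel)"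
      unfolding Gnn[OF jk(1)] by (simp add: add_ac)
    also have "\<dots> = (\<integral>\<^sup>+y. (\<integral>\<^sup>+t. ennreal (f j (axis j (fst y) + axis k (snd y) + axis 1 t)) \<partial>lborel) \<partial>(lborel \<Otimes>\<^sub>M lborel))"
      by (rule lborel_pair.nn_integral_snd[OF mH])
    also have "\<dots> \<le> ennreal (KP_sq \<phi>)" using tot by (simp only: lborel_prod)
    finally show ?thesis .
  qed
  have Gk: "(\<integral>\<^sup>+a. ennreal (G k j a) \<partial>lborel) \<le> ennreal (KP_sq \<phi>)"
  proof -
    have "(\<integral>\<^sup>+a. ennreal (G k j a) \<partial>lborel) = (\<integral>\<^sup>+a. (\<integral>\<^sup>+b. (\<integral>\<^sup>+t. ennreal (f k (axis j (fst (a, b)) + axis k (snd (a, b)) + axis 1 t)) \<partial>lborel) \<partial>lborel) \<partial>lborel)"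
      unfolding Gnn[OF jk(2)] by (simp add: add_ac)
    also have "\<dots> = (\<integral>\<^sup>+y. (\<integral>\<^sup>+t. ennreal (f k (axis j (fst y) + axis k (snd y) + axis 1 t)) \<partial>lborel) \<partial>(lborel \<Otimes>\<^sub>M lborel))"
      by (rule lborel.nn_integral_fst[OF mH])
    also have "\<dots> \<le> ennreal (KP_sq \<phi>)" using tot by (simp only: lborel_prod)
    finally show ?thesis .
  qed
  have m2: "(\<lambda>p. ennreal (2 * G j k (snd p)) * ennreal (2 * G k j (fst p))) \<in> borel_measurable (lborel \<Otimes>\<^sub>M lborel)"
  proof -
    note mG[measurable]
    show ?thesis by measurable
  qed
  have "(\<integral>\<^sup>+y. (ennreal (A y))\<^sup>2 \<partial>lborel) \<le> (\<integral>\<^sup>+p. ennreal (2 * G j k (snd p)) * ennreal (2 * G k j (fst p)) \<partial>lborel)"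
  proof (rule nn_integral_mono)
    fix p :: "real \<times> real"
    show "(ennreal (A p))\<^sup>2 \<le> ennreal (2 * G j k (snd p)) * ennreal (2 * G k j (fst p))"
      using pt[of "fst p" "snd p"] by simp
  qed
  also have "\<dots> = (\<integral>\<^sup>+p. ennreal (2 * G j k (snd p)) * ennreal (2 * G k j (fst p)) \<partial>(lborel \<Otimes>\<^sub>M lborel))"
    by (simp only: lborel_prod)
  also have "\<dots> = (\<integral>\<^sup>+b. (\<integral>\<^sup>+a. ennreal (2 * G j k (snd (a, b))) * ennreal (2 * G k j (fst (a, b))) \<partial>lborel) \<partial>lborel)"
    by (rule lborel_pair.nn_integral_snd[OF m2, symmetric])
  also have "\<dots> = (\<integral>\<^sup>+b. ennreal (2 * G j k b) * (\<integral>\<^sup>+a. ennreal (2 * G k j a) \<partial>lborel) \<partial>lborel)"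
    using mG by (simp add: nn_integral_cmult)
  also have "\<dots> = (\<integral>\<^sup>+b. ennreal (2 * G j k b) \<partial>lborel) * (\<integral>\<^sup>+a. ennreal (2 * G k j a) \<partial>lborel)"
    by (rule nn_integral_multc) (use mG in simp)
  also have "\<dots> = (2 * (\<integral>\<^sup>+b. ennreal (G j k b) \<partial>lborel)) * (2 * (\<integral>\<^sup>+a. ennreal (G k j a) \<partial>lborel))"
    using mG G0 by (simp add: ennreal_mult nn_integral_cmult)
  also have "\<dots> \<le> (2 * ennreal (KP_sq \<phi>)) * (2 * ennreal (KP_sq \<phi>))"
    by (intro mult_mono Gj Gk) simp_all
  also have "\<dots> = ennreal (4 * (KP_sq \<phi>)\<^sup>2)"
  proof -
    have "2 * ennreal (KP_sq \<phi>) = ennreal (2 * KP_sq \<phi>)" using KP_sq_nonneg[of \<phi>] by (simp add: ennreal_mult)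
    then show ?thesis using KP_sq_nonneg[of \<phi>] by (simp add: ennreal_mult[symmetric] power2_eq_square mult_ac)
  qed
  finally show ?thesis by (simp add: A_def)
qed

text \<open>The factor \<open>\<integral>u\<^sup>2\<close>, for \<open>u = \<partial>\<^sub>1\<phi>\<close>, is the point of this form: the energy norm enters \<open>(\<integral>\<bar>u\<bar>\<^sup>3)\<^sup>1\<^sup>/\<^sup>3\<close> with
  a power smaller than one, the rest being an \<open>L\<^sup>2\<close> norm, which lets the nonlinearity be absorbed.\<close>

theorem Gagliardo_Nirenberg:
  fixes \<phi> :: "real ^ 'n::{finite,one} \<Rightarrow> real"
  assumes dim: "CARD('n) = 2 \<or> CARD('n) = 3" and \<phi>: "test_function \<phi>"
  shows "pint 3 (partial 1 \<phi>) ^ 4 \<le> 64 * pint 2 (partial 1 \<phi>) * KP_sq \<phi> ^ 5"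
proof -
  have u: "test_function (partial 1 \<phi>)" by (intro test_partial \<phi>)
  have fin: ?thesis if "pint 3 (partial 1 \<phi>) ^ 4 \<le> 4 * K\<^sup>2 * pint 2 (partial 1 \<phi>) * pint 2 (partial 1 (partial 1 \<phi>))"
    "0 \<le> K" "K \<le> 4 * (KP_sq \<phi>)\<^sup>2" for K
  proof -
    have "K\<^sup>2 \<le> (4 * (KP_sq \<phi>)\<^sup>2)\<^sup>2" using that by (intro power_mono) auto
    then have "4 * K\<^sup>2 * pint 2 (partial 1 \<phi>) * pint 2 (partial 1 (partial 1 \<phi>))
       \<le> 4 * (4 * (KP_sq \<phi>)\<^sup>2)\<^sup>2 * pint 2 (partial 1 \<phi>) * KP_sq \<phi>"
      by (intro mult_mono pint_partial2_le_KP_sq) (simp_all add: pint_nonneg)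
    also have "\<dots> = 64 * pint 2 (partial 1 \<phi>) * KP_sq \<phi> ^ 5"
      by (simp add: power_mult_distrib eval_nat_numeral)
    finally show ?thesis using that(1) by linarith
  qed
  from dim show ?thesis
  proof
    assume "CARD('n) = 2"
    then obtain a b :: 'n where ab: "UNIV = {a, b}" "a \<noteq> b" by (auto simp: card_2_iff)
    then obtain j where j: "(UNIV :: 'n set) = {1, j}" "j \<noteq> 1"
      by (metis UNIV_I insertE insert_commute singletonD)
    show ?thesis
      by (rule fin[OF cube_bound_from_mass[OF distr_plane[OF j] continuous_on_axis u _ mass_bound_plane[OF j \<phi>]]])
         (simp_all add: power2_eq_square KP_sq_nonneg)
  next
    assume "CARD('n) = 3"
    then obtain a b c :: 'n where abc: "UNIV = {a, b, c}" "a \<noteq> b" "b \<noteq> c" "a \<noteq> c" by (auto simp: card_3_iff)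
    obtain j k where jk: "(UNIV :: 'n set) = {1, j, k}" "j \<noteq> 1" "k \<noteq> 1" "j \<noteq> k"
    proof -
      have "(1::'n) = a \<or> 1 = b \<or> 1 = c" using abc(1) by blast
      then show ?thesis
        using that[of b c] that[of a c] that[of a b] abc by (auto simp: insert_commute)
    qed
    have cS: "continuous_on UNIV (\<lambda>y::real \<times> real. axis j (fst y) + axis k (snd y) :: real ^ 'n::{finite,one})"
      by (intro continuous_on_add continuous_on_compose2[OF continuous_on_axis]
          continuous_on_fst continuous_on_snd continuous_on_id) auto
    show ?thesis
      by (rule fin[OF cube_bound_from_mass[OF distr_space[OF jk] cS u _ mass_bound_space[OF jk \<phi>]]])
         (simp_all add: KP_sq_nonneg)
  qed
qed

section \<open>Smooth bump functions and the fundamental lemma\<close>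

text \<open>The class of functions \<open>P(1/t) exp(-1/t)\<close>, extended by zero to \<open>t \<le> 0\<close>, is closed under
  derivatives; this is why \<open>exp(-1/t)\<close> is smooth at the origin.\<close>

definition flat_exp :: "real poly \<Rightarrow> real \<Rightarrow> real" where
  "flat_exp p t = (if t > 0 then poly p (1 / t) * exp (- 1 / t) else 0)"

lemma poly_div_exp_tendsto_0: "((\<lambda>s. s ^ k * poly p s / exp s) \<longlongrightarrow> (0::real)) at_top"
proof (induction p arbitrary: k)
  case 0
  then show ?case by simp
next
  case (pCons a p)
  have "((\<lambda>s. a * (s ^ k / exp s) + s ^ Suc k * poly p s / exp s) \<longlongrightarrow> a * 0 + 0) at_top"
    by (intro tendsto_add tendsto_mult_left tendsto_power_div_exp_0 pCons.IH)
  moreover have "(\<lambda>s. a * (s ^ k / exp s) + s ^ Suc k * poly p s / exp s) = (\<lambda>s. s ^ k * poly (pCons a p) s / exp s)"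
    by (auto simp: field_simps)
  ultimately show ?case by simp
qed

lemma flat_exp_tendsto_0: "((\<lambda>t. poly p (1 / t) * exp (- 1 / t)) \<longlongrightarrow> 0) (at_right (0::real))"
proof -
  have "((\<lambda>s. poly p s / exp s) \<longlongrightarrow> 0) at_top"
    using poly_div_exp_tendsto_0[of 0 p] by simp
  from filterlim_compose[OF this filterlim_inverse_at_top_right]
  show ?thesis by (simp add: exp_minus divide_inverse)
qed

lemma flat_exp_derivative:
  "(flat_exp p has_real_derivative flat_exp ([:0, 0, 1:] * (p - pderiv p)) t) (at t)"
proof -
  let ?q = "[:0, 0, 1:] * (p - pderiv p)"
  consider "t > 0" | "t < 0" | "t = 0" by linarith
  then show ?thesis
  proof cases
    case 1
    have "((\<lambda>t. poly p (1 / t) * exp (- 1 / t)) has_real_derivative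
        (poly (pderiv p) (1 / t) * (- 1 / t\<^sup>2)) * exp (- 1 / t) + poly p (1 / t) * (exp (- 1 / t) * (1 / t\<^sup>2))) (at t)"
    proof -
      have i: "((\<lambda>t. 1 / t) has_real_derivative - 1 / t\<^sup>2) (at t)"
        using 1 by (auto intro!: derivative_eq_intros simp: power2_eq_square)
      have j: "((\<lambda>t. - 1 / t) has_real_derivative 1 / t\<^sup>2) (at t)"
        using 1 by (auto intro!: derivative_eq_intros simp: power2_eq_square)
      have a: "((\<lambda>t. poly p (1 / t)) has_real_derivative poly (pderiv p) (1 / t) * (- 1 / t\<^sup>2)) (at t)"
        by (rule DERIV_chain2[OF poly_DERIV i])
      have b: "((\<lambda>t. exp (- 1 / t)) has_real_derivative exp (- 1 / t) * (1 / t\<^sup>2)) (at t)"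
        by (rule DERIV_chain2[OF DERIV_exp j])
      show ?thesis
        by (rule DERIV_cong[OF DERIV_mult[OF a b]]) (simp only: mult.commute)
    qed
    also have "(poly (pderiv p) (1 / t) * (- 1 / t\<^sup>2)) * exp (- 1 / t) + poly p (1 / t) * (exp (- 1 / t) * (1 / t\<^sup>2))
        = flat_exp ?q t"
      using 1 by (simp add: flat_exp_def power2_eq_square algebra_simps)
    finally have D: "((\<lambda>t. poly p (1 / t) * exp (- 1 / t)) has_real_derivative flat_exp ?q t) (at t)" .
    show ?thesis
      by (rule has_field_derivative_transform_within_open[OF D, of "{0<..}"]) (use 1 in \<open>auto simp: flat_exp_def\<close>)
  next
    case 2
    have D: "((\<lambda>t. 0) has_real_derivative flat_exp ?q t) (at t)"
      using 2 by (simp add: flat_exp_def)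
    show ?thesis
      by (rule has_field_derivative_transform_within_open[OF D, of "{..<0}"]) (use 2 in \<open>auto simp: flat_exp_def\<close>)
  next
    case 3
    have "((\<lambda>h. (flat_exp p (0 + h) - flat_exp p 0) / h) \<longlongrightarrow> 0) (at 0)"
    proof (rule filterlim_split_at)
      show "((\<lambda>h. (flat_exp p (0 + h) - flat_exp p 0) / h) \<longlongrightarrow> 0) (at_left 0)"
        by (rule Lim_transform_eventually[OF tendsto_const]) (auto simp: flat_exp_def eventually_at_filter)
      show "((\<lambda>h. (flat_exp p (0 + h) - flat_exp p 0) / h) \<longlongrightarrow> 0) (at_right 0)"
        by (rule Lim_transform_eventually[OF flat_exp_tendsto_0[of "[:0, 1:] * p"]])
           (auto simp: flat_exp_def eventually_at_filter)
    qed
    then show ?thesis using 3 by (simp add: DERIV_def flat_exp_def)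
  qed
qed

definition flat_exp_deriv :: "nat \<Rightarrow> real \<Rightarrow> real" where
  "flat_exp_deriv m = flat_exp (((\<lambda>p. [:0, 0, 1:] * (p - pderiv p)) ^^ m) 1)"

lemma flat_exp_deriv: "(flat_exp_deriv m has_real_derivative flat_exp_deriv (Suc m) t) (at t)"
  unfolding flat_exp_deriv_def using flat_exp_derivative by simp

lemma flat_exp_0: "flat_exp_deriv 0 t = (if t > 0 then exp (- 1 / t) else 0)"
  by (simp add: flat_exp_deriv_def flat_exp_def)

lemma box_indicator_approx:
  fixes a b :: "real ^ 'n::finite"
  obtains \<psi> where "\<And>m. test_function (\<psi> m)" "\<And>m x. 0 \<le> \<psi> m x" "\<And>m x. \<psi> m x \<le> indicator (box a b) x"
    "\<And>x. (\<lambda>m. \<psi> m x) \<longlonglongrightarrow> indicator (box a b) x"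
proof -
  let ?e = "flat_exp_deriv 0"
  define p where "p x = (\<Prod>i\<in>UNIV. ?e (x $ i - a $ i) * ?e (b $ i - x $ i))" for x
  define \<psi> where "\<psi> m x = ?e (real (Suc m) * p x)" for m :: nat and x
  have e0: "?e t \<ge> 0" "?e t > 0 \<longleftrightarrow> t > 0" for t by (auto simp: flat_exp_0)
  have sp: "smooth p" unfolding p_def[abs_def]
    by (intro smooth_prod smooth_mult smooth_comp_real[of flat_exp_deriv] flat_exp_deriv smooth_diff smooth_component smooth_const)
  have s: "smooth (\<psi> m)" for m unfolding \<psi>_def[abs_def]
    by (intro smooth_comp_real[of flat_exp_deriv] flat_exp_deriv smooth_scale sp)
  have p0: "p x \<ge> 0" for x unfolding p_def by (intro prod_nonneg mult_nonneg_nonneg e0) 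
  have pin: "p x > 0" if "x \<in> box a b" for x
    unfolding p_def using that by (intro prod_pos mult_pos_pos) (auto simp: e0(2) mem_box_cart)
  have pout: "p x = 0" if x_out: "x \<notin> box a b" for x
  proof -
    obtain i where "\<not> (a $ i < x $ i \<and> x $ i < b $ i)" using x_out unfolding mem_box_cart by blast
    then have "?e (x $ i - a $ i) * ?e (b $ i - x $ i) = 0" by (auto simp: flat_exp_0)
    then show ?thesis unfolding p_def by (intro prod_zero) auto
  qed
  have out: "\<psi> m x = 0" if "x \<notin> box a b" for m x
    by (simp add: \<psi>_def pout[OF that] flat_exp_0)
  show ?thesis
  proof (rule that[of \<psi>])
    show "test_function (\<psi> m)" for m
    proof -
      have "bounded {x. \<psi> m x \<noteq> 0}"
        by (rule bounded_subset[OF bounded_box[of a b]]) (use out in blast)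
      then show ?thesis using s by (simp add: test_function_iff)
    qed
    show "0 \<le> \<psi> m x" for m x by (simp add: \<psi>_def e0)
    show "\<psi> m x \<le> indicator (box a b) x" for m x
    proof (cases "x \<in> box a b")
      case True
      then show ?thesis using p0[of x] by (simp add: \<psi>_def flat_exp_0)
    qed (simp add: out)
    show "(\<lambda>m. \<psi> m x) \<longlonglongrightarrow> indicator (box a b) x" for x
    proof (cases "x \<in> box a b")
      case True
      have "\<psi> m x = exp (- (inverse (real (Suc m)) * inverse (p x)))" for m
        using pin[OF True] by (simp add: \<psi>_def flat_exp_0 divide_inverse)
      moreover have "(\<lambda>m. exp (- (inverse (real (Suc m)) * inverse (p x)))) \<longlonglongrightarrow> exp (- (0 * inverse (p x)))"
        by (intro tendsto_intros LIMSEQ_inverse_real_of_nat)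
      ultimately show ?thesis using True by simp
    qed (simp add: out)
  qed
qed

lemma L2_integrable_bounded:
  assumes g: "g \<in> L2" and C: "C \<in> sets lebesgue" "emeasure lebesgue C < \<infinity>"
  shows "integrable lebesgue (\<lambda>x. indicator C x * g x)"
proof -
  have m: "g \<in> borel_measurable lebesgue" "integrable lebesgue (\<lambda>x. (g x)\<^sup>2)" using g by (auto simp: L2_def)
  have "integrable lebesgue (\<lambda>x. (indicator C x :: real)\<^sup>2)"
  proof -
    have "(indicator C x :: real)\<^sup>2 = indicator C x" for x by (simp add: indicator_def)
    then show ?thesis using integrable_real_indicator[OF C] by (simp only:)
  qed
  then show ?thesis using m C by (intro Cauchy_Schwarz_integral) auto
qed

text \<open>By approximation of indicator functions of boxes, and since boxes generate the Borel sets,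
  a square integrable function is determined by its integrals against test functions.\<close>

lemma L2_eq_0_if_orthogonal:
  fixes g :: "real ^ 'n::finite \<Rightarrow> real"
  assumes g: "g \<in> L2" and orth: "\<And>\<psi>. test_function \<psi> \<Longrightarrow> (\<integral>x. g x * \<psi> x \<partial>lebesgue) = 0"
  shows "AE x in lebesgue. g x = 0"
proof -
  have gm: "g \<in> borel_measurable lebesgue" using g by (simp add: L2_def)
  have ib: "integrable lebesgue (\<lambda>x. indicator (box a b) x * g x)" for a b
    by (rule L2_integrable_bounded[OF g]) (use emeasure_bounded_finite[OF bounded_box[of a b]] in auto)
  have box0: "(\<integral>x. indicator (box a b) x * g x \<partial>lebesgue) = 0" for a b
  proof -
    obtain \<psi> where \<psi>: "\<And>m. test_function (\<psi> m)" "\<And>m x. 0 \<le> \<psi> m x" "\<And>m x. \<psi> m x \<le> indicator (box a b) x"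
      "\<And>x. (\<lambda>m. \<psi> m x) \<longlonglongrightarrow> indicator (box a b) x"
      using box_indicator_approx[of a b] by blast
    have pm: "\<psi> m \<in> borel_measurable lebesgue" for m
      by (rule borel_measurable_integrable[OF Cc_integrable[OF test_Cc[OF \<psi>(1)]]])
    have "(\<lambda>m. \<integral>x. g x * \<psi> m x \<partial>lebesgue) \<longlonglongrightarrow> (\<integral>x. indicator (box a b) x * g x \<partial>lebesgue)"
    proof (rule integral_dominated_convergence[where w="\<lambda>x. \<bar>indicator (box a b) x * g x\<bar>"])
      show "(\<lambda>x. indicator (box a b) x * g x) \<in> borel_measurable lebesgue"
        using ib by (rule borel_measurable_integrable)
      show "(\<lambda>x. g x * \<psi> m x) \<in> borel_measurable lebesgue" for m using gm pm by simp
      show "integrable lebesgue (\<lambda>x. \<bar>indicator (box a b) x * g x\<bar>)" using ib by (rule integrable_abs)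
      show "AE x in lebesgue. (\<lambda>m. g x * \<psi> m x) \<longlonglongrightarrow> indicator (box a b) x * g x"
        by (rule AE_I2) (subst mult.commute, intro tendsto_mult_left \<psi>)
      show "AE x in lebesgue. norm (g x * \<psi> m x) \<le> \<bar>indicator (box a b) x * g x\<bar>" for m
      proof (rule AE_I2)
        fix x
        have "\<bar>\<psi> m x\<bar> \<le> indicator (box a b) x" using \<psi>(2,3)[of m x] by simp
        then show "norm (g x * \<psi> m x) \<le> \<bar>indicator (box a b) x * g x\<bar>"
          using mult_left_mono[of "\<bar>\<psi> m x\<bar>" "indicator (box a b) x" "\<bar>g x\<bar>"]
          by (simp add: abs_mult mult.commute)
      qed
    qed
    then have "(\<lambda>m. 0) \<longlonglongrightarrow> (\<integral>x. indicator (box a b) x * g x \<partial>lebesgue)"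
      by (simp only: orth[OF \<psi>(1)])
    then show ?thesis using LIMSEQ_unique[OF _ tendsto_const] by blast
  qed
  obtain g' where g': "g' \<in> borel_measurable lborel" "AE x in lborel. g x = g' x"
    using completion_ex_borel_measurable_real[OF gm] by blast
  have gg': "AE x in lebesgue. g x = g' x" using g'(2) by (rule AE_completion)
  have g'l: "g' \<in> borel_measurable lebesgue" using g'(1) by (rule measurable_completion)
  have ib': "integrable lborel (\<lambda>x. indicator (box a b) x * g' x)"
    and box0': "(\<integral>x. indicator (box a b) x * g' x \<partial>lborel) = 0" for a b
  proof -
    have bm: "(\<lambda>x. indicator (box a b) x * g' x) \<in> borel_measurable lborel" using g'(1) by simp
    have ae: "AE x in lebesgue. indicator (box a b) x * g x = indicator (box a b) x * g' x"
      using gg' by (rule AE_mp) (auto intro!: AE_I2)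
    have bl: "(\<lambda>x. indicator (box a b) x * g x) \<in> borel_measurable lebesgue"
      "(\<lambda>x. indicator (box a b) x * g' x) \<in> borel_measurable lebesgue"
      using borel_measurable_integrable[OF ib] measurable_completion[OF bm] by auto
    show "integrable lborel (\<lambda>x. indicator (box a b) x * g' x)"
      using ib[of a b] integrable_cong_AE[OF bl ae] integrable_completion[OF bm] by simp
    show "(\<integral>x. indicator (box a b) x * g' x \<partial>lborel) = 0"
      using box0[of a b] integral_cong_AE[OF bl ae] integral_completion[OF bm] by simp
  qed
  have C0: "AE x in lborel. indicator (box c d) x * g' x = 0" for c d
  proof (rule density_unique_real)
    let ?f = "\<lambda>x. indicator (box c d) x * g' x"
    show "integrable lborel ?f" by (rule ib')
    show "integrable lborel (\<lambda>x. 0::real)" by simp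
    have si: "set_integrable lborel A ?f" if "A \<in> sets borel" for A
      unfolding set_integrable_def by (rule integrable_mult_indicator) (use that ib' in auto)
    fix A :: "(real ^ 'n) set" assume "A \<in> sets lborel"
    then have As: "A \<in> sigma_sets UNIV (range (\<lambda>(a, b). box a b))" by (simp add: borel_eq_box)
    have Is: "Int_stable (range (\<lambda>(a, b). box a b :: (real ^ 'n) set))"
      by (auto simp: Int_stable_def box_Int_box)
    have Ps: "range (\<lambda>(a, b). box a b :: (real ^ 'n) set) \<subseteq> Pow UNIV" by simp
    from Is Ps As have "(LINT x:A|lborel. ?f x) = 0"
    proof (induction rule: sigma_sets_induct_disjoint)
      case (basic A)
      then obtain a b where A: "A = box a b" by auto
      obtain a' b' where ab': "box a b \<inter> box c d = box a' b'" using box_Int_box[of a b c d] by blast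
      have "indicator A x *\<^sub>R ?f x = indicator (box a' b') x * g' x" for x
        unfolding ab'[symmetric] by (simp add: A indicator_def)
      then show ?case using box0'[of a' b'] by (simp only: set_lebesgue_integral_def)
    next
      case empty
      then show ?case by (simp add: set_lebesgue_integral_def)
    next
      case (compl A)
      then have A: "A \<in> sets borel" by (simp add: borel_eq_box)
      have "(LINT x:UNIV - A|lborel. ?f x) + (LINT x:A|lborel. ?f x) = (LINT x:(UNIV - A) \<union> A|lborel. ?f x)"
        by (rule set_integral_Un[symmetric]) (use si A in auto)
      also have "\<dots> = 0" using box0'[of c d] by (simp add: set_lebesgue_integral_def)
      finally show ?case using compl by simp
    next
      case (union A)
      then have A: "A i \<in> sets borel" for i by (auto simp: borel_eq_box)
      have "(LINT x:(\<Union>i. A i)|lborel. ?f x) = (\<Sum>i. (LINT x:A i|lborel. ?f x))"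
        by (rule lebesgue_integral_countable_add) (use A union si in \<open>auto simp: disjoint_family_on_def\<close>)
      then show ?case using union by simp
    qed
    then show "(LINT x:A|lborel. ?f x) = (LINT x:A|lborel. 0)" by (simp add: set_lebesgue_integral_def)
  qed
  let ?A = "\<lambda>n::nat. box (- (real n *\<^sub>R One)) (real n *\<^sub>R One) :: (real ^ 'n) set"
  have all0: "AE x in lborel. \<forall>n. indicator (?A n) x * g' x = 0"
    unfolding AE_all_countable using C0 by blast
  have ex: "\<exists>n. x \<in> ?A n" for x using UN_box_eq_UNIV by blast
  have "AE x in lborel. g' x = 0"
  proof (rule AE_mp[OF all0], intro AE_I2 impI)
    fix x assume x: "\<forall>n. indicator (?A n) x * g' x = 0"
    obtain n where "x \<in> ?A n" using ex by blast
    then show "g' x = 0" using spec[OF x, of n] by simp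
  qed
  then have "AE x in lebesgue. g' x = 0" by (rule AE_completion)
  with gg' show ?thesis by eventually_elim simp
qed

text \<open>A square integrable \<^term>\<open>g\<close> whose derivative in one direction vanishes is invariant under
  translations in this direction; its integral against a test function then equals that against a
  translate arbitrarily far away, hence is zero.\<close>

lemma L2_eq_0_if_partial_orthogonal:
  fixes g :: "real ^ 'n::finite \<Rightarrow> real"
  assumes g: "g \<in> L2" and orth: "\<And>\<psi>. test_function \<psi> \<Longrightarrow> (\<integral>x. g x * partial i \<psi> x \<partial>lebesgue) = 0"
  shows "AE x in lebesgue. g x = 0"
proof (rule L2_eq_0_if_orthogonal[OF g])
  fix \<psi> :: "real ^ 'n \<Rightarrow> real" assume \<psi>: "test_function \<psi>"
  have gm: "g \<in> borel_measurable lebesgue" and gi: "integrable lebesgue (\<lambda>x. (g x)\<^sup>2)"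
    using g by (auto simp: L2_def)
  have cm: "f \<in> borel_measurable lebesgue" "integrable lebesgue (\<lambda>x. (f x)\<^sup>2)" if "Cc f" for f :: "real ^ 'n \<Rightarrow> real"
    using Cc_integrable[OF that] Cc_integrable[OF Cc_power[OF that, of 2]] by (auto intro: borel_measurable_integrable)
  have ig: "integrable lebesgue (\<lambda>x. g x * f x)"
    and CS: "(\<integral>x. g x * f x \<partial>lebesgue)\<^sup>2 \<le> (\<integral>x. (g x)\<^sup>2 \<partial>lebesgue) * pint 2 f" if "Cc f" for f
  proof -
    show i: "integrable lebesgue (\<lambda>x. g x * f x)"
      by (rule Cauchy_Schwarz_integral(1)[OF gm cm(1)[OF that] gi cm(2)[OF that]])
    have "\<bar>\<integral>x. g x * f x \<partial>lebesgue\<bar>\<^sup>2 \<le> (\<integral>x. \<bar>g x * f x\<bar> \<partial>lebesgue)\<^sup>2"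
      by (intro power_mono integral_abs_bound) simp
    also have "\<dots> \<le> (\<integral>x. (g x)\<^sup>2 \<partial>lebesgue) * (\<integral>x. (f x)\<^sup>2 \<partial>lebesgue)"
      by (rule Cauchy_Schwarz_integral(2)[OF gm cm(1)[OF that] gi cm(2)[OF that]])
    finally show "(\<integral>x. g x * f x \<partial>lebesgue)\<^sup>2 \<le> (\<integral>x. (g x)\<^sup>2 \<partial>lebesgue) * pint 2 f" by (simp add: pint_def)
  qed
  define F where "F s = (\<integral>x. g x * shift (axis i s) \<psi> x \<partial>lebesgue)" for s
  have ts: "test_function (shift (axis i s) \<psi>)" for s by (rule test_shift[OF \<psi>])
  have "(F has_real_derivative 0) (at s)" for s
    unfolding DERIV_def LIMSEQ_SEQ_conv[symmetric]
  proof (intro allI impI, elim conjE)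
    fix k :: "nat \<Rightarrow> real" assume k: "\<forall>m. k m \<noteq> 0" "k \<longlonglongrightarrow> 0"
    let ?\<psi> = "shift (axis i s) \<psi>"
    let ?d = "\<lambda>m x. (?\<psi> (x + axis i (k m)) - ?\<psi> x) / k m - partial i ?\<psi> x"
    have "(\<lambda>x. ?\<psi> (x + axis i (k m))) = shift (axis i (k m)) ?\<psi>" for m by (auto simp: shift_def)
    then have c: "Cc (\<lambda>x. ?\<psi> (x + axis i (k m)))" "Cc ?\<psi>" "Cc (partial i ?\<psi>)" for m
      by (simp_all only: Cc_shift[OF test_Cc[OF ts]] test_Cc[OF ts] test_Cc[OF test_partial[OF ts]])
    have cd: "Cc (?d m)" for m by (intro Cc_diff Cc_divide c)
    have e: "(F (s + k m) - F s) / k m = (\<integral>x. g x * ?d m x \<partial>lebesgue)" for m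
    proof -
      have sh: "shift (axis i (s + k m)) \<psi> = (\<lambda>x. ?\<psi> (x + axis i (k m)))"
        by (auto simp: shift_def axis_add add_ac)
      have "(\<integral>x. g x * ?d m x \<partial>lebesgue) = (\<integral>x. (g x * ?\<psi> (x + axis i (k m)) - g x * ?\<psi> x) / k m - g x * partial i ?\<psi> x \<partial>lebesgue)"
        by (intro Bochner_Integration.integral_cong refl) (simp add: algebra_simps diff_divide_distrib)
      also have "\<dots> = (F (s + k m) - F s) / k m - 0"
        using ig[OF c(1)] ig[OF c(2)] ig[OF c(3)] orth[OF ts] by (simp add: F_def sh)
      finally show ?thesis by simp
    qed
    have lim: "(\<lambda>m. (\<integral>x. (g x)\<^sup>2 \<partial>lebesgue) * pint 2 (?d m)) \<longlonglongrightarrow> (\<integral>x. (g x)\<^sup>2 \<partial>lebesgue) * 0"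
      by (intro tendsto_mult_left diff_quotient_tendsto ts) (use k in auto)
    have "(\<lambda>m. ((F (s + k m) - F s) / k m)\<^sup>2) \<longlonglongrightarrow> 0"
    proof (rule Lim_null_comparison)
      show "(\<lambda>m. (\<integral>x. (g x)\<^sup>2 \<partial>lebesgue) * pint 2 (?d m)) \<longlonglongrightarrow> 0" using lim by simp
      show "\<forall>\<^sub>F m in sequentially. norm (((F (s + k m) - F s) / k m)\<^sup>2) \<le> (\<integral>x. (g x)\<^sup>2 \<partial>lebesgue) * pint 2 (?d m)"
      proof (rule always_eventually, rule allI)
        fix m
        show "norm (((F (s + k m) - F s) / k m)\<^sup>2) \<le> (\<integral>x. (g x)\<^sup>2 \<partial>lebesgue) * pint 2 (?d m)"
          unfolding e using CS[OF cd[of m]] by simp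
      qed
    qed
    then have "(\<lambda>m. sqrt (((F (s + k m) - F s) / k m)\<^sup>2)) \<longlonglongrightarrow> sqrt 0" by (rule tendsto_real_sqrt)
    then have "(\<lambda>m. \<bar>(F (s + k m) - F s) / k m\<bar>) \<longlonglongrightarrow> 0" by (simp only: real_sqrt_abs real_sqrt_zero)
    then show "(\<lambda>m. (F (s + k m) - F s) / k m) \<longlonglongrightarrow> 0" by (rule tendsto_rabs_zero_cancel)
  qed
  then have const: "F s = F 0" for s using DERIV_isconst_all by blast
  obtain r where r: "r > 0" "\<And>x. norm x > r \<Longrightarrow> \<psi> x = 0" using Cc_radius[OF test_Cc[OF \<psi>]] by blast
  let ?I = "\<lambda>n x. indicator (cball 0 r) (x + axis i (real n)) * (g x)\<^sup>2"
  have im: "(\<lambda>x. indicator (cball 0 r) (x + axis i (real n)) :: real) \<in> borel_measurable lebesgue" for n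
  proof -
    have "(\<lambda>x. x + axis i (real n) :: real ^ 'n) \<in> borel_measurable borel" by simp
    from measurable_compose[OF this borel_measurable_indicator[of "cball 0 r" borel]]
    have "(\<lambda>x. indicator (cball 0 r) (x + axis i (real n)) :: real) \<in> borel_measurable lborel" by simp
    then show ?thesis by (rule measurable_completion)
  qed
  have Im: "?I n \<in> borel_measurable lebesgue" for n using im gm by simp
  have Ii: "integrable lebesgue (?I n)" for n
    by (rule Bochner_Integration.integrable_bound[OF gi Im]) (auto intro!: AE_I2 simp: indicator_def)
  have I0: "(\<lambda>n. \<integral>x. ?I n x \<partial>lebesgue) \<longlonglongrightarrow> (\<integral>x. 0 \<partial>(lebesgue :: (real ^ 'n) measure))"
  proof (rule integral_dominated_convergence[where w="\<lambda>x. (g x)\<^sup>2"])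
    show "AE x in lebesgue. (\<lambda>n. ?I n x) \<longlonglongrightarrow> 0"
    proof (rule AE_I2)
      fix x :: "real ^ 'n"
      obtain n0 :: nat where n0: "norm x + r < real n0" using reals_Archimedean2 by blast
      have "?I n x = 0" if "n \<ge> n0" for n
      proof -
        have "norm (axis i (real n) :: real ^ 'n) \<le> norm (x + axis i (real n)) + norm x"
          using norm_triangle_ineq4[of "x + axis i (real n)" x] by simp
        then have "norm (x + axis i (real n)) > r" using n0 that by (simp add: norm_axis_real)
        then show ?thesis by (simp add: indicator_def)
      qed
      then show "(\<lambda>n. ?I n x) \<longlonglongrightarrow> 0" by (intro tendsto_eventually) (auto simp: eventually_sequentially)
    qed
  qed (use Im gi in \<open>auto intro!: AE_I2 simp: indicator_def\<close>)
  have "(F 0)\<^sup>2 \<le> (\<integral>x. ?I n x \<partial>lebesgue) * pint 2 \<psi>" for n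
  proof -
    let ?s = "shift (axis i (real n)) \<psi>"
    have cs: "Cc ?s" by (rule test_Cc[OF ts])
    have "\<bar>F (real n)\<bar>\<^sup>2 \<le> (\<integral>x. \<bar>g x * ?s x\<bar> \<partial>lebesgue)\<^sup>2"
      unfolding F_def by (intro power_mono integral_abs_bound) simp
    also have "\<dots> \<le> (\<integral>x. ?I n x \<partial>lebesgue) * (\<integral>x. (?s x)\<^sup>2 \<partial>lebesgue)"
    proof (rule Cauchy_Schwarz_geometric(2))
      show "(g x * ?s x)\<^sup>2 \<le> ?I n x * (?s x)\<^sup>2" for x
        using r(2)[of "x + axis i (real n)"]
        by (cases "norm (x + axis i (real n)) \<le> r") (simp_all add: power_mult_distrib shift_def)
    qed (use gm cm[OF cs] Ii in auto)
    also have "(\<integral>x. (?s x)\<^sup>2 \<partial>lebesgue) = pint 2 \<psi>"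
      using pint_shift[OF test_Cc[OF \<psi>], of 2 "axis i (real n)"] by (simp add: pint_def)
    finally show ?thesis using const[of "real n"] by simp
  qed
  moreover have "(\<lambda>n. (\<integral>x. ?I n x \<partial>lebesgue) * pint 2 \<psi>) \<longlonglongrightarrow> 0 * pint 2 \<psi>"
    using I0 by (intro tendsto_mult_right) simp
  ultimately have "(F 0)\<^sup>2 \<le> 0" by (intro LIMSEQ_le_const[of _ 0]) auto
  then show "(\<integral>x. g x * \<psi> x \<partial>lebesgue) = 0" by (simp add: F_def shift_def axis_zero)
qed

section \<open>Limits in \<open>L\<^sup>p\<close>\<close>

definition Cauchy_pint :: "nat \<Rightarrow> (nat \<Rightarrow> 'a::euclidean_space \<Rightarrow> real) \<Rightarrow> bool" where
  "Cauchy_pint p f \<longleftrightarrow> (\<forall>e>0. \<exists>N. \<forall>m\<ge>N. \<forall>n\<ge>N. pint p (\<lambda>x. f m x - f n x) < e)"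

lemma Cauchy_pint_limit:
  fixes f :: "nat \<Rightarrow> 'a::euclidean_space \<Rightarrow> real"
  assumes c: "\<And>n. Cc (f n)" and p: "p \<ge> 1" and Cau: "Cauchy_pint p f"
    and r: "strict_mono r" and lim: "AE x in lebesgue. (\<lambda>i. f (r i) x) \<longlonglongrightarrow> g x"
    and g: "g \<in> borel_measurable lebesgue"
  shows "integrable lebesgue (\<lambda>x. \<bar>f n x - g x\<bar> ^ p)" "integrable lebesgue (\<lambda>x. \<bar>g x\<bar> ^ p)"
    "(\<lambda>n. pint p (\<lambda>x. f n x - g x)) \<longlonglongrightarrow> 0"
proof -
  have fm: "f n \<in> borel_measurable lebesgue" for n
    by (rule borel_measurable_integrable[OF Cc_integrable[OF c]])
  have bound: "\<exists>N. \<forall>n\<ge>N. (\<integral>\<^sup>+x. ennreal (\<bar>f n x - g x\<bar> ^ p) \<partial>lebesgue) \<le> ennreal e" if "e > 0" for e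
  proof -
    obtain N where N: "\<And>m n. m \<ge> N \<Longrightarrow> n \<ge> N \<Longrightarrow> pint p (\<lambda>x. f m x - f n x) < e"
      using Cau \<open>e > 0\<close> unfolding Cauchy_pint_def by meson
    have "(\<integral>\<^sup>+x. ennreal (\<bar>f n x - g x\<bar> ^ p) \<partial>lebesgue) \<le> ennreal e" if n: "n \<ge> N" for n
    proof -
      have "(\<integral>\<^sup>+x. ennreal (\<bar>f n x - g x\<bar> ^ p) \<partial>lebesgue)
          = (\<integral>\<^sup>+x. liminf (\<lambda>i. ennreal (\<bar>f n x - f (r i) x\<bar> ^ p)) \<partial>lebesgue)"
      proof (rule nn_integral_cong_AE, rule AE_mp[OF lim], intro AE_I2 impI)
        fix x assume "(\<lambda>i. f (r i) x) \<longlonglongrightarrow> g x"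
        then have "(\<lambda>i. ennreal (\<bar>f n x - f (r i) x\<bar> ^ p)) \<longlonglongrightarrow> ennreal (\<bar>f n x - g x\<bar> ^ p)"
          by (intro tendsto_ennrealI tendsto_intros)
        from lim_imp_Liminf[OF sequentially_bot this]
        show "ennreal (\<bar>f n x - g x\<bar> ^ p) = liminf (\<lambda>i. ennreal (\<bar>f n x - f (r i) x\<bar> ^ p))" by simp
      qed
      also have "\<dots> \<le> liminf (\<lambda>i. \<integral>\<^sup>+x. ennreal (\<bar>f n x - f (r i) x\<bar> ^ p) \<partial>lebesgue)"
        by (rule nn_integral_liminf) (use fm in simp)
      also have "\<dots> \<le> ennreal e"
      proof (rule Liminf_le[THEN order_trans[rotated]])
        show "\<forall>\<^sub>F i in sequentially. (\<integral>\<^sup>+x. ennreal (\<bar>f n x - f (r i) x\<bar> ^ p) \<partial>lebesgue) \<le> ennreal e"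
        proof (rule eventually_sequentiallyI[of N])
          fix i assume "N \<le> i"
          then have "r i \<ge> N" using seq_suble[OF r, of i] by linarith
          have "(\<integral>\<^sup>+x. ennreal (\<bar>f n x - f (r i) x\<bar> ^ p) \<partial>lebesgue) = ennreal (pint p (\<lambda>x. f n x - f (r i) x))"
            unfolding pint_def
            by (rule nn_integral_eq_integral[OF Cc_integrable[OF Cc_abs_power[OF Cc_diff[OF c c] p]]]) simp
          then show "(\<integral>\<^sup>+x. ennreal (\<bar>f n x - f (r i) x\<bar> ^ p) \<partial>lebesgue) \<le> ennreal e"
            using N[OF n \<open>r i \<ge> N\<close>] by (simp add: ennreal_leI)
        qed
      qed simp_all
      finally show ?thesis .
    qed
    then show ?thesis by blast
  qed
  have im: "(\<lambda>x. \<bar>f n x - g x\<bar> ^ p) \<in> borel_measurable lebesgue" for n using fm g by simp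
  have int_of: "integrable lebesgue (\<lambda>x. \<bar>f n x - g x\<bar> ^ p)"
    if "(\<integral>\<^sup>+x. ennreal (\<bar>f n x - g x\<bar> ^ p) \<partial>lebesgue) \<le> ennreal e" for n e
  proof (rule integrableI_bounded[OF im])
    have "(\<integral>\<^sup>+x. ennreal (norm (\<bar>f n x - g x\<bar> ^ p)) \<partial>lebesgue) \<le> ennreal e"
      using that by (simp only: real_norm_def power_abs abs_idempotent)
    then show "(\<integral>\<^sup>+x. ennreal (norm (\<bar>f n x - g x\<bar> ^ p)) \<partial>lebesgue) < \<infinity>"
      by (rule order_le_less_trans) simp
  qed
  obtain N where N: "(\<integral>\<^sup>+x. ennreal (\<bar>f N x - g x\<bar> ^ p) \<partial>lebesgue) \<le> ennreal 1" using bound[of 1] by auto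
  have iN: "integrable lebesgue (\<lambda>x. \<bar>f N x - g x\<bar> ^ p)" by (rule int_of[OF N])
  have dom: "integrable lebesgue (\<lambda>x. \<bar>h x - (f N x - g x)\<bar> ^ p)" if h: "Cc h" for h
  proof (rule Bochner_Integration.integrable_bound)
    show "integrable lebesgue (\<lambda>x. 2 ^ (p - 1) * (\<bar>h x\<bar> ^ p + \<bar>f N x - g x\<bar> ^ p))"
      by (intro integrable_mult_right Bochner_Integration.integrable_add iN Cc_integrable Cc_abs_power h p)
    show "(\<lambda>x. \<bar>h x - (f N x - g x)\<bar> ^ p) \<in> borel_measurable lebesgue"
      using borel_measurable_integrable[OF Cc_integrable[OF h]] fm g by simp
    show "AE x in lebesgue. norm (\<bar>h x - (f N x - g x)\<bar> ^ p) \<le> norm (2 ^ (p - 1) * (\<bar>h x\<bar> ^ p + \<bar>f N x - g x\<bar> ^ p))"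
    proof (rule AE_I2)
      fix x
      show "norm (\<bar>h x - (f N x - g x)\<bar> ^ p) \<le> norm (2 ^ (p - 1) * (\<bar>h x\<bar> ^ p + \<bar>f N x - g x\<bar> ^ p))"
      proof -
        have eq: "h x - (f N x - g x) = h x + (g x - f N x)" by simp
        have "\<bar>h x - (f N x - g x)\<bar> ^ p \<le> 2 ^ (p - 1) * (\<bar>h x\<bar> ^ p + \<bar>f N x - g x\<bar> ^ p)"
          unfolding eq abs_minus_commute[of "f N x"] by (rule power_add_le[OF p])
        then show ?thesis by simp
      qed
    qed
  qed
  show i: "integrable lebesgue (\<lambda>x. \<bar>f n x - g x\<bar> ^ p)" for n
    using dom[OF Cc_diff[OF c[of N] c[of n]]] by (simp add: abs_minus_commute)
  show "integrable lebesgue (\<lambda>x. \<bar>g x\<bar> ^ p)"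
    using dom[OF c[of N]] by simp
  show "(\<lambda>n. pint p (\<lambda>x. f n x - g x)) \<longlonglongrightarrow> 0"
  proof (rule LIMSEQ_I)
    fix e :: real assume e: "e > 0"
    obtain N where N: "\<And>n. n \<ge> N \<Longrightarrow> (\<integral>\<^sup>+x. ennreal (\<bar>f n x - g x\<bar> ^ p) \<partial>lebesgue) \<le> ennreal (e / 2)"
      using bound[of "e / 2"] e by auto
    have "norm (pint p (\<lambda>x. f n x - g x) - 0) < e" if "n \<ge> N" for n
    proof -
      have "ennreal (pint p (\<lambda>x. f n x - g x)) \<le> ennreal (e / 2)"
        using N[OF that] nn_integral_eq_integral[OF i[of n]] by (simp add: pint_def)
      then have "pint p (\<lambda>x. f n x - g x) \<le> e / 2" using e by (simp add: ennreal_le_iff)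
      then show ?thesis using e pint_nonneg[of p "\<lambda>x. f n x - g x"] by simp
    qed
    then show "\<exists>N. \<forall>n\<ge>N. norm (pint p (\<lambda>x. f n x - g x) - 0) < e" by blast
  qed
qed

lemma L2_tendsto_AE_subseq:
  assumes "L2_tendsto f g"
  obtains r where "strict_mono r" "AE x in lebesgue. (\<lambda>i. f (r i) x) \<longlonglongrightarrow> g x"
proof -
  have f: "f n \<in> L2" "g \<in> L2" for n using assms by (simp_all add: L2_tendsto_def)
  have lim: "(\<lambda>n. L2_norm (\<lambda>x. f n x - g x)) \<longlonglongrightarrow> 0" using assms by (simp add: L2_tendsto_def)
  have i: "integrable lebesgue (\<lambda>x. (f n x - g x)\<^sup>2)" for n
  proof (rule Bochner_Integration.integrable_bound)
    show "integrable lebesgue (\<lambda>x. 2 * ((f n x)\<^sup>2 + (g x)\<^sup>2))" using f by (auto simp: L2_def)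
    show "(\<lambda>x. (f n x - g x)\<^sup>2) \<in> borel_measurable lebesgue"
      using f by (intro borel_measurable_power borel_measurable_diff) (simp_all add: L2_def)
    show "AE x in lebesgue. norm ((f n x - g x)\<^sup>2) \<le> norm (2 * ((f n x)\<^sup>2 + (g x)\<^sup>2))"
    proof (rule AE_I2)
      fix x
      have "(f n x - g x)\<^sup>2 + (f n x + g x)\<^sup>2 = 2 * ((f n x)\<^sup>2 + (g x)\<^sup>2)" by (simp add: power2_eq_square algebra_simps)
      then have "(f n x - g x)\<^sup>2 \<le> 2 * ((f n x)\<^sup>2 + (g x)\<^sup>2)"
        using zero_le_power2[of "f n x + g x"] by linarith
      then show "norm ((f n x - g x)\<^sup>2) \<le> norm (2 * ((f n x)\<^sup>2 + (g x)\<^sup>2))" by simp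
    qed
  qed
  have "(\<lambda>n. (L2_norm (\<lambda>x. f n x - g x))\<^sup>2) \<longlonglongrightarrow> 0\<^sup>2" by (intro tendsto_intros lim)
  then have "(\<lambda>n. \<integral>x. norm ((f n x - g x)\<^sup>2) \<partial>lebesgue) \<longlonglongrightarrow> 0" by (simp add: L2_norm_def)
  from tendsto_L1_AE_subseq[OF i this]
  obtain r where r: "strict_mono r" "AE x in lebesgue. (\<lambda>n. (f (r n) x - g x)\<^sup>2) \<longlonglongrightarrow> 0" by blast
  have "AE x in lebesgue. (\<lambda>i. f (r i) x) \<longlonglongrightarrow> g x"
  proof (rule AE_mp[OF r(2)], intro AE_I2 impI)
    fix x assume "(\<lambda>n. (f (r n) x - g x)\<^sup>2) \<longlonglongrightarrow> 0"
    then have "(\<lambda>n. sqrt ((f (r n) x - g x)\<^sup>2)) \<longlonglongrightarrow> sqrt 0" by (rule tendsto_real_sqrt)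
    then have "(\<lambda>n. \<bar>f (r n) x - g x\<bar>) \<longlonglongrightarrow> 0" by simp
    then have "(\<lambda>n. f (r n) x - g x) \<longlonglongrightarrow> 0" by (rule tendsto_rabs_zero_cancel)
    then show "(\<lambda>i. f (r i) x) \<longlonglongrightarrow> g x" by (simp add: LIM_zero_iff)
  qed
  with r(1) show ?thesis by (rule that)
qed

lemma Cc_L2: "Cc f \<Longrightarrow> f \<in> L2"
  using Cc_integrable[OF Cc_power[of f 2]] by (auto simp: L2_def intro: borel_measurable_integrable Cc_integrable)

text \<open>Completeness: multiplying by a fixed positive square integrable weight turns an \<open>L\<^sup>2\<close> Cauchy
  sequence into an \<open>L\<^sup>1\<close> Cauchy sequence, which has a subsequence converging almost everywhere.\<close>

lemma L2_complete:
  fixes f :: "nat \<Rightarrow> real ^ 'n::finite \<Rightarrow> real"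
  assumes c: "\<And>n. Cc (f n)" and Cau: "Cauchy_pint 2 f"
  obtains g where "L2_tendsto f g"
proof -
  obtain h where h: "h \<in> borel_measurable lborel" "integral\<^sup>N lborel h \<noteq> \<infinity>" "\<And>x::real ^ 'n. 0 < h x" "\<And>x. h x < \<infinity>"
    using sigma_finite_measure.Ex_finite_integrable_function[OF sigma_finite_lborel] by auto
  define w where "w x = sqrt (enn2real (h x))" for x
  have wb: "w \<in> borel_measurable lborel" unfolding w_def[abs_def] using h(1) by simp
  have w0: "w x > 0" for x unfolding w_def using h(3,4)[of x] by (simp add: enn2real_positive_iff)
  have w2: "integrable lborel (\<lambda>x. (w x)\<^sup>2)"
  proof (rule integrableI_bounded)
    have "ennreal (norm ((w x)\<^sup>2)) = h x" for x
      using h(4)[of x] by (simp add: w_def)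
    then show "(\<integral>\<^sup>+x. ennreal (norm ((w x)\<^sup>2)) \<partial>lborel) < \<infinity>" using h(2) by (simp add: less_top)
  qed (use wb in simp)
  have fb: "Cc k \<Longrightarrow> k \<in> borel_measurable lborel" for k :: "real ^ 'n \<Rightarrow> real" by (rule Cc_lborel)
  have k2: "integrable lborel (\<lambda>x. (k x)\<^sup>2)" if "Cc k" for k :: "real ^ 'n \<Rightarrow> real"
    by (rule Cc_integrable_lborel[OF Cc_power[OF that]]) simp
  have kw: "integrable lborel (\<lambda>x. k x * w x)"
    "(\<integral>x. \<bar>k x * w x\<bar> \<partial>lborel)\<^sup>2 \<le> pint 2 k * (\<integral>x. (w x)\<^sup>2 \<partial>lborel)" if k: "Cc k" for k :: "real ^ 'n \<Rightarrow> real"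
  proof -
    have "pint 2 k = (\<integral>x. (k x)\<^sup>2 \<partial>lborel)"
      using Cc_integral_lborel[OF Cc_power[OF k, of 2]] by (simp add: pint_def)
    then show "integrable lborel (\<lambda>x. k x * w x)"
      "(\<integral>x. \<bar>k x * w x\<bar> \<partial>lborel)\<^sup>2 \<le> pint 2 k * (\<integral>x. (w x)\<^sup>2 \<partial>lborel)"
      using Cauchy_Schwarz_integral[OF fb[OF k] wb k2[OF k] w2] by simp_all
  qed
  define W where "W = (\<integral>x. (w x)\<^sup>2 \<partial>lborel) + 1"
  have W: "W > 0" "(\<integral>x. (w x)\<^sup>2 \<partial>lborel) \<le> W" unfolding W_def by (simp_all add: add_nonneg_pos)
  have "\<exists>N. \<forall>i\<ge>N. \<forall>j\<ge>N. (\<integral>x. norm (f i x * w x - f j x * w x) \<partial>lborel) < e" if e: "e > 0" for e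
  proof -
    have "e\<^sup>2 / W > 0" using e W by simp
    then obtain N where N: "\<And>i j. i \<ge> N \<Longrightarrow> j \<ge> N \<Longrightarrow> pint 2 (\<lambda>x. f i x - f j x) < e\<^sup>2 / W"
      using Cau unfolding Cauchy_pint_def by meson
    have "(\<integral>x. norm (f i x * w x - f j x * w x) \<partial>lborel) < e" if "i \<ge> N" "j \<ge> N" for i j
    proof (rule power2_less_imp_less)
      have "(\<integral>x. norm (f i x * w x - f j x * w x) \<partial>lborel)\<^sup>2 \<le> pint 2 (\<lambda>x. f i x - f j x) * (\<integral>x. (w x)\<^sup>2 \<partial>lborel)"
        using kw(2)[OF Cc_diff[OF c[of i] c[of j]]] by (simp add: left_diff_distrib)
      also have "\<dots> \<le> pint 2 (\<lambda>x. f i x - f j x) * W" using W(2) pint_nonneg by (rule mult_left_mono)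
      also have "\<dots> < e\<^sup>2 / W * W" using N[OF that] W(1) by (rule mult_strict_right_mono)
      finally show "(\<integral>x. norm (f i x * w x - f j x * w x) \<partial>lborel)\<^sup>2 < e\<^sup>2" using W by simp
    qed (use e in simp)
    then show ?thesis by blast
  qed
  from cauchy_L1_AE_cauchy_subseq[OF kw(1)[OF c] this]
  obtain r where r: "strict_mono r" "AE x in lborel. Cauchy (\<lambda>i. f (r i) x * w x)" by blast
  define g where "g x = lim (\<lambda>i. f (r i) x)" for x
  have gb: "g \<in> borel_measurable lborel" unfolding g_def[abs_def]
    by (rule borel_measurable_lim_metric) (rule fb[OF c])
  have lim: "AE x in lebesgue. (\<lambda>i. f (r i) x) \<longlonglongrightarrow> g x"
  proof (rule AE_completion, rule AE_mp[OF r(2)], intro AE_I2 impI)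
    fix x assume "Cauchy (\<lambda>i. f (r i) x * w x)"
    then obtain l where "(\<lambda>i. f (r i) x * w x) \<longlonglongrightarrow> l" using Cauchy_convergent convergent_def by blast
    then have "(\<lambda>i. f (r i) x * w x / w x) \<longlonglongrightarrow> l / w x" by (intro tendsto_divide tendsto_const) (use w0[of x] in auto)
    then have "(\<lambda>i. f (r i) x) \<longlonglongrightarrow> l / w x" using w0[of x] by simp
    then show "(\<lambda>i. f (r i) x) \<longlonglongrightarrow> g x" unfolding g_def by (simp add: limI)
  qed
  have gm: "g \<in> borel_measurable lebesgue" by (rule measurable_completion[OF gb])
  note L = Cauchy_pint_limit[OF c _ Cau r(1) lim gm]
  have "g \<in> L2" using L(2) gm by (simp add: L2_def)
  moreover have "(\<lambda>n. sqrt (pint 2 (\<lambda>x. f n x - g x))) \<longlonglongrightarrow> sqrt 0" by (intro tendsto_real_sqrt L(3)) simp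
  then have "(\<lambda>n. L2_norm (\<lambda>x. f n x - g x)) \<longlonglongrightarrow> 0" by (simp add: L2_norm_def pint_def)
  ultimately have "L2_tendsto f g" using Cc_L2[OF c] by (simp add: L2_tendsto_def)
  then show ?thesis by (rule that)
qed

section \<open>The weak equation for almost solutions\<close>

definition energy_form :: "(real ^ 'n::{finite,one} \<Rightarrow> real) \<Rightarrow> (real ^ 'n::{finite,one} \<Rightarrow> real) \<Rightarrow> real" where
  "energy_form \<phi> \<psi> = (\<Sum>j\<in>UNIV. \<integral>x. partial j \<phi> x * partial j \<psi> x \<partial>lebesgue)
     + (\<integral>x. partial 1 (partial 1 \<phi>) x * partial 1 (partial 1 \<psi>) x \<partial>lebesgue)"

text \<open>For \<open>v = \<partial>\<^sub>1\<phi>\<close> and \<open>v\<^sub>j = \<partial>\<^sub>j\<phi>\<close> this is the left-hand side of the equation applied to \<open>\<psi>\<close>, after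
  integrations by parts that leave an expression symmetric in its linear part; the norm of \<open>Y\<close> is the
  square root of \<open>energy_form \<phi> \<phi>\<close>.\<close>

definition residual :: "(real ^ 'n::{finite,one} \<Rightarrow> real) \<Rightarrow> (real ^ 'n::{finite,one} \<Rightarrow> real) \<Rightarrow> real" where
  "residual \<phi> \<psi> = energy_form \<phi> \<psi> - 1/2 * (\<integral>x. (partial 1 \<phi> x)\<^sup>2 * partial 1 \<psi> x \<partial>lebesgue)"

lemma Cc_integral_diff:
  "Cc f \<Longrightarrow> Cc g \<Longrightarrow> (\<integral>x. f x - g x \<partial>lebesgue) = (\<integral>x. f x \<partial>lebesgue) - (\<integral>x. g x \<partial>lebesgue)"
  by (simp add: Cc_integrable)

lemma Cc_integral_add:
  "Cc f \<Longrightarrow> Cc g \<Longrightarrow> (\<integral>x. f x + g x \<partial>lebesgue) = (\<integral>x. f x \<partial>lebesgue) + (\<integral>x. g x \<partial>lebesgue)"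
  by (simp add: Cc_integrable)

lemma Cc_integral_mono:
  "Cc f \<Longrightarrow> Cc g \<Longrightarrow> (\<And>x. f x \<le> g x) \<Longrightarrow> (\<integral>x. f x \<partial>lebesgue) \<le> (\<integral>x. g x \<partial>lebesgue)"
  by (intro integral_mono Cc_integrable)

lemma Cc_integral_abs_le:
  assumes "Cc f" "Cc g" "\<And>x. \<bar>f x\<bar> \<le> g x"
  shows "\<bar>\<integral>x. f x \<partial>lebesgue\<bar> \<le> (\<integral>x. g x \<partial>lebesgue)"
  using integral_abs_bound[of lebesgue f] Cc_integral_mono[OF Cc_abs[OF assms(1)] assms(2,3)] by linarith

lemma Cc_integral_shift_mult:
  assumes "Cc f" "Cc g"
  shows "(\<integral>x. shift y f x * g x \<partial>lebesgue) = (\<integral>x. f x * shift (- y) g x \<partial>lebesgue)"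
  using Cc_integral_shift[OF Cc_mult[OF assms(1) Cc_shift[OF assms(2), of "- y"]], of y]
  by (simp add: shift_def[abs_def])

lemma pint_2: "pint 2 f = (\<integral>x. f x * f x \<partial>lebesgue)"
  by (simp add: pint_def power2_eq_square)

lemma residual_shift:
  assumes "test_function \<phi>" "test_function \<psi>"
  shows "residual (shift y \<phi>) \<psi> = residual \<phi> (shift (- y) \<psi>)"
proof -
  have t: "test_function (partial j \<phi>)" "test_function (partial j \<psi>)" for j
    by (intro test_partial assms)+
  have p: "partial j (shift z \<phi>) = shift z (partial j \<phi>)" "partial j (shift z \<psi>) = shift z (partial j \<psi>)" for j z
    by (intro test_partial_shift assms)+
  have p2: "partial k (shift z (partial j \<phi>)) = shift z (partial k (partial j \<phi>))"
    "partial k (shift z (partial j \<psi>)) = shift z (partial k (partial j \<psi>))" for j k z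
    by (intro test_partial_shift t)+
  have c: "Cc (partial j \<phi>)" "Cc (partial j \<psi>)" "Cc (partial k (partial j \<phi>))" "Cc (partial k (partial j \<psi>))" for j k
    by (intro test_Cc test_partial assms)+
  have sq: "(shift y f x)\<^sup>2 = shift y (\<lambda>x. (f x)\<^sup>2) x" for f :: "'z::plus \<Rightarrow> real" and y x by (simp add: shift_def)
  show ?thesis
    unfolding residual_def energy_form_def p p2 sq
    by (simp add: Cc_integral_shift_mult c Cc_power)
qed

lemma KP_sq_shift: "test_function \<phi> \<Longrightarrow> KP_sq (shift y \<phi>) = KP_sq \<phi>"
  unfolding KP_sq_def
  by (simp add: test_partial_shift test_partial pint_shift test_Cc)

definition incr :: "'n \<Rightarrow> real \<Rightarrow> (real ^ 'n::finite \<Rightarrow> real) \<Rightarrow> real ^ 'n \<Rightarrow> real" where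
  "incr i s f x = f (x + axis i s) - f x"

lemma incr_shift: "incr i s f = (\<lambda>x. shift (axis i s) f x - f x)"
  by (auto simp: incr_def shift_def)

lemma test_incr: "test_function f \<Longrightarrow> test_function (incr i s f)"
  unfolding incr_shift by (intro test_diff test_shift)

lemma Cc_incr: "Cc f \<Longrightarrow> Cc (incr i s f)"
  unfolding incr_shift by (intro Cc_diff Cc_shift)

lemma partial_incr: "test_function f \<Longrightarrow> partial j (incr i s f) = incr i s (partial j f)"
  unfolding incr_shift by (simp add: test_partial_diff test_shift test_partial_shift)

lemma taylor_incr:
  assumes f: "test_function f" and q: "Cc q" and p: "p \<ge> 1"
    and M: "\<And>s. \<bar>s\<bar> \<le> \<bar>h\<bar> \<Longrightarrow> pint p (\<lambda>x. partial i f (x + axis i s) - q x) \<le> M"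
  shows "pint p (\<lambda>x. incr i h f x - h * q x) \<le> 2 ^ (p - 1) * \<bar>h\<bar> ^ p * M"
  unfolding incr_def by (rule taylor_pint[OF f q p M])

lemma pint_incr_le:
  assumes f: "test_function f"
  shows "pint 2 (incr i h f) \<le> 2 * h\<^sup>2 * pint 2 (partial i f)"
proof -
  have sh: "(\<lambda>x. partial i f (x + axis i s) - 0) = shift (axis i s) (partial i f)" for s by (auto simp: shift_def)
  have "pint 2 (\<lambda>x. incr i h f x - h * 0) \<le> 2 ^ (2 - 1) * \<bar>h\<bar> ^ 2 * pint 2 (partial i f)"
  proof (rule taylor_incr[OF f Cc_zero])
    show "pint 2 (\<lambda>x. partial i f (x + axis i s) - 0) \<le> pint 2 (partial i f)" for s
      unfolding sh by (simp add: pint_shift test_Cc test_partial f)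
  qed simp
  then show ?thesis by simp
qed

lemma power4_le: "(x::real) ^ 4 \<le> y\<^sup>2 \<Longrightarrow> y \<ge> 0 \<Longrightarrow> x\<^sup>2 \<le> y"
  by (rule power2_le_imp_le) (simp_all add: power_mult[symmetric])

text \<open>One parameter \<open>h\<close> serves both as the step of the difference quotients and to measure the residual:
  a residual of size \<open>h\<^sup>2\<close>, tested with functions divided by \<open>h\<close>, still leaves an error of order \<open>h\<close>.\<close>

locale almost_wave =
  fixes \<phi> :: "real ^ 'n::{finite,one} \<Rightarrow> real" and K h :: real
  assumes dim: "CARD('n) = 2 \<or> CARD('n) = 3" and test: "test_function \<phi>"
    and K: "K \<ge> 1" "KP_sq \<phi> \<le> K" and h: "0 < h" "h \<le> 1"
    and resid: "\<And>\<psi>. test_function \<psi> \<Longrightarrow> \<bar>residual \<phi> \<psi>\<bar> \<le> h\<^sup>2 * sqrt (KP_sq \<psi>)"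
begin

abbreviation u where "u \<equiv> partial 1 \<phi>"

lemma tests: "test_function (partial j \<phi>)" "test_function (partial k (partial j \<phi>))"
  by (intro test_partial test)+

lemma Ccs: "Cc \<phi>" "Cc (partial j \<phi>)" "Cc (partial k (partial j \<phi>))"
  by (intro test_Cc test tests)+

lemma pint_bounds: "pint 2 (partial j \<phi>) \<le> K" "pint 2 (partial 1 u) \<le> K"
  using pint_partial_le_KP_sq[of j \<phi>] pint_partial2_le_KP_sq[of \<phi>] K by linarith+

lemma pint3_u: "pint 3 u \<le> 3 * K\<^sup>2"
proof -
  have "pint 3 u ^ 4 \<le> 64 * pint 2 u * KP_sq \<phi> ^ 5" by (rule Gagliardo_Nirenberg[OF dim test])
  also have "\<dots> \<le> 64 * K * K ^ 5"
    using K by (intro mult_mono power_mono pint_bounds mult_nonneg_nonneg pint_nonneg zero_le_power) (auto simp: KP_sq_nonneg)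
  also have "\<dots> = (8 * K ^ 3)\<^sup>2" by (simp add: power2_eq_square eval_nat_numeral)
  finally have "(pint 3 u)\<^sup>2 \<le> 8 * K ^ 3" using K by (intro power4_le) auto
  also have "\<dots> \<le> 9 * K ^ 4" using K by (intro mult_mono power_increasing) auto
  also have "\<dots> = (3 * K\<^sup>2)\<^sup>2" by (simp add: power2_eq_square eval_nat_numeral)
  finally show ?thesis by (rule power2_le_imp_le) simp
qed

text \<open>Subtracting the equation for \<open>\<phi>\<close> from that for a translate and testing with the difference
  \<open>d\<close>, the nonlinear term is quadratic in \<open>\<partial>\<^sub>1 d\<close>. In the Gagliardo--Nirenberg inequality the power of
  the full norm is subcritical, so this term is absorbed: the full norm of \<open>d\<close> is bounded by
  the \<open>L\<^sup>2\<close> norm of \<open>\<partial>\<^sub>1 d\<close> alone.\<close>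

lemma translation_estimate:
  "KP_sq (\<lambda>x. shift y \<phi> x - \<phi> x) \<le> 16 * h ^ 4 + 36864 * K ^ 4 * pint 2 (\<lambda>x. shift y u x - u x)"
proof -
  define d where "d = (\<lambda>x. shift y \<phi> x - \<phi> x)"
  define \<delta> where "\<delta> = (\<lambda>x. shift y u x - u x)"
  define P n where "P = pint 2 \<delta>" and "n = sqrt (KP_sq d)"
  have td: "test_function d" unfolding d_def by (intro test_diff test_shift test)
  have pd: "partial j d = (\<lambda>x. shift y (partial j \<phi>) x - partial j \<phi> x)" for j
    unfolding d_def by (simp add: test_partial_diff test_shift test test_partial_shift)
  have p1: "partial 1 d = \<delta>" by (simp add: pd \<delta>_def)
  have p11: "partial 1 (partial 1 d) = (\<lambda>x. shift y (partial 1 u) x - partial 1 u x)"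
    unfolding pd by (simp add: test_partial_diff test_shift tests test_partial_shift)
  have c\<delta>: "Cc \<delta>" unfolding \<delta>_def by (intro Cc_diff Cc_shift Ccs)
  have cd: "Cc (partial j d)" "Cc (partial 1 (partial 1 d))" for j by (intro test_Cc test_partial td)+
  have cs: "Cc (shift y (partial j \<phi>))" "Cc (shift y (partial 1 u))" for j by (intro Cc_shift Ccs)+
  have n2: "n\<^sup>2 = KP_sq d" by (simp add: n_def KP_sq_nonneg)
  have n0: "n \<ge> 0" by (simp add: n_def KP_sq_nonneg)
  have f: "(\<integral>x. shift y f x * g x \<partial>lebesgue) - (\<integral>x. f x * g x \<partial>lebesgue) = (\<integral>x. (shift y f x - f x) * g x \<partial>lebesgue)"
    if "Cc f" "Cc g" for f g
    using Cc_integral_diff[OF Cc_mult[OF Cc_shift[OF that(1), of y] that(2)] Cc_mult[OF that]]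
    by (simp add: left_diff_distrib)
  have ef: "energy_form (shift y \<phi>) d - energy_form \<phi> d = n\<^sup>2"
  proof -
    have "energy_form (shift y \<phi>) d - energy_form \<phi> d
      = (\<Sum>j\<in>UNIV. (\<integral>x. shift y (partial j \<phi>) x * partial j d x \<partial>lebesgue) - (\<integral>x. partial j \<phi> x * partial j d x \<partial>lebesgue))
      + ((\<integral>x. shift y (partial 1 u) x * partial 1 (partial 1 d) x \<partial>lebesgue) - (\<integral>x. partial 1 u x * partial 1 (partial 1 d) x \<partial>lebesgue))"
      unfolding energy_form_def by (simp add: test_partial_shift test tests sum_subtractf)
    also have "\<dots> = (\<Sum>j\<in>UNIV. pint 2 (partial j d)) + pint 2 (partial 1 (partial 1 d))"
    proof -
      have "shift y (partial j \<phi>) x - partial j \<phi> x = partial j d x" for j x by (simp add: pd)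
      moreover have "shift y (partial 1 u) x - partial 1 u x = partial 1 (partial 1 d) x" for x by (simp add: p11)
      ultimately show ?thesis unfolding f[OF Ccs(2) cd(1)] f[OF Ccs(3) cd(2)] pint_2 by (simp only:)
    qed
    finally show ?thesis unfolding n2 KP_sq_def .
  qed
  let ?N = "\<lambda>v. \<integral>x. (v x)\<^sup>2 * \<delta> x \<partial>lebesgue"
  define X where "X v = (\<integral>x. \<bar>v x\<bar> * (\<delta> x)\<^sup>2 \<partial>lebesgue)" for v
  have cX: "Cc (\<lambda>x. \<bar>v x\<bar> * (\<delta> x)\<^sup>2)" if "Cc v" for v
    using that c\<delta> by (simp add: Cc_mult Cc_abs Cc_power)
  have nl: "?N (shift y u) - ?N u \<le> X (shift y u) + X u"
  proof -
    have c1: "Cc (\<lambda>x. (shift y u x)\<^sup>2 * \<delta> x)" "Cc (\<lambda>x. (u x)\<^sup>2 * \<delta> x)"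
      using cs(1) Ccs(2) c\<delta> by (simp_all add: Cc_mult Cc_power)
    have "?N (shift y u) - ?N u = (\<integral>x. (shift y u x)\<^sup>2 * \<delta> x - (u x)\<^sup>2 * \<delta> x \<partial>lebesgue)"
      by (rule Cc_integral_diff[OF c1, symmetric])
    also have "\<dots> \<le> (\<integral>x. \<bar>shift y u x\<bar> * (\<delta> x)\<^sup>2 + \<bar>u x\<bar> * (\<delta> x)\<^sup>2 \<partial>lebesgue)"
    proof (rule Cc_integral_mono[OF Cc_diff[OF c1] Cc_add[OF cX[OF cs(1)] cX[OF Ccs(2)]]])
      fix x
      have "(shift y u x)\<^sup>2 * \<delta> x - (u x)\<^sup>2 * \<delta> x = (shift y u x + u x) * (\<delta> x)\<^sup>2"
        by (simp add: \<delta>_def power2_eq_square algebra_simps)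
      also have "\<dots> \<le> (\<bar>shift y u x\<bar> + \<bar>u x\<bar>) * (\<delta> x)\<^sup>2"
        by (intro mult_right_mono) auto
      finally show "(shift y u x)\<^sup>2 * \<delta> x - (u x)\<^sup>2 * \<delta> x \<le> \<bar>shift y u x\<bar> * (\<delta> x)\<^sup>2 + \<bar>u x\<bar> * (\<delta> x)\<^sup>2"
        by (simp add: distrib_right)
    qed
    also have "\<dots> = X (shift y u) + X u"
      unfolding X_def by (rule Cc_integral_add[OF cX[OF cs(1)] cX[OF Ccs(2)]])
    finally show ?thesis .
  qed
  have r: "residual (shift y \<phi>) d - residual \<phi> d \<le> 2 * h\<^sup>2 * n"
  proof -
    have "\<bar>residual (shift y \<phi>) d\<bar> \<le> h\<^sup>2 * n"
      unfolding residual_shift[OF test td] n_def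
      using resid[OF test_shift[OF td, of "- y"]] by (simp add: KP_sq_shift[OF td])
    moreover have "\<bar>residual \<phi> d\<bar> \<le> h\<^sup>2 * n" unfolding n_def by (rule resid[OF td])
    ultimately show ?thesis by linarith
  qed
  define Y where "Y = max (X (shift y u)) (X u)"
  have main: "n\<^sup>2 \<le> 2 * h\<^sup>2 * n + Y"
  proof -
    have eq: "residual (shift y \<phi>) d - residual \<phi> d = n\<^sup>2 - 1/2 * (?N (shift y u) - ?N u)"
      unfolding residual_def ef[symmetric] by (simp add: test_partial_shift test p1 algebra_simps)
    have XY: "X (shift y u) \<le> Y" "X u \<le> Y" by (simp_all add: Y_def)
    have lin: "a = m - 1/2 * b \<Longrightarrow> a \<le> c \<Longrightarrow> b \<le> x + z \<Longrightarrow> x \<le> Y \<Longrightarrow> z \<le> Y \<Longrightarrow> m \<le> c + Y"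
      for a b c m x z :: real by (simp add: field_simps)
    show ?thesis by (rule lin[OF eq r nl XY])
  qed
  have X3: "X v ^ 3 \<le> 3 * K\<^sup>2 * (pint 3 \<delta>)\<^sup>2" if "Cc v" "pint 3 v = pint 3 u" for v
  proof -
    have "X v ^ 3 \<le> pint 3 v * (pint 3 \<delta>)\<^sup>2" unfolding X_def pint_def
      by (rule Hoelder_cube(2))
         (simp_all add: that c\<delta> Cc_integrable Cc_abs_power borel_measurable_integrable[OF Cc_integrable])
    also have "\<dots> \<le> 3 * K\<^sup>2 * (pint 3 \<delta>)\<^sup>2" unfolding that(2) by (intro mult_right_mono pint3_u) simp
    finally show ?thesis .
  qed
  have X0: "X v \<ge> 0" for v unfolding X_def by simp
  have Y0: "Y \<ge> 0" unfolding Y_def using X0[of u] by simp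
  have "Y ^ 3 \<le> 3 * K\<^sup>2 * (pint 3 \<delta>)\<^sup>2"
    unfolding Y_def max_def using X3[OF cs(1)] X3[OF Ccs(2)] by (simp add: pint_shift Ccs)
  then have "(Y ^ 3)\<^sup>2 \<le> (3 * K\<^sup>2 * (pint 3 \<delta>)\<^sup>2)\<^sup>2" using Y0 by (intro power_mono) auto
  then have "Y ^ 6 \<le> 9 * K ^ 4 * pint 3 \<delta> ^ 4" by (simp add: power_mult_distrib power_mult[symmetric])
  also have "\<dots> \<le> 9 * K ^ 4 * (64 * P * (n\<^sup>2) ^ 5)"
    using Gagliardo_Nirenberg[OF dim td] unfolding p1 P_def n2 by (intro mult_left_mono) auto
  finally have Y6: "Y ^ 6 \<le> 576 * K ^ 4 * P * n ^ 10" by (simp add: power_mult[symmetric] mult_ac)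
  have P0: "P \<ge> 0" by (simp add: P_def pint_nonneg)
  have C0: "36864 * K ^ 4 * P \<ge> 0" using K P0 by simp
  have "n\<^sup>2 \<le> 16 * h ^ 4 + 36864 * K ^ 4 * P"
  proof (cases "n \<le> 4 * h\<^sup>2")
    case True
    then have "n\<^sup>2 \<le> (4 * h\<^sup>2)\<^sup>2" using n0 by (intro power_mono)
    moreover have "(4 * h\<^sup>2)\<^sup>2 = 16 * h ^ 4" by (simp add: power_mult_distrib power_mult[symmetric])
    ultimately show ?thesis using C0 by linarith
  next
    case False
    then have n: "n > 0" using h by (smt (verit) zero_le_power2)
    have "2 * h\<^sup>2 * n \<le> n\<^sup>2 / 2" using False n by (simp add: power2_eq_square)
    then have "n\<^sup>2 / 2 \<le> Y" using main by simp
    then have "(n\<^sup>2 / 2) ^ 6 \<le> Y ^ 6" by (intro power_mono) auto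
    then have "n ^ 12 / 64 \<le> 576 * K ^ 4 * P * n ^ 10"
      using Y6 by (simp add: power_divide power_mult[symmetric])
    then have "n ^ 10 * n\<^sup>2 \<le> n ^ 10 * (36864 * K ^ 4 * P)"
      by (simp add: power_add[symmetric] mult_ac)
    then have "n\<^sup>2 \<le> 36864 * K ^ 4 * P" by (rule mult_left_le_imp_le) (use n in simp)
    moreover have "0 \<le> 16 * h ^ 4" by simp
    ultimately show ?thesis by linarith
  qed
  then show ?thesis unfolding n2 d_def P_def \<delta>_def .
qed

end

lemma pint2_mult_le:
  assumes f: "Cc f" and b: "continuous_on UNIV b" "\<And>x. \<bar>b x\<bar> \<le> B"
  shows "pint 2 (\<lambda>x. b x * f x) \<le> B\<^sup>2 * pint 2 f"
proof -
  have c: "Cc (\<lambda>x. b x * f x)" by (rule Cc_mult_right[OF f b(1)])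
  have "pint 2 (\<lambda>x. b x * f x) \<le> (\<integral>x. B\<^sup>2 * \<bar>f x\<bar> ^ 2 \<partial>lebesgue)"
    unfolding pint_def
  proof (rule Cc_integral_mono)
    show "Cc (\<lambda>x. \<bar>b x * f x\<bar> ^ 2)" "Cc (\<lambda>x. B\<^sup>2 * \<bar>f x\<bar> ^ 2)"
      using c f by (simp_all add: Cc_power Cc_scale)
    fix x
    have "\<bar>b x\<bar>\<^sup>2 \<le> B\<^sup>2" using b(2)[of x] by (intro power_mono) auto
    then show "\<bar>b x * f x\<bar> ^ 2 \<le> B\<^sup>2 * \<bar>f x\<bar> ^ 2" by (simp add: power_mult_distrib mult_right_mono)
  qed
  then show ?thesis by (simp add: pint_def)
qed

text \<open>The inequality \<open>\<bar>f r\<bar> \<le> (h f\<^sup>2 + r\<^sup>2/h)/2\<close> under the integral.\<close>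

lemma integral_product_le:
  assumes f: "Cc f" and r: "Cc r" and b: "continuous_on UNIV b" "\<And>x. \<bar>b x\<bar> \<le> B" and h: "h > 0"
  shows "\<bar>\<integral>x. b x * (f x * r x) \<partial>lebesgue\<bar> \<le> B * ((h * pint 2 f + pint 2 r / h) / 2)"
proof -
  have B: "B \<ge> 0" using b(2)[of undefined] by linarith
  have cc: "Cc (\<lambda>x. (f x)\<^sup>2)" "Cc (\<lambda>x. (r x)\<^sup>2)" using f r by (simp_all add: Cc_power)
  have "\<bar>\<integral>x. b x * (f x * r x) \<partial>lebesgue\<bar> \<le> (\<integral>x. B * ((h * (f x)\<^sup>2 + (r x)\<^sup>2 / h) / 2) \<partial>lebesgue)"
  proof (rule Cc_integral_abs_le)
    show "Cc (\<lambda>x. b x * (f x * r x))" by (rule Cc_mult_right[OF Cc_mult[OF f r] b(1)])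
    show "Cc (\<lambda>x. B * ((h * (f x)\<^sup>2 + (r x)\<^sup>2 / h) / 2))"
      by (rule Cc_scale[OF Cc_divide[OF Cc_add[OF Cc_scale[OF cc(1)] Cc_divide[OF cc(2)]]]])
    fix x
    have "0 \<le> (sqrt h * \<bar>f x\<bar> - \<bar>r x\<bar> / sqrt h)\<^sup>2" by simp
    also have "\<dots> = h * (f x)\<^sup>2 + (r x)\<^sup>2 / h - 2 * (\<bar>f x\<bar> * \<bar>r x\<bar>)"
      using h by (simp add: power2_diff power_mult_distrib power_divide)
    finally have "\<bar>f x * r x\<bar> \<le> (h * (f x)\<^sup>2 + (r x)\<^sup>2 / h) / 2" by (simp add: abs_mult)
    then show "\<bar>b x * (f x * r x)\<bar> \<le> B * ((h * (f x)\<^sup>2 + (r x)\<^sup>2 / h) / 2)"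
      unfolding abs_mult[of "b x"] using b(2)[of x] B by (intro mult_mono) auto
  qed
  also have "\<dots> = B * ((h * pint 2 f + pint 2 r / h) / 2)"
    using Cc_integrable[OF cc(1)] Cc_integrable[OF cc(2)] by (simp add: pint_def)
  finally show ?thesis .
qed

lemma sin_taylor: "\<bar>sin (a + b) - sin a - b * cos a\<bar> \<le> (b::real)\<^sup>2"
proof -
  have lip: "\<bar>cos x - cos y\<bar> \<le> \<bar>x - y\<bar>" for x y :: real
  proof -
    have "norm (cos x - cos y) \<le> 1 * norm (x - y)"
      by (rule field_differentiable_bound[of UNIV cos "\<lambda>z. - sin z"]) (auto intro!: derivative_eq_intros)
    then show ?thesis by simp
  qed
  let ?F = "\<lambda>t. sin (a + t) - sin a - t * cos a"
  have "norm (?F b - ?F 0) \<le> \<bar>b\<bar> * norm (b - 0)"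
  proof (rule field_differentiable_bound[of "cball 0 \<bar>b\<bar>" ?F "\<lambda>t. cos (a + t) - cos a"])
    show "(?F has_field_derivative cos (a + z) - cos a) (at z within cball 0 \<bar>b\<bar>)" for z
      by (auto intro!: derivative_eq_intros)
    show "norm (cos (a + z) - cos a) \<le> \<bar>b\<bar>" if "z \<in> cball 0 \<bar>b\<bar>" for z
      using lip[of "a + z" a] that by simp
  qed auto
  then show ?thesis by (simp add: power2_eq_square abs_mult_self_eq)
qed

definition trans_const :: "real \<Rightarrow> real" where
  "trans_const K = 16 + 36864 * K ^ 4 * (64 + 8 * (36864 * K ^ 4) * K + 32 * K)"

context almost_wave
begin

abbreviation Q where "Q \<equiv> trans_const K"

lemma Q: "Q \<ge> 1"
  unfolding trans_const_def using K by (simp add: add_increasing2)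

text \<open>In direction 1 the bound holds because \<open>\<partial>\<^sub>1u\<close> is square integrable, and \<open>translation_estimate\<close> turns it
  into a bound of order \<open>h\<^sup>2\<close> for the energy of \<open>f\<close>, the increment of \<open>\<phi>\<close> in direction 1. In direction \<open>i\<close>,
  \<open>u\<close> is compared with \<open>f/h\<close>: the difference is a Taylor remainder, and the increment of \<open>f\<close> is
  controlled by \<open>\<partial>\<^sub>if\<close>, hence by the energy of \<open>f\<close>. This is the relation \<open>\<partial>\<^sub>1v\<^sub>i = \<partial>\<^sub>iv\<close> for differences.\<close>

lemma incr_u_bound:
  assumes s: "\<bar>s\<bar> \<le> h"
  shows "pint 2 (incr i s u) \<le> h\<^sup>2 * (64 + 8 * (36864 * K ^ 4) * K + 32 * K)"
proof -
  define C where "C = 36864 * K ^ 4"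
  have C0: "C \<ge> 0" using K by (simp add: C_def)
  define f where "f = incr 1 h \<phi>"
  define r where "r x = f x - h * u x" for x
  have tf: "test_function f" unfolding f_def by (rule test_incr[OF test])
  have s2: "s\<^sup>2 \<le> h\<^sup>2" using s h by (metis abs_le_square_iff abs_of_pos)
  have i1: "pint 2 (incr 1 t u) \<le> 2 * h\<^sup>2 * K" if "\<bar>t\<bar> \<le> h" for t
  proof -
    have "pint 2 (incr 1 t u) \<le> 2 * t\<^sup>2 * pint 2 (partial 1 u)" by (rule pint_incr_le[OF tests(1)])
    also have "\<dots> \<le> 2 * h\<^sup>2 * K"
    proof (intro mult_mono pint_bounds)
      show "t\<^sup>2 \<le> h\<^sup>2" using that h by (metis abs_le_square_iff abs_of_pos)
    qed (use h in \<open>simp_all add: pint_nonneg\<close>)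
    finally show ?thesis .
  qed
  have Kf: "KP_sq f \<le> 16 * h ^ 4 + C * (2 * h\<^sup>2 * K)"
  proof -
    have "KP_sq f \<le> 16 * h ^ 4 + C * pint 2 (incr 1 h u)"
      using translation_estimate[of "axis 1 h"] by (simp add: f_def incr_shift C_def)
    also have "\<dots> \<le> 16 * h ^ 4 + C * (2 * h\<^sup>2 * K)"
      using i1[of h] h C0 by (intro add_left_mono mult_left_mono) auto
    finally show ?thesis .
  qed
  have a: "pint 2 (incr i s f) \<le> 2 * h\<^sup>2 * (16 * h ^ 4 + C * (2 * h\<^sup>2 * K))"
  proof -
    have "pint 2 (incr i s f) \<le> 2 * s\<^sup>2 * pint 2 (partial i f)" by (rule pint_incr_le[OF tf])
    also have "\<dots> \<le> 2 * h\<^sup>2 * KP_sq f"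
      using s2 by (intro mult_mono pint_partial_le_KP_sq) (simp_all add: pint_nonneg)
    also have "\<dots> \<le> 2 * h\<^sup>2 * (16 * h ^ 4 + C * (2 * h\<^sup>2 * K))" using Kf by (intro mult_left_mono) auto
    finally show ?thesis .
  qed
  have cr: "Cc r" unfolding r_def[abs_def] by (intro Cc_diff Cc_scale test_Cc tf Ccs)
  have rb: "pint 2 r \<le> 4 * h ^ 4 * K"
  proof -
    have "pint 2 (\<lambda>x. incr 1 h \<phi> x - h * u x) \<le> 2 ^ (2 - 1) * \<bar>h\<bar> ^ 2 * (2 * h\<^sup>2 * K)"
    proof (rule taylor_incr[OF test Ccs(2)])
      fix t assume "\<bar>t\<bar> \<le> \<bar>h\<bar>"
      then show "pint 2 (\<lambda>x. u (x + axis 1 t) - u x) \<le> 2 * h\<^sup>2 * K"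
        using i1[of t] h by (simp add: incr_def[abs_def])
    qed simp
    then show ?thesis by (simp add: r_def[abs_def] f_def eval_nat_numeral mult_ac)
  qed
  have b: "pint 2 (incr i s r) \<le> 16 * h ^ 4 * K"
  proof -
    have "incr i s r = (\<lambda>x. shift (axis i s) r x + (-1) * r x)" by (simp add: incr_shift)
    then have "pint 2 (incr i s r) = pint 2 (\<lambda>x. shift (axis i s) r x + (-1) * r x)" by (simp only:)
    also have "\<dots> \<le> 2 ^ (2 - 1) * (pint 2 (shift (axis i s) r) + pint 2 (\<lambda>x. (-1) * r x))"
      by (rule pint_add_le[OF _ Cc_shift[OF cr] Cc_scale[OF cr]]) simp
    also have "\<dots> = 4 * pint 2 r" unfolding pint_scale by (simp add: pint_shift cr)
    finally show ?thesis using rb by linarith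
  qed
  have "h\<^sup>2 * pint 2 (incr i s u) = pint 2 (\<lambda>x. h * incr i s u x)" by (simp add: pint_scale)
  also have "(\<lambda>x. h * incr i s u x) = (\<lambda>x. incr i s f x + (-1) * incr i s r x)"
    by (auto simp: incr_def r_def algebra_simps)
  also have "pint 2 (\<lambda>x. incr i s f x + (-1) * incr i s r x) \<le> 2 ^ (2 - 1) * (pint 2 (incr i s f) + pint 2 (\<lambda>x. (-1) * incr i s r x))"
    by (rule pint_add_le[OF _ Cc_incr[OF test_Cc[OF tf]] Cc_scale[OF Cc_incr[OF cr]]]) simp
  also have "\<dots> = 2 * (pint 2 (incr i s f) + pint 2 (incr i s r))" unfolding pint_scale by simp
  also have "\<dots> \<le> 2 * (2 * h\<^sup>2 * (16 * h ^ 4 + C * (2 * h\<^sup>2 * K)) + 16 * h ^ 4 * K)"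
    by (intro mult_left_mono add_mono a b) simp
  also have "\<dots> = h\<^sup>2 * (h\<^sup>2 * (64 * h\<^sup>2 + 8 * C * K + 32 * K))"
    by (simp add: eval_nat_numeral algebra_simps)
  also have "\<dots> \<le> h\<^sup>2 * (h\<^sup>2 * (64 + 8 * C * K + 32 * K))"
  proof -
    have "h\<^sup>2 \<le> 1" using h by (simp add: power_le_one)
    then show ?thesis by (intro mult_left_mono add_right_mono) auto
  qed
  finally show ?thesis unfolding C_def[symmetric] by (rule mult_left_le_imp_le) (use h in simp)
qed

lemma incr_bound:
  assumes s: "\<bar>s\<bar> \<le> h"
  shows "KP_sq (incr i s \<phi>) \<le> Q * h\<^sup>2"
proof -
  have "KP_sq (incr i s \<phi>) \<le> 16 * h ^ 4 + 36864 * K ^ 4 * pint 2 (incr i s u)"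
    using translation_estimate[of "axis i s"] by (simp add: incr_shift)
  also have "\<dots> \<le> 16 * h\<^sup>2 + 36864 * K ^ 4 * (h\<^sup>2 * (64 + 8 * (36864 * K ^ 4) * K + 32 * K))"
  proof (intro add_mono mult_left_mono incr_u_bound s)
    show "h ^ 4 \<le> h\<^sup>2" using h by (intro power_decreasing) auto
  qed (use K in auto)
  also have "\<dots> = Q * h\<^sup>2" by (simp add: trans_const_def algebra_simps)
  finally show ?thesis .
qed

lemma incr_partial_bound:
  assumes "\<bar>s\<bar> \<le> h"
  shows "pint 2 (incr i s (partial j \<phi>)) \<le> Q * h\<^sup>2" "pint 2 (incr i s (partial 1 u)) \<le> Q * h\<^sup>2"
  using incr_bound[OF assms, of i] pint_partial_le_KP_sq[of j "incr i s \<phi>"] pint_partial2_le_KP_sq[of "incr i s \<phi>"]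
  by (simp_all add: partial_incr test tests)

lemma incr_u_cube:
  assumes "\<bar>s\<bar> \<le> h"
  shows "pint 3 (incr i s u) \<le> 3 * Q\<^sup>2 * h ^ 3"
proof -
  have "pint 3 (incr i s u) ^ 4 \<le> 64 * pint 2 (incr i s u) * KP_sq (incr i s \<phi>) ^ 5"
    using Gagliardo_Nirenberg[OF dim test_incr[OF test], of i s] by (simp add: partial_incr test)
  also have "\<dots> \<le> 64 * (Q * h\<^sup>2) * (Q * h\<^sup>2) ^ 5"
    using incr_partial_bound(1)[OF assms, of i 1] incr_bound[OF assms, of i]
    by (intro mult_mono power_mono) (use Q in \<open>auto simp: KP_sq_nonneg pint_nonneg\<close>)
  also have "\<dots> = (8 * Q ^ 3 * h ^ 6)\<^sup>2" by (simp add: power2_eq_square eval_nat_numeral)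
  finally have "(pint 3 (incr i s u))\<^sup>2 \<le> 8 * Q ^ 3 * h ^ 6" using Q h by (intro power4_le) auto
  also have "\<dots> \<le> 9 * Q ^ 4 * h ^ 6"
    by (intro mult_right_mono mult_mono power_increasing) (use Q h in auto)
  also have "\<dots> = (3 * Q\<^sup>2 * h ^ 3)\<^sup>2" by (simp add: power2_eq_square eval_nat_numeral)
  finally show ?thesis by (rule power2_le_imp_le) (use h in simp)
qed

end

section \<open>Pohozaev identities for almost solutions\<close>

text \<open>The multiplier \<open>x\<^sub>i \<partial>\<^sub>i\<phi>\<close> is replaced by \<open>R sin(x\<^sub>i/R)\<close> times a forward difference quotient of
  \<open>\<phi>\<close>. The weight is bounded with a derivative that tends to \<open>1\<close> boundedly as \<open>R\<close> grows, and it
  depends on \<open>x\<^sub>i\<close> only, so that it commutes with the other derivatives; no cutoff is needed because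
  \<open>\<phi>\<close> has compact support.\<close>

definition weight :: "real \<Rightarrow> nat \<Rightarrow> 'n::finite \<Rightarrow> real ^ 'n \<Rightarrow> real" where
  "weight R m i x = R * (1 / R) ^ m * sin (x $ i / R + real m * (pi / 2))"

lemma cos_eq_sin_shift: "cos (a + real m * (pi / 2)) = sin (a + real (Suc m) * (pi / 2))"
proof -
  have "a + real (Suc m) * (pi / 2) = (a + real m * (pi / 2)) + pi / 2" by (simp add: distrib_right)
  then show ?thesis by (simp only: sin_add[of _ "pi / 2"] sin_pi_half cos_pi_half mult_zero_right mult_1_right add_0_left)
qed

lemma weight_derivative:
  "((\<lambda>t. R * (1 / R) ^ m * sin (t / R + real m * (pi / 2))) has_real_derivative
     R * (1 / R) ^ Suc m * sin (t / R + real (Suc m) * (pi / 2))) (at t)"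
proof -
  have D: "((\<lambda>t. sin (t / R + c)) has_real_derivative cos (t / R + c) * (1 / R)) (at t)" for c
    by (auto intro!: derivative_eq_intros simp: divide_inverse)
  show ?thesis
    by (rule DERIV_cong[OF DERIV_cmult[OF D]]) (unfold cos_eq_sin_shift, simp only: power_Suc mult_ac)
qed

lemma smooth_weight: "smooth (weight R m i)"
  unfolding weight_def[abs_def]
  by (rule smooth_comp_real[of "\<lambda>m t. R * (1 / R) ^ m * sin (t / R + real m * (pi / 2))",
        OF weight_derivative smooth_component])

lemma partial_weight:
  fixes i k :: "'n::finite"
  shows "partial k (weight R m i) x = (if k = i then weight R (Suc m) i x else 0)"
proof -
  have "partial k (\<lambda>x. R * (1 / R) ^ m * sin (x $ i / R + real m * (pi / 2))) x
      = weight R (Suc m) i x * partial k (\<lambda>x. x $ i) x"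
    unfolding weight_def by (rule partial_comp_real[OF weight_derivative differentiable_component])
  then show ?thesis by (simp add: weight_def[abs_def] partial_component)
qed

lemma weight_bounds:
  assumes "R \<ge> 1"
  shows "\<bar>weight R 0 i x\<bar> \<le> R" "\<bar>weight R (Suc 0) i x\<bar> \<le> 1" "\<bar>weight R (Suc (Suc 0)) i x\<bar> \<le> 1 / R"
proof -
  have s: "\<bar>sin t\<bar> \<le> 1" for t :: real by (rule abs_sin_le_one)
  show "\<bar>weight R 0 i x\<bar> \<le> R"
    using mult_left_mono[OF s[of "x $ i / R"], of R] assms by (simp add: weight_def abs_mult)
  show "\<bar>weight R (Suc 0) i x\<bar> \<le> 1"
    using s assms by (simp add: weight_def abs_mult)
  have "weight R (Suc (Suc 0)) i x = (1 / R) * sin (x $ i / R + real (Suc (Suc 0)) * (pi / 2))"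
    using assms by (simp add: weight_def)
  then show "\<bar>weight R (Suc (Suc 0)) i x\<bar> \<le> 1 / R"
    using mult_left_mono[OF s, of "1 / R"] assms by (simp only: abs_mult) simp
qed

lemma weight_1: "R \<ge> 1 \<Longrightarrow> weight R (Suc 0) i x = cos (x $ i / R)"
  by (simp add: weight_def sin_add)

lemma continuous_weight: "continuous_on UNIV (weight R m i)"
  by (rule smooth_continuous[OF smooth_weight])

lemma weight_increment:
  assumes R: "R \<ge> 1" and h: "h > 0"
  shows "\<bar>(weight R 0 i (x - axis i h) - weight R 0 i x) / h + weight R (Suc 0) i x\<bar> \<le> h"
proof -
  let ?a = "x $ i / R" and ?b = "- h / R"
  have "(x - axis i h) $ i / R = ?a + ?b" by (simp add: axis_def diff_divide_distrib)
  then have "weight R 0 i (x - axis i h) - weight R 0 i x + h * weight R (Suc 0) i x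
      = R * (sin (?a + ?b) - sin ?a - ?b * cos ?a)"
  proof -
    have "R * (sin (?a + ?b) - sin ?a - ?b * cos ?a) = R * sin (?a + ?b) - R * sin ?a + h * cos ?a"
      using R by (simp add: right_diff_distrib distrib_left)
    moreover have "weight R 0 i (x - axis i h) = R * sin (?a + ?b)" "weight R 0 i x = R * sin ?a"
      using \<open>(x - axis i h) $ i / R = ?a + ?b\<close> by (simp_all only: weight_def) simp_all
    ultimately show ?thesis by (simp only: weight_1[OF R])
  qed
  then have "\<bar>weight R 0 i (x - axis i h) - weight R 0 i x + h * weight R (Suc 0) i x\<bar> \<le> R * ?b\<^sup>2"
    using mult_left_mono[OF sin_taylor[of ?a ?b], of R] R by (simp add: abs_mult)
  also have "\<dots> = h * (h / R)" using R by (simp add: power2_eq_square)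
  also have "\<dots> \<le> h * h" using R h by (intro mult_left_mono) (auto simp: divide_le_eq)
  finally have "\<bar>weight R 0 i (x - axis i h) - weight R 0 i x + h * weight R (Suc 0) i x\<bar> / h \<le> h"
    using h by (simp add: divide_le_eq)
  moreover have "(weight R 0 i (x - axis i h) - weight R 0 i x) / h + weight R (Suc 0) i x
     = (weight R 0 i (x - axis i h) - weight R 0 i x + h * weight R (Suc 0) i x) / h"
    using h by (simp add: add_divide_distrib)
  ultimately show ?thesis using h by (simp add: abs_divide)
qed

text \<open>Summation by parts: the increment moves onto the weight.\<close>

lemma weight_incr_integral:
  assumes f: "Cc f" and R: "R \<ge> 1" and h: "h > 0"
  shows "\<bar>(\<integral>x. weight R 0 i x * incr i h f x \<partial>lebesgue) / h + (\<integral>x. weight R (Suc 0) i x * f x \<partial>lebesgue)\<bar>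
    \<le> h * (\<integral>x. \<bar>f x\<bar> \<partial>lebesgue)"
proof -
  let ?g = "weight R 0 i" and ?g1 = "weight R (Suc 0) i"
  let ?gs = "\<lambda>x. ?g (x - axis i h)"
  have cg: "continuous_on UNIV ?gs"
    by (rule continuous_on_compose2[OF continuous_weight]) (auto intro!: continuous_on_diff continuous_on_id continuous_on_const)
  have c: "Cc (\<lambda>x. ?g x * shift (axis i h) f x)" "Cc (\<lambda>x. ?g x * f x)" "Cc (\<lambda>x. ?gs x * f x)" "Cc (\<lambda>x. ?g1 x * f x)"
    by (rule Cc_mult_right[OF Cc_shift[OF f] continuous_weight] Cc_mult_right[OF f continuous_weight] Cc_mult_right[OF f cg])+
  have "(\<integral>x. ?g x * incr i h f x \<partial>lebesgue) = (\<integral>x. ?g x * shift (axis i h) f x - ?g x * f x \<partial>lebesgue)"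
    by (simp add: incr_shift right_diff_distrib)
  also have "\<dots> = (\<integral>x. ?g x * shift (axis i h) f x \<partial>lebesgue) - (\<integral>x. ?g x * f x \<partial>lebesgue)"
    by (rule Cc_integral_diff[OF c(1,2)])
  also have "(\<integral>x. ?g x * shift (axis i h) f x \<partial>lebesgue) = (\<integral>x. ?gs x * f x \<partial>lebesgue)"
    using Cc_integral_shift[OF c(3), of "axis i h"] by (simp add: shift_def[abs_def])
  finally have "(\<integral>x. ?g x * incr i h f x \<partial>lebesgue) / h + (\<integral>x. ?g1 x * f x \<partial>lebesgue)
     = (\<integral>x. ((?gs x - ?g x) / h + ?g1 x) * f x \<partial>lebesgue)"
    using Cc_integrable[OF c(3)] Cc_integrable[OF c(2)] Cc_integrable[OF c(4)]
    by (simp add: distrib_right diff_divide_distrib left_diff_distrib)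
  also have "\<bar>\<dots>\<bar> \<le> (\<integral>x. h * \<bar>f x\<bar> \<partial>lebesgue)"
  proof (rule Cc_integral_abs_le)
    show "Cc (\<lambda>x. ((?gs x - ?g x) / h + ?g1 x) * f x)"
      by (rule Cc_mult_right[OF f]) (use h in \<open>intro continuous_on_add continuous_on_divide continuous_on_diff cg continuous_weight continuous_on_const, simp_all\<close>)
    show "Cc (\<lambda>x. h * \<bar>f x\<bar>)" by (intro Cc_scale Cc_abs f)
    show "\<bar>((?gs x - ?g x) / h + ?g1 x) * f x\<bar> \<le> h * \<bar>f x\<bar>" for x
      unfolding abs_mult by (intro mult_right_mono weight_increment R h) simp
  qed
  finally show ?thesis by simp
qed

definition dquot :: "'n \<Rightarrow> real \<Rightarrow> (real ^ 'n::finite \<Rightarrow> real) \<Rightarrow> real ^ 'n \<Rightarrow> real" where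
  "dquot i h f x = incr i h f x / h"

lemma Cc_dquot: "Cc f \<Longrightarrow> Cc (dquot i h f)"
  unfolding dquot_def[abs_def] by (intro Cc_divide Cc_incr)

lemma test_dquot: "test_function f \<Longrightarrow> test_function (dquot i h f)"
  using test_scale[OF test_incr, of f "1 / h" i h] by (simp add: dquot_def[abs_def])

lemma partial_dquot: "test_function f \<Longrightarrow> partial j (dquot i h f) = dquot i h (partial j f)"
  using test_partial_scale[OF test_incr, of f j "1 / h" i h] by (simp add: dquot_def[abs_def] partial_incr)

lemma pint2_dquot: "h > 0 \<Longrightarrow> pint 2 (dquot i h f) = pint 2 (incr i h f) / h\<^sup>2"
  using pint_scale[of 2 "1 / h" "incr i h f"] by (simp add: dquot_def[abs_def] power_divide)

lemma weight_quadratic: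
  assumes f: "Cc f" and R: "R \<ge> 1" and h: "h > 0"
  shows "\<bar>(\<integral>x. f x * (weight R 0 i x * dquot i h f x) \<partial>lebesgue) + 1/2 * (\<integral>x. weight R (Suc 0) i x * (f x)\<^sup>2 \<partial>lebesgue)\<bar>
    \<le> 1/2 * (h * pint 2 f + R / h * pint 2 (incr i h f))"
proof -
  let ?g = "weight R 0 i" and ?f2 = "\<lambda>x. (f x)\<^sup>2"
  have c2: "Cc ?f2" using Cc_power[OF f] by simp
  have ci: "Cc (incr i h f)" "Cc (incr i h ?f2)" "Cc (\<lambda>x. (incr i h f x)\<^sup>2)"
    using Cc_incr[OF f] Cc_incr[OF c2] Cc_power[OF Cc_incr[OF f]] by simp_all
  have cc: "Cc (\<lambda>x. ?g x * incr i h ?f2 x)" "Cc (\<lambda>x. ?g x * (incr i h f x)\<^sup>2)"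
    by (rule Cc_mult_right[OF ci(2) continuous_weight] Cc_mult_right[OF ci(3) continuous_weight])+
  have "f x * (?g x * dquot i h f x) = 1 / (2 * h) * (?g x * incr i h ?f2 x) - 1 / (2 * h) * (?g x * (incr i h f x)\<^sup>2)" for x
    using h by (simp add: dquot_def incr_def power2_eq_square field_simps)
  then have e: "(\<integral>x. f x * (?g x * dquot i h f x) \<partial>lebesgue)
     = 1/2 * ((\<integral>x. ?g x * incr i h ?f2 x \<partial>lebesgue) / h) - 1/2 * (1 / h * (\<integral>x. ?g x * (incr i h f x)\<^sup>2 \<partial>lebesgue))"
    using Cc_integrable[OF cc(1)] Cc_integrable[OF cc(2)] by simp
  have a: "\<bar>(\<integral>x. ?g x * incr i h ?f2 x \<partial>lebesgue) / h + (\<integral>x. weight R (Suc 0) i x * ?f2 x \<partial>lebesgue)\<bar> \<le> h * pint 2 f"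
    using weight_incr_integral[OF c2 R h] by (simp add: pint_def)
  have "\<bar>\<integral>x. ?g x * (incr i h f x)\<^sup>2 \<partial>lebesgue\<bar> \<le> (\<integral>x. R * (incr i h f x)\<^sup>2 \<partial>lebesgue)"
    by (rule Cc_integral_abs_le[OF cc(2) Cc_scale[OF ci(3)]])
       (use weight_bounds(1)[OF R, of i] in \<open>simp add: abs_mult mult_right_mono\<close>)
  also have "\<dots> = R * pint 2 (incr i h f)" by (simp add: pint_def)
  finally have "\<bar>1 / h * (\<integral>x. ?g x * (incr i h f x)\<^sup>2 \<partial>lebesgue)\<bar> \<le> 1 / h * (R * pint 2 (incr i h f))"
    using h unfolding abs_mult by (intro mult_mono) auto
  then have b: "\<bar>1 / h * (\<integral>x. ?g x * (incr i h f x)\<^sup>2 \<partial>lebesgue)\<bar> \<le> R / h * pint 2 (incr i h f)" by simp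
  have lin: "\<bar>1/2 * A - 1/2 * B + 1/2 * C\<bar> \<le> 1/2 * (X + Y)" if "\<bar>A + C\<bar> \<le> X" "\<bar>B\<bar> \<le> Y" for A B C X Y :: real
    using that by argo
  show ?thesis unfolding e by (rule lin[OF a b])
qed

lemma dquot_error:
  assumes f: "test_function f" and h: "h > 0"
    and M: "\<And>s. \<bar>s\<bar> \<le> h \<Longrightarrow> pint 2 (incr i s (partial i f)) \<le> M"
  shows "pint 2 (\<lambda>x. dquot i h f x - partial i f x) \<le> 2 * M"
proof -
  have "pint 2 (\<lambda>x. incr i h f x - h * partial i f x) \<le> 2 ^ (2 - 1) * \<bar>h\<bar> ^ 2 * M"
    by (rule taylor_incr[OF f test_Cc[OF test_partial[OF f]]]) (use M h in \<open>simp_all add: incr_def[abs_def]\<close>)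
  moreover have "(\<lambda>x. incr i h f x - h * partial i f x) = (\<lambda>x. h * (dquot i h f x - partial i f x))"
    using h by (simp add: dquot_def right_diff_distrib)
  ultimately have "h\<^sup>2 * pint 2 (\<lambda>x. dquot i h f x - partial i f x) \<le> h\<^sup>2 * (2 * M)"
    by (simp add: pint_scale mult_ac)
  then show ?thesis by (rule mult_left_le_imp_le) (use h in simp)
qed

lemma weight_dquot_error:
  assumes f: "Cc f" and v: "test_function v" and R: "R \<ge> 1" and h: "h > 0"
    and M: "\<And>s. \<bar>s\<bar> \<le> h \<Longrightarrow> pint 2 (incr i s (partial i v)) \<le> M"
  shows "\<bar>(\<integral>x. f x * (weight R (Suc 0) i x * dquot i h v x) \<partial>lebesgue) - (\<integral>x. weight R (Suc 0) i x * (f x * partial i v x) \<partial>lebesgue)\<bar>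
    \<le> (h * pint 2 f + 2 * M / h) / 2"
proof -
  let ?g = "weight R (Suc 0) i"
  let ?r = "\<lambda>x. dquot i h v x - partial i v x"
  have cd: "Cc (dquot i h v)" "Cc (partial i v)" using Cc_dquot[OF test_Cc[OF v]] test_Cc[OF test_partial[OF v]] by auto
  have cr: "Cc ?r" by (rule Cc_diff[OF cd])
  have c: "Cc (\<lambda>x. ?g x * (f x * dquot i h v x))" "Cc (\<lambda>x. ?g x * (f x * partial i v x))"
    by (rule Cc_mult_right[OF Cc_mult[OF f cd(1)] continuous_weight] Cc_mult_right[OF Cc_mult[OF f cd(2)] continuous_weight])+
  have "(\<integral>x. f x * (?g x * dquot i h v x) \<partial>lebesgue) - (\<integral>x. ?g x * (f x * partial i v x) \<partial>lebesgue)
     = (\<integral>x. ?g x * (f x * dquot i h v x) \<partial>lebesgue) - (\<integral>x. ?g x * (f x * partial i v x) \<partial>lebesgue)"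
    by (simp add: mult.left_commute)
  also have "\<dots> = (\<integral>x. ?g x * (f x * dquot i h v x) - ?g x * (f x * partial i v x) \<partial>lebesgue)"
    by (rule Cc_integral_diff[OF c, symmetric])
  also have "\<dots> = (\<integral>x. ?g x * (f x * ?r x) \<partial>lebesgue)" by (simp add: right_diff_distrib)
  also have "\<bar>\<dots>\<bar> \<le> 1 * ((h * pint 2 f + pint 2 ?r / h) / 2)"
    by (rule integral_product_le[OF f cr continuous_weight weight_bounds(2)[OF R] h])
  also have "\<dots> \<le> (h * pint 2 f + 2 * M / h) / 2"
    unfolding mult_1
    by (intro divide_right_mono add_left_mono dquot_error[OF v h M]) (use h in simp_all)
  finally show ?thesis .
qed

lemma Hoelder_cube_Cc:
  assumes "Cc f" "Cc g"
  shows "(\<integral>x. \<bar>f x\<bar> * (g x)\<^sup>2 \<partial>lebesgue) ^ 3 \<le> pint 3 f * (pint 3 g)\<^sup>2"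
  unfolding pint_def
  by (rule Hoelder_cube(2)) (simp_all add: assms Cc_integrable Cc_abs_power borel_measurable_integrable[OF Cc_integrable])

definition poh_const :: "real \<Rightarrow> real \<Rightarrow> real" where
  "poh_const K R = (let Q = trans_const K in
     (1 + (2 * R\<^sup>2 * Q + 16 * Q + 12 * K)) + (K + R * Q) / 2 + 3 * (K + 2 * Q) / 2
     + (K\<^sup>2 + 3 * R * K * Q\<^sup>2 + R * Q\<^sup>2) / 2 + 5 * Q * K\<^sup>2 / 2)"

context almost_wave
begin

lemma weight_cubic:
  assumes R: "R \<ge> 1"
  shows "\<bar>(\<integral>x. (u x)\<^sup>2 * (weight R 0 i x * dquot i h u x) \<partial>lebesgue) + 1/3 * (\<integral>x. weight R (Suc 0) i x * u x ^ 3 \<partial>lebesgue)\<bar>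
    \<le> h * (K\<^sup>2 + 3 * R * K * Q\<^sup>2 + R * Q\<^sup>2)"
proof -
  let ?g = "weight R 0 i" and ?d = "incr i h u" and ?u3 = "\<lambda>x. u x ^ 3"
  have hh: "\<bar>h\<bar> \<le> h" using h by simp
  have cu: "Cc u" by (rule Ccs)
  have c: "Cc ?u3" "Cc ?d" "Cc (incr i h ?u3)" "Cc (\<lambda>x. u x * (?d x)\<^sup>2)" "Cc (\<lambda>x. ?d x ^ 3)"
    using cu by (simp_all add: Cc_power Cc_incr Cc_mult)
  have cg: "Cc (\<lambda>x. ?g x * incr i h ?u3 x)" "Cc (\<lambda>x. ?g x * (u x * (?d x)\<^sup>2))" "Cc (\<lambda>x. ?g x * ?d x ^ 3)"
    by (rule Cc_mult_right[OF c(3) continuous_weight] Cc_mult_right[OF c(4) continuous_weight] Cc_mult_right[OF c(5) continuous_weight])+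
  have gb: "\<bar>?g x\<bar> \<le> R" for x by (rule weight_bounds(1)[OF R])
  define A where "A = (\<integral>x. ?g x * incr i h ?u3 x \<partial>lebesgue) / h"
  define B where "B = (\<integral>x. ?g x * (u x * (?d x)\<^sup>2) \<partial>lebesgue) / h"
  define C where "C = (\<integral>x. ?g x * ?d x ^ 3 \<partial>lebesgue) / h"
  define U where "U = (\<integral>x. weight R (Suc 0) i x * u x ^ 3 \<partial>lebesgue)"
  have cube: "(a + d) ^ 3 - a ^ 3 = 3 * (a\<^sup>2 * d) + 3 * (a * d\<^sup>2) + d ^ 3" for a d :: real
    by (simp add: power3_eq_cube power2_eq_square algebra_simps)
  have pt: "(u x)\<^sup>2 * (?g x * dquot i h u x) = (1 / (3 * h)) * (?g x * incr i h ?u3 x)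
      - (1 / h) * (?g x * (u x * (?d x)\<^sup>2)) - (1 / (3 * h)) * (?g x * ?d x ^ 3)" for x
  proof -
    have "incr i h ?u3 x = (u x + ?d x) ^ 3 - u x ^ 3" by (simp add: incr_def)
    then have "incr i h ?u3 x = 3 * ((u x)\<^sup>2 * ?d x) + 3 * (u x * (?d x)\<^sup>2) + ?d x ^ 3" by (simp only: cube)
    then show ?thesis using h by (simp add: dquot_def field_simps)
  qed
  have e: "(\<integral>x. (u x)\<^sup>2 * (?g x * dquot i h u x) \<partial>lebesgue) = A / 3 - B - C / 3"
    unfolding pt A_def B_def C_def
    using Cc_integrable[OF cg(1)] Cc_integrable[OF cg(2)] Cc_integrable[OF cg(3)] by simp
  have d3: "pint 3 ?d \<le> 3 * Q\<^sup>2 * h ^ 3" by (rule incr_u_cube[OF hh])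
  have a: "\<bar>A + U\<bar> \<le> h * (3 * K\<^sup>2)"
  proof -
    have "(\<integral>x. \<bar>?u3 x\<bar> \<partial>lebesgue) = pint 3 u" by (simp add: pint_def power_abs)
    then have "\<bar>A + U\<bar> \<le> h * pint 3 u" using weight_incr_integral[OF c(1) R h(1), of i] by (simp add: A_def U_def)
    also have "\<dots> \<le> h * (3 * K\<^sup>2)" using h by (intro mult_left_mono pint3_u) simp
    finally show ?thesis .
  qed
  define X where "X = (\<integral>x. \<bar>u x\<bar> * (?d x)\<^sup>2 \<partial>lebesgue)"
  have X: "X \<le> 3 * K * Q\<^sup>2 * h\<^sup>2"
  proof -
    have "X ^ 3 \<le> pint 3 u * (pint 3 ?d)\<^sup>2" unfolding X_def by (rule Hoelder_cube_Cc[OF cu c(2)])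
    also have "\<dots> \<le> (3 * K\<^sup>2) * (3 * Q\<^sup>2 * h ^ 3)\<^sup>2"
      by (intro mult_mono pint3_u power_mono d3) (simp_all add: pint_nonneg)
    also have "\<dots> = 27 * (K\<^sup>2 * (Q ^ 4 * h ^ 6))" by (simp add: power_mult_distrib power_mult[symmetric])
    also have "\<dots> \<le> 27 * (K ^ 3 * (Q ^ 6 * h ^ 6))"
      by (intro mult_left_mono mult_mono mult_right_mono power_increasing) (use K Q h in auto)
    also have "\<dots> = (3 * K * Q\<^sup>2 * h\<^sup>2) ^ Suc 2" by (simp add: power_mult_distrib power_mult[symmetric])
    finally have "X ^ Suc 2 \<le> (3 * K * Q\<^sup>2 * h\<^sup>2) ^ Suc 2" by (simp add: eval_nat_numeral)
    then show ?thesis by (rule power_le_imp_le_base) (use K Q h in simp)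
  qed
  have b: "\<bar>B\<bar> \<le> h * (3 * R * K * Q\<^sup>2)"
  proof -
    have "\<bar>\<integral>x. ?g x * (u x * (?d x)\<^sup>2) \<partial>lebesgue\<bar> \<le> (\<integral>x. R * (\<bar>u x\<bar> * (?d x)\<^sup>2) \<partial>lebesgue)"
    proof (rule Cc_integral_abs_le[OF cg(2)])
      show "Cc (\<lambda>x. R * (\<bar>u x\<bar> * (?d x)\<^sup>2))" using cu c(2) by (simp add: Cc_scale Cc_mult Cc_abs Cc_power)
      show "\<bar>?g x * (u x * (?d x)\<^sup>2)\<bar> \<le> R * (\<bar>u x\<bar> * (?d x)\<^sup>2)" for x
        using mult_right_mono[OF gb, of "\<bar>u x\<bar> * (?d x)\<^sup>2" x] by (simp add: abs_mult)
    qed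
    also have "\<dots> = R * X" by (simp add: X_def)
    also have "\<dots> \<le> R * (3 * K * Q\<^sup>2 * h\<^sup>2)" using R by (intro mult_left_mono X) simp
    finally have "\<bar>B\<bar> \<le> R * (3 * K * Q\<^sup>2 * h\<^sup>2) / h" unfolding B_def abs_divide using h by (simp add: divide_right_mono)
    also have "\<dots> = h * (3 * R * K * Q\<^sup>2)" using h by (simp add: power2_eq_square)
    finally show ?thesis .
  qed
  have cc: "\<bar>C\<bar> \<le> h * (3 * R * Q\<^sup>2)"
  proof -
    have "\<bar>\<integral>x. ?g x * ?d x ^ 3 \<partial>lebesgue\<bar> \<le> (\<integral>x. R * \<bar>?d x\<bar> ^ 3 \<partial>lebesgue)"
    proof (rule Cc_integral_abs_le[OF cg(3)])
      show "Cc (\<lambda>x. R * \<bar>?d x\<bar> ^ 3)" using c(2) by (simp add: Cc_scale Cc_abs_power)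
      show "\<bar>?g x * ?d x ^ 3\<bar> \<le> R * \<bar>?d x\<bar> ^ 3" for x
        using mult_right_mono[OF gb, of "\<bar>?d x\<bar> ^ 3" x] by (simp add: abs_mult power_abs)
    qed
    also have "\<dots> = R * pint 3 ?d" by (simp add: pint_def)
    also have "\<dots> \<le> R * (3 * Q\<^sup>2 * h ^ 3)" using R by (intro mult_left_mono d3) simp
    finally have "\<bar>C\<bar> \<le> R * (3 * Q\<^sup>2 * h ^ 3) / h" unfolding C_def abs_divide using h by (simp add: divide_right_mono)
    also have "\<dots> = (3 * R * Q\<^sup>2) * h\<^sup>2" using h by (simp add: power2_eq_square power3_eq_cube)
    also have "\<dots> \<le> (3 * R * Q\<^sup>2) * h"
      by (rule mult_left_mono) (use h R in \<open>simp_all add: power2_eq_square\<close>)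
    finally show ?thesis by (simp add: mult.commute)
  qed
  have lin: "\<bar>A / 3 - B - C / 3 + 1/3 * U\<bar> \<le> x / 3 + y + z / 3" if "\<bar>A + U\<bar> \<le> x" "\<bar>B\<bar> \<le> y" "\<bar>C\<bar> \<le> z"
    for A B C U x y z :: real using that by argo
  have "\<bar>A / 3 - B - C / 3 + 1/3 * U\<bar> \<le> h * (3 * K\<^sup>2) / 3 + h * (3 * R * K * Q\<^sup>2) + h * (3 * R * Q\<^sup>2) / 3"
    by (rule lin[OF a b cc])
  also have "h * (3 * K\<^sup>2) / 3 + h * (3 * R * K * Q\<^sup>2) + h * (3 * R * Q\<^sup>2) / 3 = h * (K\<^sup>2 + 3 * R * K * Q\<^sup>2 + R * Q\<^sup>2)"
    by (simp add: distrib_left)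
  finally show ?thesis unfolding e U_def .
qed

lemma dquot_cubic:
  assumes R: "R \<ge> 1"
  shows "\<bar>(\<integral>x. (u x)\<^sup>2 * (weight R (Suc 0) 1 x * dquot 1 h \<phi> x) \<partial>lebesgue) - (\<integral>x. weight R (Suc 0) 1 x * u x ^ 3 \<partial>lebesgue)\<bar>
    \<le> h * (5 * Q * K\<^sup>2)"
proof -
  let ?g = "weight R (Suc 0) 1"
  let ?r = "\<lambda>x. dquot 1 h \<phi> x - u x"
  have cr: "Cc ?r" by (rule Cc_diff[OF Cc_dquot[OF Ccs(1)] Ccs(2)])
  have "pint 3 (\<lambda>x. incr 1 h \<phi> x - h * u x) \<le> 2 ^ (3 - 1) * \<bar>h\<bar> ^ 3 * (3 * Q\<^sup>2 * h ^ 3)"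
    by (rule taylor_incr[OF test Ccs(2)]) (use incr_u_cube h in \<open>simp_all add: incr_def[abs_def]\<close>)
  moreover have "(\<lambda>x. incr 1 h \<phi> x - h * u x) = (\<lambda>x. h * ?r x)"
    using h by (simp add: dquot_def right_diff_distrib)
  ultimately have "h ^ 3 * pint 3 ?r \<le> h ^ 3 * (12 * Q\<^sup>2 * h ^ 3)"
    using h by (simp add: pint_scale mult_ac)
  then have r3: "pint 3 ?r \<le> 12 * Q\<^sup>2 * h ^ 3" by (rule mult_left_le_imp_le) (use h in simp)
  define Y where "Y = (\<integral>x. \<bar>?r x\<bar> * (u x)\<^sup>2 \<partial>lebesgue)"
  have Y: "Y \<le> h * (5 * Q * K\<^sup>2)"
  proof -
    have "Y ^ 3 \<le> pint 3 ?r * (pint 3 u)\<^sup>2" unfolding Y_def by (rule Hoelder_cube_Cc[OF cr Ccs(2)])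
    also have "\<dots> \<le> (12 * Q\<^sup>2 * h ^ 3) * (3 * K\<^sup>2)\<^sup>2"
      by (intro mult_mono power_mono r3 pint3_u) (use h in \<open>simp_all add: pint_nonneg\<close>)
    also have "\<dots> = 108 * (Q\<^sup>2 * (K ^ 4 * h ^ 3))" by (simp add: power_mult_distrib power_mult[symmetric])
    also have "\<dots> \<le> 125 * (Q ^ 3 * (K ^ 6 * h ^ 3))"
      by (intro mult_mono mult_right_mono power_increasing) (use K Q h in auto)
    also have "\<dots> = (h * (5 * Q * K\<^sup>2)) ^ Suc 2" by (simp add: power_mult_distrib power_mult[symmetric])
    finally have "Y ^ Suc 2 \<le> (h * (5 * Q * K\<^sup>2)) ^ Suc 2" by (simp add: eval_nat_numeral)
    then show ?thesis by (rule power_le_imp_le_base) (use K Q h in simp)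
  qed
  have c: "Cc (\<lambda>x. (u x)\<^sup>2 * (?g x * dquot 1 h \<phi> x))" "Cc (\<lambda>x. ?g x * u x ^ 3)"
    by (rule Cc_mult[OF _ Cc_mult_right[OF Cc_dquot[OF Ccs(1)] continuous_weight]] Cc_mult_right[OF _ continuous_weight];
        simp add: Cc_power Ccs)+
  have "(\<integral>x. (u x)\<^sup>2 * (?g x * dquot 1 h \<phi> x) \<partial>lebesgue) - (\<integral>x. ?g x * u x ^ 3 \<partial>lebesgue)
     = (\<integral>x. (u x)\<^sup>2 * (?g x * dquot 1 h \<phi> x) - ?g x * u x ^ 3 \<partial>lebesgue)"
    by (rule Cc_integral_diff[OF c, symmetric])
  also have "\<bar>\<dots>\<bar> \<le> Y" unfolding Y_def
  proof (rule Cc_integral_abs_le[OF Cc_diff[OF c]])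
    show "Cc (\<lambda>x. \<bar>?r x\<bar> * (u x)\<^sup>2)" using cr by (simp add: Cc_mult Cc_abs Cc_power Ccs)
    fix x
    have "(u x)\<^sup>2 * (?g x * dquot 1 h \<phi> x) - ?g x * u x ^ 3 = ?g x * (?r x * (u x)\<^sup>2)"
      by (simp add: power3_eq_cube power2_eq_square algebra_simps)
    also have "\<bar>\<dots>\<bar> \<le> 1 * \<bar>?r x * (u x)\<^sup>2\<bar>"
      unfolding abs_mult[of "?g x"] by (intro mult_right_mono weight_bounds(2)[OF R]) simp
    finally show "\<bar>(u x)\<^sup>2 * (?g x * dquot 1 h \<phi> x) - ?g x * u x ^ 3\<bar> \<le> \<bar>?r x\<bar> * (u x)\<^sup>2" by (simp add: abs_mult)
  qed
  also note Y
  finally show ?thesis .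
qed

lemma pint2_dquot_phi: "pint 2 (dquot i h \<phi>) \<le> 2 * K"
proof -
  have "pint 2 (incr i h \<phi>) \<le> 2 * h\<^sup>2 * pint 2 (partial i \<phi>)" by (rule pint_incr_le[OF test])
  also have "\<dots> \<le> 2 * h\<^sup>2 * K" by (intro mult_left_mono pint_bounds) simp
  finally show ?thesis using h by (simp add: pint2_dquot divide_le_eq mult_ac)
qed

lemma pint2_dquot_sum: "(\<Sum>k\<in>UNIV. pint 2 (dquot i h (partial k \<phi>))) + pint 2 (dquot i h (partial 1 u)) \<le> Q"
proof -
  have "(\<Sum>k\<in>UNIV. pint 2 (dquot i h (partial k \<phi>))) + pint 2 (dquot i h (partial 1 u)) = KP_sq (incr i h \<phi>) / h\<^sup>2"
    using h by (simp add: pint2_dquot KP_sq_def partial_incr test tests add_divide_distrib sum_divide_distrib)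
  also have "\<dots> \<le> Q" using incr_bound[of h i] h by (simp add: divide_le_eq)
  finally show ?thesis .
qed

definition
  "multiplier R i x = weight R 0 i x * dquot i h \<phi> x"

lemma test_multiplier: "test_function (multiplier R i)"
  unfolding multiplier_def[abs_def] by (intro test_mult_smooth test_dquot test smooth_weight)

lemma partial_multiplier:
  "partial k (multiplier R i) = (\<lambda>x. weight R 0 i x * dquot i h (partial k \<phi>) x
     + (if k = i then weight R (Suc 0) i x * dquot i h \<phi> x else 0))"
proof
  fix x
  show "partial k (multiplier R i) x = weight R 0 i x * dquot i h (partial k \<phi>) x
     + (if k = i then weight R (Suc 0) i x * dquot i h \<phi> x else 0)"
    unfolding multiplier_def[abs_def]
    by (subst partial_mult[OF smooth_differentiable[OF smooth_weight] test_differentiable[OF test_dquot[OF test]]])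
       (simp add: partial_dquot test partial_weight)
qed

lemma partial2_multiplier:
  "partial 1 (partial 1 (multiplier R i)) = (\<lambda>x. weight R 0 i x * dquot i h (partial 1 u) x
     + (if i = 1 then 2 * (weight R (Suc 0) 1 x * dquot 1 h u x) + weight R (Suc (Suc 0)) 1 x * dquot 1 h \<phi> x else 0))"
proof
  fix x
  have d: "weight R m i differentiable (at x)" "dquot i h f differentiable (at x)" if "test_function f" for m f
    by (rule smooth_differentiable[OF smooth_weight], rule test_differentiable[OF test_dquot[OF that]])
  have d2: "(\<lambda>x. weight R m i x * dquot i h f x) differentiable (at x)" if "test_function f" for m f
    by (rule differentiable_mult[OF d(1)[OF that] d(2)[OF that]])
  have p: "partial 1 (\<lambda>x. weight R m i x * dquot i h f x) x = weight R m i x * dquot i h (partial 1 f) x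
      + (if i = 1 then weight R (Suc m) i x * dquot i h f x else 0)" if "test_function f" for m f
    by (subst partial_mult[OF d[OF that]]) (auto simp: partial_dquot that partial_weight)
  show "partial 1 (partial 1 (multiplier R i)) x = weight R 0 i x * dquot i h (partial 1 u) x
     + (if i = 1 then 2 * (weight R (Suc 0) 1 x * dquot 1 h u x) + weight R (Suc (Suc 0)) 1 x * dquot 1 h \<phi> x else 0)"
  proof (cases "i = 1")
    case True
    then have "partial 1 (partial 1 (multiplier R i)) x
      = partial 1 (\<lambda>x. weight R 0 i x * dquot i h u x + weight R (Suc 0) i x * dquot i h \<phi> x) x"
      by (simp add: partial_multiplier)
    also have "\<dots> = partial 1 (\<lambda>x. weight R 0 i x * dquot i h u x) x + partial 1 (\<lambda>x. weight R (Suc 0) i x * dquot i h \<phi> x) x"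
      by (rule partial_add[OF d2[OF tests(1)] d2[OF test]])
    finally show ?thesis unfolding p[OF tests(1)] p[OF test] using True by simp
  next
    case False
    then have "partial 1 (partial 1 (multiplier R i)) x = partial 1 (\<lambda>x. weight R 0 i x * dquot i h u x) x"
      by (simp add: partial_multiplier)
    then show ?thesis unfolding p[OF tests(1)] using False by simp
  qed
qed

lemma KP_sq_multiplier:
  assumes R: "R \<ge> 1"
  shows "KP_sq (multiplier R i) \<le> 2 * R\<^sup>2 * Q + 16 * Q + 12 * K"
proof -
  have wb: "pint 2 (\<lambda>x. weight R 0 i x * f x) \<le> R\<^sup>2 * pint 2 f" "pint 2 (\<lambda>x. weight R (Suc 0) i x * f x) \<le> pint 2 f"
    "pint 2 (\<lambda>x. weight R (Suc (Suc 0)) i x * f x) \<le> pint 2 f" if "Cc f" for f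
  proof -
    show "pint 2 (\<lambda>x. weight R 0 i x * f x) \<le> R\<^sup>2 * pint 2 f"
      by (rule pint2_mult_le[OF that continuous_weight weight_bounds(1)[OF R]])
    show "pint 2 (\<lambda>x. weight R (Suc 0) i x * f x) \<le> pint 2 f"
      using pint2_mult_le[OF that continuous_weight weight_bounds(2)[OF R]] by simp
    have "1 / R \<le> 1" using R by simp
    then have "\<bar>weight R (Suc (Suc 0)) i x\<bar> \<le> 1" for x using weight_bounds(3)[OF R, of i x] by linarith
    then show "pint 2 (\<lambda>x. weight R (Suc (Suc 0)) i x * f x) \<le> pint 2 f"
      using pint2_mult_le[OF that continuous_weight, of R "Suc (Suc 0)" i 1] by simp
  qed
  have cw: "Cc (\<lambda>x. weight R m i x * dquot i h f x)" if "Cc f" for m f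
    by (rule Cc_mult_right[OF Cc_dquot[OF that] continuous_weight])
  have cd: "Cc (dquot i h f)" if "Cc f" for f by (rule Cc_dquot[OF that])
  have add2: "pint 2 (\<lambda>x. a x + b x) \<le> 2 * pint 2 a + 2 * pint 2 b" if "Cc a" "Cc b" for a b :: "real ^ 'n::{finite,one} \<Rightarrow> real"
    using pint_add_le[of 2 a b] that by simp
  have Q0: "Q \<ge> 0" and K0: "K \<ge> 0" using Q K by auto
  have 1: "pint 2 (partial k (multiplier R i)) \<le> 2 * R\<^sup>2 * pint 2 (dquot i h (partial k \<phi>)) + (if k = i then 4 * K else 0)" for k
  proof (cases "k = i")
    case True
    have "pint 2 (partial k (multiplier R i)) \<le> 2 * pint 2 (\<lambda>x. weight R 0 i x * dquot i h (partial k \<phi>) x)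
       + 2 * pint 2 (\<lambda>x. weight R (Suc 0) i x * dquot i h \<phi> x)"
      unfolding partial_multiplier using True add2[OF cw[OF Ccs(2)] cw[OF Ccs(1)]] by simp
    also have "\<dots> \<le> 2 * (R\<^sup>2 * pint 2 (dquot i h (partial k \<phi>))) + 2 * (2 * K)"
      using wb(1)[OF cd[OF Ccs(2)], of k] order_trans[OF wb(2)[OF cd[OF Ccs(1)]] pint2_dquot_phi] by (intro add_mono mult_left_mono) auto
    finally show ?thesis using True by simp
  next
    case False
    have "pint 2 (partial k (multiplier R i)) \<le> R\<^sup>2 * pint 2 (dquot i h (partial k \<phi>))"
      unfolding partial_multiplier using False wb(1)[OF cd[OF Ccs(2)], of k] by simp
    moreover have "R\<^sup>2 * pint 2 (dquot i h (partial k \<phi>)) \<ge> 0" by (simp add: pint_nonneg)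
    ultimately show ?thesis using False by simp
  qed
  have 2: "pint 2 (partial 1 (partial 1 (multiplier R i))) \<le> 2 * R\<^sup>2 * pint 2 (dquot i h (partial 1 u)) + (16 * Q + 8 * K)"
  proof (cases "i = 1")
    case True
    have "pint 2 (dquot i h u) \<le> Q"
      using incr_partial_bound(1)[of h i 1] h by (simp add: pint2_dquot divide_le_eq)
    then have q: "pint 2 (\<lambda>x. weight R (Suc 0) i x * dquot i h u x) \<le> Q" using wb(2)[OF cd[OF Ccs(2)], of 1] by linarith
    have r: "pint 2 (\<lambda>x. weight R (Suc (Suc 0)) i x * dquot i h \<phi> x) \<le> 2 * K"
      by (rule order_trans[OF wb(3)[OF cd[OF Ccs(1)]] pint2_dquot_phi])
    let ?b = "\<lambda>x. 2 * (weight R (Suc 0) i x * dquot i h u x) + weight R (Suc (Suc 0)) i x * dquot i h \<phi> x"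
    have "pint 2 ?b \<le> 2 * pint 2 (\<lambda>x. 2 * (weight R (Suc 0) i x * dquot i h u x)) + 2 * pint 2 (\<lambda>x. weight R (Suc (Suc 0)) i x * dquot i h \<phi> x)"
      by (rule add2[OF Cc_scale[OF cw[OF Ccs(2)]] cw[OF Ccs(1)]])
    also have "\<dots> \<le> 2 * (4 * Q) + 2 * (2 * K)"
      unfolding pint_scale using q r by simp
    finally have b: "pint 2 ?b \<le> 8 * Q + 4 * K" by simp
    have "pint 2 (partial 1 (partial 1 (multiplier R i))) = pint 2 (\<lambda>x. weight R 0 i x * dquot i h (partial 1 u) x + ?b x)"
      unfolding partial2_multiplier using True by simp
    also have "\<dots> \<le> 2 * pint 2 (\<lambda>x. weight R 0 i x * dquot i h (partial 1 u) x) + 2 * pint 2 ?b"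
      by (rule add2[OF cw[OF Ccs(3)] Cc_add[OF Cc_scale[OF cw[OF Ccs(2)]] cw[OF Ccs(1)]]])
    also have "\<dots> \<le> 2 * (R\<^sup>2 * pint 2 (dquot i h (partial 1 u))) + 2 * (8 * Q + 4 * K)"
      using b wb(1)[OF cd[OF Ccs(3)], of 1 1] by (intro add_mono mult_left_mono) auto
    finally show ?thesis by simp
  next
    case False
    have "pint 2 (partial 1 (partial 1 (multiplier R i))) \<le> R\<^sup>2 * pint 2 (dquot i h (partial 1 u))"
      unfolding partial2_multiplier using False wb(1)[OF cd[OF Ccs(3)], of 1 1] by simp
    moreover have "R\<^sup>2 * pint 2 (dquot i h (partial 1 u)) \<ge> 0" by (simp add: pint_nonneg)
    ultimately show ?thesis using Q0 K0 by simp
  qed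
  have "KP_sq (multiplier R i) \<le> (\<Sum>k\<in>UNIV. 2 * R\<^sup>2 * pint 2 (dquot i h (partial k \<phi>)) + (if k = i then 4 * K else 0))
      + (2 * R\<^sup>2 * pint 2 (dquot i h (partial 1 u)) + (16 * Q + 8 * K))"
    unfolding KP_sq_def by (intro add_mono sum_mono 1 2)
  also have "\<dots> = 2 * R\<^sup>2 * ((\<Sum>k\<in>UNIV. pint 2 (dquot i h (partial k \<phi>))) + pint 2 (dquot i h (partial 1 u))) + 16 * Q + 12 * K"
    by (simp add: sum.distrib sum_distrib_left distrib_left)
  also have "\<dots> \<le> 2 * R\<^sup>2 * Q + 16 * Q + 12 * K"
    by (intro add_right_mono mult_left_mono pint2_dquot_sum) simp
  finally show ?thesis .
qed

end

context almost_wave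
begin

text \<open>The almost equation is tested with the multiplier. Each quadratic term \<open>\<integral>g f D f\<close>, where \<open>D\<close> is
  the difference quotient and \<open>g\<close> the weight, becomes \<open>-\<integral>g' f\<^sup>2/2\<close> and the cubic term
  \<open>\<integral>g u\<^sup>2 D u\<close> becomes \<open>-\<integral>g' u\<^sup>3/3\<close>, with errors of order \<open>h\<close> for fixed \<open>R\<close>. The extra terms
  for \<open>i = 1\<close> come from the derivatives in direction 1 that fall on the weight; those with second
  derivatives of the weight are of order \<open>1/R\<close>.\<close>

lemma Pohozaev_almost:
  assumes R: "R \<ge> 1"
  shows "\<bar>(- 1/2) * ((\<Sum>k\<in>UNIV. \<integral>x. weight R (Suc 0) i x * (partial k \<phi> x)\<^sup>2 \<partial>lebesgue)
        + (\<integral>x. weight R (Suc 0) i x * (partial 1 u x)\<^sup>2 \<partial>lebesgue))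
      + (\<integral>x. weight R (Suc 0) i x * (partial i \<phi> x)\<^sup>2 \<partial>lebesgue)
      + 1/6 * (\<integral>x. weight R (Suc 0) i x * u x ^ 3 \<partial>lebesgue)
      + (if i = 1 then 2 * (\<integral>x. weight R (Suc 0) i x * (partial 1 u x)\<^sup>2 \<partial>lebesgue)
           - 1/2 * (\<integral>x. weight R (Suc 0) i x * u x ^ 3 \<partial>lebesgue) else 0)\<bar>
    \<le> h * poh_const K R + 3 * K / R"
proof -
  let ?g0 = "weight R 0 i" and ?g1 = "weight R (Suc 0) i"
  define I where "I k = (\<integral>x. ?g1 x * (partial k \<phi> x)\<^sup>2 \<partial>lebesgue)" for k
  define I11 where "I11 = (\<integral>x. ?g1 x * (partial 1 u x)\<^sup>2 \<partial>lebesgue)"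
  define U where "U = (\<integral>x. ?g1 x * u x ^ 3 \<partial>lebesgue)"
  define Tq where "Tq k = (\<integral>x. partial k \<phi> x * (?g0 x * dquot i h (partial k \<phi>) x) \<partial>lebesgue)" for k
  define T3 where "T3 = (\<integral>x. partial i \<phi> x * (?g1 x * dquot i h \<phi> x) \<partial>lebesgue)"
  define Tl where "Tl = (\<integral>x. partial 1 u x * (?g0 x * dquot i h (partial 1 u) x) \<partial>lebesgue)"
  define T4 where "T4 = (\<integral>x. partial 1 u x * (weight R (Suc 0) 1 x * dquot 1 h u x) \<partial>lebesgue)"
  define T5 where "T5 = (\<integral>x. partial 1 u x * (weight R (Suc (Suc 0)) 1 x * dquot 1 h \<phi> x) \<partial>lebesgue)"
  define T6 where "T6 = (\<integral>x. (u x)\<^sup>2 * (?g0 x * dquot i h u x) \<partial>lebesgue)"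
  define T7 where "T7 = (\<integral>x. (u x)\<^sup>2 * (weight R (Suc 0) 1 x * dquot 1 h \<phi> x) \<partial>lebesgue)"
  have cw: "Cc (\<lambda>x. f x * (weight R m j x * dquot j h v x))" if "Cc f" "Cc v" for f v m j
    by (rule Cc_mult[OF that(1) Cc_mult_right[OF Cc_dquot[OF that(2)] continuous_weight]])
  have cu2: "Cc (\<lambda>x. (u x)\<^sup>2)" using Cc_power[OF Ccs(2), of 2] by simp
  have p: "(\<integral>x. partial k \<phi> x * partial k (multiplier R i) x \<partial>lebesgue) = Tq k + (if k = i then T3 else 0)" for k
  proof (cases "k = i")
    case True
    show ?thesis unfolding partial_multiplier Tq_def T3_def using True Cc_integral_add[OF cw[OF Ccs(2) Ccs(2)] cw[OF Ccs(2) Ccs(1)]]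
      by (simp add: distrib_left)
  qed (simp add: partial_multiplier Tq_def)
  have p11: "(\<integral>x. partial 1 u x * partial 1 (partial 1 (multiplier R i)) x \<partial>lebesgue)
      = Tl + (if i = 1 then 2 * T4 + T5 else 0)"
  proof (cases "i = 1")
    case True
    have "(\<integral>x. partial 1 u x * partial 1 (partial 1 (multiplier R i)) x \<partial>lebesgue)
      = (\<integral>x. partial 1 u x * (?g0 x * dquot i h (partial 1 u) x) + (2 * (partial 1 u x * (weight R (Suc 0) 1 x * dquot 1 h u x))
          + partial 1 u x * (weight R (Suc (Suc 0)) 1 x * dquot 1 h \<phi> x)) \<partial>lebesgue)"
      unfolding partial2_multiplier using True by (simp add: distrib_left mult.left_commute[of _ 2])
    also have "\<dots> = Tl + (2 * T4 + T5)"
      unfolding Tl_def T4_def T5_def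
      by (subst Cc_integral_add[OF cw[OF Ccs(3) Ccs(3)] Cc_add[OF Cc_scale[OF cw[OF Ccs(3) Ccs(2)]] cw[OF Ccs(3) Ccs(1)]]],
          subst Cc_integral_add[OF Cc_scale[OF cw[OF Ccs(3) Ccs(2)]] cw[OF Ccs(3) Ccs(1)]]) simp
    finally show ?thesis using True by simp
  qed (simp add: partial2_multiplier Tl_def)
  have pn: "(\<integral>x. (u x)\<^sup>2 * partial 1 (multiplier R i) x \<partial>lebesgue) = T6 + (if i = 1 then T7 else 0)"
  proof (cases "i = 1")
    case True
    show ?thesis unfolding partial_multiplier T6_def T7_def using True Cc_integral_add[OF cw[OF cu2 Ccs(2)] cw[OF cu2 Ccs(1)]]
      by (simp add: distrib_left)
  qed (simp add: partial_multiplier T6_def)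
  have res: "residual \<phi> (multiplier R i) = ((\<Sum>k\<in>UNIV. Tq k) + T3) + (Tl + (if i = 1 then 2 * T4 + T5 else 0))
      - 1/2 * (T6 + (if i = 1 then T7 else 0))"
    unfolding residual_def energy_form_def p p11 pn by (simp add: sum.distrib)
  have Q0: "Q \<ge> 0" using Q by simp
  have hh: "\<bar>h\<bar> \<le> h" using h by simp
  have e0: "\<bar>residual \<phi> (multiplier R i)\<bar> \<le> h * (1 + (2 * R\<^sup>2 * Q + 16 * Q + 12 * K))"
  proof -
    let ?C = "2 * R\<^sup>2 * Q + 16 * Q + 12 * K"
    have C0: "?C \<ge> 0" using Q0 K by simp
    have "sqrt (KP_sq (multiplier R i)) \<le> 1 + ?C"
    proof (rule real_le_lsqrt)
      have sq: "c \<le> (1 + c)\<^sup>2" if "c \<ge> 0" for c :: real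
      proof -
        have "(1 + c)\<^sup>2 = 1 + c\<^sup>2 + 2 * c" by (simp add: power2_sum)
        then show ?thesis using zero_le_power2[of c] that by argo
      qed
      show "KP_sq (multiplier R i) \<le> (1 + ?C)\<^sup>2"
        by (rule order_trans[OF KP_sq_multiplier[OF R] sq[OF C0]])
    qed (use C0 in \<open>simp_all add: KP_sq_nonneg\<close>)
    moreover have "h\<^sup>2 \<le> h" using h by (simp add: power2_eq_square)
    ultimately have "h\<^sup>2 * sqrt (KP_sq (multiplier R i)) \<le> h * (1 + ?C)"
      using h by (intro mult_mono) (auto simp: KP_sq_nonneg)
    then show ?thesis using resid[OF test_multiplier, of R i] by linarith
  qed
  have e1: "\<bar>((\<Sum>k\<in>UNIV. Tq k) + 1/2 * (\<Sum>k\<in>UNIV. I k)) + (Tl + 1/2 * I11)\<bar> \<le> h * ((K + R * Q) / 2)"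
  proof -
    have q: "\<bar>Tq k + 1/2 * I k\<bar> \<le> 1/2 * (h * pint 2 (partial k \<phi>) + R / h * pint 2 (incr i h (partial k \<phi>)))" for k
      unfolding Tq_def I_def by (rule weight_quadratic[OF Ccs(2) R h(1)])
    have l: "\<bar>Tl + 1/2 * I11\<bar> \<le> 1/2 * (h * pint 2 (partial 1 u) + R / h * pint 2 (incr i h (partial 1 u)))"
      unfolding Tl_def I11_def by (rule weight_quadratic[OF Ccs(3) R h(1)])
    have "((\<Sum>k\<in>UNIV. Tq k) + 1/2 * (\<Sum>k\<in>UNIV. I k)) = (\<Sum>k\<in>UNIV. Tq k + 1/2 * I k)"
      by (simp only: sum.distrib sum_distrib_left)
    also have "\<bar>\<dots>\<bar> \<le> (\<Sum>k\<in>UNIV. 1/2 * (h * pint 2 (partial k \<phi>) + R / h * pint 2 (incr i h (partial k \<phi>))))"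
      by (rule order_trans[OF sum_abs sum_mono[OF q]])
    finally have "\<bar>((\<Sum>k\<in>UNIV. Tq k) + 1/2 * (\<Sum>k\<in>UNIV. I k)) + (Tl + 1/2 * I11)\<bar>
       \<le> (\<Sum>k\<in>UNIV. 1/2 * (h * pint 2 (partial k \<phi>) + R / h * pint 2 (incr i h (partial k \<phi>))))
        + 1/2 * (h * pint 2 (partial 1 u) + R / h * pint 2 (incr i h (partial 1 u)))"
      using l by argo
    also have "\<dots> = 1/2 * (h * KP_sq \<phi> + R / h * KP_sq (incr i h \<phi>))"
      unfolding KP_sq_def partial_incr[OF test] partial_incr[OF tests(1)]
      by (simp only: sum_distrib_left[symmetric] sum.distrib distrib_left)
    also have "\<dots> \<le> 1/2 * (h * K + R / h * (Q * h\<^sup>2))"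
      using R h by (intro mult_left_mono add_mono incr_bound[OF hh] K(2)) auto
    also have "\<dots> = h * ((K + R * Q) / 2)" using h by (simp add: power2_eq_square field_simps)
    finally show ?thesis .
  qed
  have M: "pint 2 (incr i s (partial i \<phi>)) \<le> Q * h\<^sup>2" "pint 2 (incr 1 s (partial 1 u)) \<le> Q * h\<^sup>2" if "\<bar>s\<bar> \<le> h" for s
    using incr_partial_bound[OF that] by blast+
  have Eb: "(h * pint 2 f + 2 * (Q * h\<^sup>2) / h) / 2 \<le> h * ((K + 2 * Q) / 2)" if "pint 2 f \<le> K" for f
  proof -
    have "(h * pint 2 f + 2 * (Q * h\<^sup>2) / h) / 2 = h * ((pint 2 f + 2 * Q) / 2)"
      using h by (simp add: power2_eq_square field_simps)
    also have "\<dots> \<le> h * ((K + 2 * Q) / 2)" using that h by (intro mult_left_mono divide_right_mono add_right_mono) auto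
    finally show ?thesis .
  qed
  have sqI: "(\<integral>x. ?g1 x * (f x * f x) \<partial>lebesgue) = (\<integral>x. ?g1 x * (f x)\<^sup>2 \<partial>lebesgue)" for f
    by (simp add: power2_eq_square)
  have e2: "\<bar>T3 - I i\<bar> \<le> h * ((K + 2 * Q) / 2)"
    using order_trans[OF weight_dquot_error[OF Ccs(2) test R h(1) M(1), of i] Eb[OF pint_bounds(1)[of i]]]
    unfolding T3_def I_def sqI .
  have e3: "\<bar>T4 - I11\<bar> \<le> h * ((K + 2 * Q) / 2)" if i: "i = 1"
    using order_trans[OF weight_dquot_error[OF Ccs(3) tests(1) R h(1) M(2), of 1 1] Eb[OF pint_bounds(2)]]
    unfolding T4_def I11_def i sqI[unfolded i] .
  have e4: "\<bar>T5\<bar> \<le> 3 * K / R"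
  proof -
    have "T5 = (\<integral>x. weight R (Suc (Suc 0)) 1 x * (partial 1 u x * dquot 1 h \<phi> x) \<partial>lebesgue)"
      unfolding T5_def by (simp add: mult.left_commute)
    also have "\<bar>\<dots>\<bar> \<le> 1 / R * ((1 * pint 2 (partial 1 u) + pint 2 (dquot 1 h \<phi>) / 1) / 2)"
      by (rule integral_product_le[OF Ccs(3) Cc_dquot[OF Ccs(1)] continuous_weight weight_bounds(3)[OF R]]) simp
    also have "\<dots> \<le> 1 / R * (3 * K)"
    proof (rule mult_left_mono)
      show "(1 * pint 2 (partial 1 u) + pint 2 (dquot 1 h \<phi>) / 1) / 2 \<le> 3 * K"
        using pint_bounds(2) pint2_dquot_phi[of 1] K by argo
    qed (use R in simp)
    finally show ?thesis by simp
  qed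
  have e5: "\<bar>T6 + 1/3 * U\<bar> \<le> h * (K\<^sup>2 + 3 * R * K * Q\<^sup>2 + R * Q\<^sup>2)"
    unfolding T6_def U_def by (rule weight_cubic[OF R])
  have e6: "\<bar>T7 - U\<bar> \<le> h * (5 * Q * K\<^sup>2)" if i: "i = 1"
    unfolding T7_def U_def i by (rule dquot_cubic[OF R])
  define S where "S = (\<Sum>k\<in>UNIV. Tq k)"
  define SI where "SI = (\<Sum>k\<in>UNIV. I k)"
  define E0 E1 E2 E4 E5 E6 where "E0 = h * (1 + (2 * R\<^sup>2 * Q + 16 * Q + 12 * K))"
    and "E1 = h * ((K + R * Q) / 2)" and "E2 = h * ((K + 2 * Q) / 2)" and "E4 = 3 * K / R"
    and "E5 = h * (K\<^sup>2 + 3 * R * K * Q\<^sup>2 + R * Q\<^sup>2)" and "E6 = h * (5 * Q * K\<^sup>2)"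
  have nn: "E2 \<ge> 0" "E4 \<ge> 0" "E6 \<ge> 0"
    unfolding E2_def E4_def E6_def using h K Q0 R by simp_all
  have tot: "E0 + E1 + 3 * E2 + E5 / 2 + E6 / 2 + E4 = h * poh_const K R + 3 * K / R"
    unfolding E0_def E1_def E2_def E4_def E5_def E6_def poh_const_def Let_def by (simp add: field_simps)
  have "\<bar>(- 1/2) * (SI + I11) + I i + 1/6 * U + (if i = 1 then 2 * I11 - 1/2 * U else 0)\<bar>
      \<le> E0 + E1 + 3 * E2 + E5 / 2 + E6 / 2 + E4"
  proof (cases "i = 1")
    case True
    have lin: "\<bar>(- 1/2) * (SI + I11) + Ii + 1/6 * U + (2 * I11 - 1/2 * U)\<bar> \<le> E0 + E1 + 3 * E2 + E5 / 2 + E6 / 2 + E4"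
      if "\<bar>(S + T3) + (Tl + (2 * T4 + T5)) - 1/2 * (T6 + T7)\<bar> \<le> E0"
        "\<bar>(S + 1/2 * SI) + (Tl + 1/2 * I11)\<bar> \<le> E1" "\<bar>T3 - Ii\<bar> \<le> E2" "\<bar>T4 - I11\<bar> \<le> E2" "\<bar>T5\<bar> \<le> E4"
        "\<bar>T6 + 1/3 * U\<bar> \<le> E5" "\<bar>T7 - U\<bar> \<le> E6" for S SI Tl T3 T4 T5 T6 T7 I11 Ii U E0 E1 E2 E4 E5 E6 :: real
      using that unfolding abs_le_iff by (elim conjE, intro conjI) argo+
    have "\<bar>(- 1/2) * (SI + I11) + I i + 1/6 * U + (2 * I11 - 1/2 * U)\<bar> \<le> E0 + E1 + 3 * E2 + E5 / 2 + E6 / 2 + E4"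
    proof (rule lin)
      show "\<bar>(S + T3) + (Tl + (2 * T4 + T5)) - 1/2 * (T6 + T7)\<bar> \<le> E0"
        using e0 True unfolding res S_def E0_def by simp
    qed (use e1 e2 e3[OF True] e4 e5 e6[OF True] in \<open>simp_all only: S_def SI_def E1_def E2_def E4_def E5_def E6_def\<close>)
    then show ?thesis using True by (simp only: if_True refl)
  next
    case False
    have lin: "\<bar>(- 1/2) * (SI + I11) + Ii + 1/6 * U + 0\<bar> \<le> E0 + E1 + 3 * E2 + E5 / 2 + E6 / 2 + E4"
      if "\<bar>(S + T3) + (Tl + 0) - 1/2 * (T6 + 0)\<bar> \<le> E0"
        "\<bar>(S + 1/2 * SI) + (Tl + 1/2 * I11)\<bar> \<le> E1" "\<bar>T3 - Ii\<bar> \<le> E2"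
        "\<bar>T6 + 1/3 * U\<bar> \<le> E5" "0 \<le> E2" "0 \<le> E4" "0 \<le> E6" for S SI Tl T3 T6 I11 Ii U E0 E1 E2 E4 E5 E6 :: real
      using that unfolding abs_le_iff by (elim conjE, intro conjI) argo+
    have "\<bar>(- 1/2) * (SI + I11) + I i + 1/6 * U + 0\<bar> \<le> E0 + E1 + 3 * E2 + E5 / 2 + E6 / 2 + E4"
    proof (rule lin[OF _ _ _ _ nn])
      show "\<bar>(S + T3) + (Tl + 0) - 1/2 * (T6 + 0)\<bar> \<le> E0"
        using e0 False unfolding res S_def E0_def by simp
    qed (use e1 e2 e5 in \<open>simp_all only: S_def SI_def E1_def E2_def E5_def\<close>)
    then show ?thesis using False by (simp only: if_False)
  qed
  then show ?thesis unfolding tot SI_def I_def I11_def U_def .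
qed

end

section \<open>Passing to the limit\<close>

lemma trilinear_bound:
  fixes a b c :: "real ^ 'n::{finite,one} \<Rightarrow> real"
  assumes dim: "CARD('n) = 2 \<or> CARD('n) = 3" and t: "test_function a" "test_function b" "test_function c"
  shows "(\<integral>x. \<bar>partial 1 a x * partial 1 b x * partial 1 c x\<bar> \<partial>lebesgue)\<^sup>2 \<le> 8 * KP_sq a * KP_sq b * KP_sq c"
proof -
  let ?f = "partial 1 a" and ?g = "partial 1 b" and ?k = "partial 1 c"
  have cc: "Cc ?f" "Cc ?g" "Cc ?k" by (intro test_Cc test_partial t)+
  define X where "X f g = (\<integral>x. \<bar>f x\<bar> * (g x)\<^sup>2 \<partial>lebesgue)" for f g :: "real ^ 'n::{finite,one} \<Rightarrow> real"
  define Z where "Z = (\<integral>x. \<bar>?f x * ?g x * ?k x\<bar> \<partial>lebesgue)"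
  define F G H where "F = pint 3 ?f" and "G = pint 3 ?g" and "H = pint 3 ?k"
  define A B C where "A = KP_sq a" and "B = KP_sq b" and "C = KP_sq c"
  have nn: "F \<ge> 0" "G \<ge> 0" "H \<ge> 0" "A \<ge> 0" "B \<ge> 0" "C \<ge> 0" "Z \<ge> 0" "X f g \<ge> 0" for f g
    by (simp_all add: F_def G_def H_def A_def B_def C_def Z_def X_def pint_nonneg KP_sq_nonneg)
  have gn: "pint 3 (partial 1 d) ^ 4 \<le> 64 * KP_sq d ^ 6" if "test_function d" for d :: "real ^ 'n::{finite,one} \<Rightarrow> real"
  proof -
    have "pint 3 (partial 1 d) ^ 4 \<le> 64 * pint 2 (partial 1 d) * KP_sq d ^ 5" by (rule Gagliardo_Nirenberg[OF dim that])
    also have "\<dots> \<le> 64 * KP_sq d * KP_sq d ^ 5"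
      by (intro mult_right_mono mult_left_mono pint_partial_le_KP_sq) (simp_all add: KP_sq_nonneg)
    also have "\<dots> = 64 * KP_sq d ^ 6" by (simp add: eval_nat_numeral)
    finally show ?thesis .
  qed
  have ci: "Cc (\<lambda>x. \<bar>f x\<bar> * (g x)\<^sup>2)" if "Cc f" "Cc g" for f g :: "real ^ 'n::{finite,one} \<Rightarrow> real"
    using that by (simp add: Cc_mult Cc_abs Cc_power)
  have Z2: "Z\<^sup>2 \<le> X ?f ?g * X ?f ?k"
    unfolding Z_def X_def
  proof (rule Cauchy_Schwarz_geometric(2))
    show "(\<lambda>x. ?f x * ?g x * ?k x) \<in> borel_measurable lebesgue"
      by (rule borel_measurable_integrable[OF Cc_integrable[OF Cc_mult[OF Cc_mult[OF cc(1,2)] cc(3)]]])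
    show "integrable lebesgue (\<lambda>x. \<bar>?f x\<bar> * (?g x)\<^sup>2)" "integrable lebesgue (\<lambda>x. \<bar>?f x\<bar> * (?k x)\<^sup>2)"
      by (intro Cc_integrable ci cc)+
    show "(?f x * ?g x * ?k x)\<^sup>2 \<le> \<bar>?f x\<bar> * (?g x)\<^sup>2 * (\<bar>?f x\<bar> * (?k x)\<^sup>2)" for x
      by (simp add: power_mult_distrib power2_eq_square abs_mult_self_eq mult_ac)
  qed simp_all
  have X3: "X ?f ?g ^ 3 \<le> F * G\<^sup>2" "X ?f ?k ^ 3 \<le> F * H\<^sup>2"
    unfolding X_def F_def G_def H_def by (rule Hoelder_cube_Cc, intro cc, intro cc)+
  have "(Z\<^sup>2) ^ 3 \<le> (X ?f ?g * X ?f ?k) ^ 3" by (intro power_mono Z2) simp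
  also have "\<dots> = X ?f ?g ^ 3 * X ?f ?k ^ 3" by (simp add: power_mult_distrib)
  also have "\<dots> \<le> (F * G\<^sup>2) * (F * H\<^sup>2)" using nn by (intro mult_mono X3) auto
  also have "\<dots> = (F * G * H)\<^sup>2" by (simp add: power2_eq_square mult_ac)
  finally have "((Z\<^sup>2) ^ 3)\<^sup>2 \<le> ((F * G * H)\<^sup>2)\<^sup>2" using nn by (intro power_mono) auto
  then have "(Z\<^sup>2) ^ 6 \<le> F ^ 4 * G ^ 4 * H ^ 4" by (simp add: power_mult[symmetric] power_mult_distrib)
  also have "\<dots> \<le> (64 * A ^ 6) * (64 * B ^ 6) * (64 * C ^ 6)"
    unfolding F_def G_def H_def A_def B_def C_def using nn
    by (intro mult_mono gn t) (simp_all add: KP_sq_nonneg pint_nonneg)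
  also have "\<dots> = (8 * A * B * C) ^ Suc 5" by (simp add: power_mult_distrib)
  finally have "(Z\<^sup>2) ^ Suc 5 \<le> (8 * A * B * C) ^ Suc 5" by (simp only: numeral_eq_Suc pred_numeral_simps arith_simps)
  then have "Z\<^sup>2 \<le> 8 * A * B * C" by (rule power_le_imp_le_base) (use nn in simp)
  then show ?thesis by (simp add: Z_def A_def B_def C_def)
qed

lemma KP_norm_sqrt: "KP_norm \<phi> = sqrt (KP_sq \<phi>)"
proof -
  have "(L2_norm f)\<^sup>2 = pint 2 f" for f :: "real ^ 'a::{finite,one} \<Rightarrow> real" by (simp add: L2_norm_def pint_def)
  then show ?thesis by (simp add: KP_norm_def KP_sq_def)
qed

lemma energy_form_bound:
  assumes "test_function a" "test_function b"
  shows "\<bar>energy_form a b\<bar> \<le> sqrt (KP_sq a) * sqrt (KP_sq b)"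
proof -
  have cs: "\<bar>\<integral>x. f x * g x \<partial>lebesgue\<bar> \<le> t * pint 2 f / 2 + pint 2 g / (2 * t)" if "Cc f" "Cc g" "t > 0" for f g :: "real ^ 'a::{finite,one} \<Rightarrow> real" and t
    using integral_product_le[OF that(1,2) continuous_on_const[of UNIV "1::real"] _ that(3), of 1] by (simp add: add_divide_distrib mult.commute)
  have c: "Cc (partial j a)" "Cc (partial j b)" "Cc (partial 1 (partial 1 a))" "Cc (partial 1 (partial 1 b))" for j
    by (intro test_Cc test_partial assms)+
  have bound: "\<bar>energy_form a b\<bar> \<le> t * KP_sq a / 2 + KP_sq b / (2 * t)" if "t > 0" for t
  proof -
    have "\<bar>energy_form a b\<bar> \<le> \<bar>\<Sum>j\<in>UNIV. \<integral>x. partial j a x * partial j b x \<partial>lebesgue\<bar> + \<bar>\<integral>x. partial 1 (partial 1 a) x * partial 1 (partial 1 b) x \<partial>lebesgue\<bar>"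
      unfolding energy_form_def by (rule abs_triangle_ineq)
    also have "\<dots> \<le> (\<Sum>j\<in>UNIV. t * pint 2 (partial j a) / 2 + pint 2 (partial j b) / (2 * t))
        + (t * pint 2 (partial 1 (partial 1 a)) / 2 + pint 2 (partial 1 (partial 1 b)) / (2 * t))"
      by (intro add_mono order_trans[OF sum_abs] sum_mono cs c that)
    also have "\<dots> = t * KP_sq a / 2 + KP_sq b / (2 * t)"
      by (simp add: KP_sq_def sum.distrib sum_distrib_left sum_divide_distrib add_divide_distrib distrib_left)
    finally show ?thesis .
  qed
  define X A B where "X = \<bar>energy_form a b\<bar>" and "A = KP_sq a" and "B = KP_sq b"
  have nn: "A \<ge> 0" "B \<ge> 0" "X \<ge> 0" by (simp_all add: A_def B_def X_def KP_sq_nonneg)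
  have b2: "X \<le> sqrt (A + e) * sqrt (B + e)" if e: "e > 0" for e
  proof -
    define t where "t = sqrt (B + e) / sqrt (A + e)"
    have p: "sqrt (A + e) > 0" "sqrt (B + e) > 0" using nn e by simp_all
    have "X \<le> t * A / 2 + B / (2 * t)" unfolding X_def A_def B_def by (rule bound) (use p in \<open>simp add: t_def\<close>)
    also have "\<dots> \<le> t * (A + e) / 2 + (B + e) / (2 * t)"
      using p e by (intro add_mono divide_right_mono mult_left_mono) (simp_all add: t_def)
    also have "t * (A + e) = sqrt (A + e) * sqrt (B + e)"
    proof -
      have "A + e = sqrt (A + e) * sqrt (A + e)" using nn e by simp
      then have "t * (A + e) = sqrt (B + e) / sqrt (A + e) * (sqrt (A + e) * sqrt (A + e))" unfolding t_def by (simp only:)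
      moreover have "q / p * (p * p) = p * q" if "p > 0" for p q :: real using that by simp
      ultimately show ?thesis using p(1) by (simp only:)
    qed
    also have "(B + e) / (2 * t) = sqrt (A + e) * sqrt (B + e) / 2"
    proof -
      have "B + e = sqrt (B + e) * sqrt (B + e)" using nn e by simp
      then have "(B + e) / (2 * t) = sqrt (B + e) * sqrt (B + e) / (2 * (sqrt (B + e) / sqrt (A + e)))" unfolding t_def by (simp only:)
      moreover have "q * q / (2 * (q / p)) = p * q / 2" if "p > 0" "q > 0" for p q :: real
        using that by (simp add: field_simps)
      ultimately show ?thesis using p by (simp only:)
    qed
    finally show ?thesis by simp
  qed
  have lim: "(\<lambda>n. sqrt (A + inverse (real (Suc n))) * sqrt (B + inverse (real (Suc n)))) \<longlonglongrightarrow> sqrt (A + 0) * sqrt (B + 0)"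
    by (intro tendsto_intros LIMSEQ_inverse_real_of_nat)
  have "X \<le> sqrt (A + 0) * sqrt (B + 0)"
    by (rule LIMSEQ_le_const[OF lim]) (use b2 in auto)
  then show ?thesis by (simp add: X_def A_def B_def)
qed

lemma L2_D: "f \<in> L2 \<Longrightarrow> f \<in> borel_measurable lebesgue" "f \<in> L2 \<Longrightarrow> integrable lebesgue (\<lambda>x. (f x)\<^sup>2)"
  by (simp_all add: L2_def)

lemma L2_product: "f \<in> L2 \<Longrightarrow> g \<in> L2 \<Longrightarrow> integrable lebesgue (\<lambda>x. f x * g x)"
  by (rule Cauchy_Schwarz_integral(1)) (simp_all add: L2_D)

lemma L2_diff:
  assumes "f \<in> L2" "g \<in> L2" shows "(\<lambda>x. f x - g x) \<in> L2"
proof -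
  have "integrable lebesgue (\<lambda>x. (f x)\<^sup>2 + (g x)\<^sup>2 - 2 * (f x * g x))"
    using L2_D(2)[OF assms(1)] L2_D(2)[OF assms(2)] L2_product[OF assms] by simp
  moreover have "(f x - g x)\<^sup>2 = (f x)\<^sup>2 + (g x)\<^sup>2 - 2 * (f x * g x)" for x by (simp add: power2_diff mult.assoc)
  ultimately show ?thesis using L2_D(1)[OF assms(1)] L2_D(1)[OF assms(2)] by (simp add: L2_def)
qed

lemma L2_product_bound:
  assumes f: "f \<in> L2" and g: "g \<in> L2" and b: "b \<in> borel_measurable lebesgue" "\<And>x. \<bar>b x\<bar> \<le> B"
  shows "integrable lebesgue (\<lambda>x. b x * (f x * g x))"
    "\<bar>\<integral>x. b x * (f x * g x) \<partial>lebesgue\<bar> \<le> B * (sqrt (pint 2 f) * sqrt (pint 2 g))"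
proof -
  have B: "B \<ge> 0" using b(2)[of undefined] by linarith
  note i = L2_product[OF f g]
  have pw: "\<bar>b x * (f x * g x)\<bar> \<le> B * \<bar>f x * g x\<bar>" for x
    unfolding abs_mult[of "b x"] by (intro mult_right_mono b) simp
  show ib: "integrable lebesgue (\<lambda>x. b x * (f x * g x))"
  proof (rule Bochner_Integration.integrable_bound[OF integrable_mult_right[OF integrable_abs[OF i], of B]])
    show "(\<lambda>x. b x * (f x * g x)) \<in> borel_measurable lebesgue" using b(1) L2_D(1)[OF f] L2_D(1)[OF g] by simp
    show "AE x in lebesgue. norm (b x * (f x * g x)) \<le> norm (B * \<bar>f x * g x\<bar>)"
      by (rule AE_I2) (use pw B in \<open>simp add: abs_mult\<close>)
  qed
  have "\<bar>\<integral>x. b x * (f x * g x) \<partial>lebesgue\<bar> \<le> (\<integral>x. \<bar>b x * (f x * g x)\<bar> \<partial>lebesgue)" by (rule integral_abs_bound)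
  also have "\<dots> \<le> (\<integral>x. B * \<bar>f x * g x\<bar> \<partial>lebesgue)"
    using ib i by (intro integral_mono pw integrable_abs integrable_mult_right) auto
  also have "\<dots> = B * (\<integral>x. \<bar>f x * g x\<bar> \<partial>lebesgue)" by simp
  also have "\<dots> \<le> B * (sqrt (pint 2 f) * sqrt (pint 2 g))"
  proof (rule mult_left_mono[OF _ B])
    have "(\<integral>x. \<bar>f x * g x\<bar> \<partial>lebesgue)\<^sup>2 \<le> pint 2 f * pint 2 g"
      using Cauchy_Schwarz_integral(2)[OF L2_D(1)[OF f] L2_D(1)[OF g] L2_D(2)[OF f] L2_D(2)[OF g]] by (simp add: pint_def)
    then show "(\<integral>x. \<bar>f x * g x\<bar> \<partial>lebesgue) \<le> sqrt (pint 2 f) * sqrt (pint 2 g)"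
      by (simp add: real_le_rsqrt real_sqrt_mult[symmetric])
  qed
  finally show "\<bar>\<integral>x. b x * (f x * g x) \<partial>lebesgue\<bar> \<le> B * (sqrt (pint 2 f) * sqrt (pint 2 g))" .
qed

lemma L2_tendstoD:
  assumes "L2_tendsto f F"
  shows "f n \<in> L2" "F \<in> L2" "(\<lambda>n. sqrt (pint 2 (\<lambda>x. f n x - F x))) \<longlonglongrightarrow> 0"
  using assms by (simp_all add: L2_tendsto_def L2_norm_def pint_def)

lemma tendsto_weighted_product:
  assumes f: "L2_tendsto f F" and g: "L2_tendsto g G" and b: "b \<in> borel_measurable lebesgue" "\<And>x. \<bar>b x\<bar> \<le> B"
  shows "(\<lambda>n. \<integral>x. b x * (f n x * g n x) \<partial>lebesgue) \<longlonglongrightarrow> (\<integral>x. b x * (F x * G x) \<partial>lebesgue)"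
proof -
  note fL = L2_tendstoD[OF f] and gL = L2_tendstoD[OF g]
  let ?df = "\<lambda>n x. f n x - F x" and ?dg = "\<lambda>n x. g n x - G x"
  let ?a = "\<lambda>n. sqrt (pint 2 (?df n))" and ?b = "\<lambda>n. sqrt (pint 2 (?dg n))"
  have d: "?df n \<in> L2" "?dg n \<in> L2" for n using L2_diff[OF fL(1,2)] L2_diff[OF gL(1,2)] by auto
  note P = L2_product_bound[OF _ _ b]
  have e: "(\<integral>x. b x * (f n x * g n x) \<partial>lebesgue) - (\<integral>x. b x * (F x * G x) \<partial>lebesgue)
     = (\<integral>x. b x * (?df n x * ?dg n x) \<partial>lebesgue) + (\<integral>x. b x * (?df n x * G x) \<partial>lebesgue) + (\<integral>x. b x * (F x * ?dg n x) \<partial>lebesgue)" for n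
  proof -
    have "(\<integral>x. b x * (f n x * g n x) \<partial>lebesgue) - (\<integral>x. b x * (F x * G x) \<partial>lebesgue)
      = (\<integral>x. b x * (f n x * g n x) - b x * (F x * G x) \<partial>lebesgue)"
      using P(1)[OF fL(1) gL(1)] P(1)[OF fL(2) gL(2)] by simp
    also have "\<dots> = (\<integral>x. (b x * (?df n x * ?dg n x) + b x * (?df n x * G x)) + b x * (F x * ?dg n x) \<partial>lebesgue)"
      by (intro Bochner_Integration.integral_cong refl) (simp add: algebra_simps)
    also have "\<dots> = (\<integral>x. b x * (?df n x * ?dg n x) \<partial>lebesgue) + (\<integral>x. b x * (?df n x * G x) \<partial>lebesgue) + (\<integral>x. b x * (F x * ?dg n x) \<partial>lebesgue)"
      using P(1)[OF d] P(1)[OF d(1) gL(2)] P(1)[OF fL(2) d(2)] by (subst Bochner_Integration.integral_add, simp, simp, subst Bochner_Integration.integral_add) simp_all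
    finally show ?thesis .
  qed
  have "(\<lambda>n. (\<integral>x. b x * (f n x * g n x) \<partial>lebesgue) - (\<integral>x. b x * (F x * G x) \<partial>lebesgue)) \<longlonglongrightarrow> 0"
  proof (rule Lim_null_comparison)
    show "\<forall>\<^sub>F n in sequentially. norm ((\<integral>x. b x * (f n x * g n x) \<partial>lebesgue) - (\<integral>x. b x * (F x * G x) \<partial>lebesgue))
        \<le> B * (?a n * ?b n) + B * (?a n * sqrt (pint 2 G)) + B * (sqrt (pint 2 F) * ?b n)"
    proof (rule always_eventually, rule allI)
      fix n
      show "norm ((\<integral>x. b x * (f n x * g n x) \<partial>lebesgue) - (\<integral>x. b x * (F x * G x) \<partial>lebesgue))
        \<le> B * (?a n * ?b n) + B * (?a n * sqrt (pint 2 G)) + B * (sqrt (pint 2 F) * ?b n)"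
        unfolding e real_norm_def
        by (rule order_trans[OF abs_triangle_ineq add_mono[OF order_trans[OF abs_triangle_ineq add_mono[OF P(2)[OF d] P(2)[OF d(1) gL(2)]]] P(2)[OF fL(2) d(2)]]])
    qed
    have "(\<lambda>n. B * (?a n * ?b n) + B * (?a n * sqrt (pint 2 G)) + B * (sqrt (pint 2 F) * ?b n))
       \<longlonglongrightarrow> B * (0 * 0) + B * (0 * sqrt (pint 2 G)) + B * (sqrt (pint 2 F) * 0)"
      by (intro tendsto_intros fL(3) gL(3))
    then show "(\<lambda>n. B * (?a n * ?b n) + B * (?a n * sqrt (pint 2 G)) + B * (sqrt (pint 2 F) * ?b n)) \<longlonglongrightarrow> 0" by simp
  qed
  then show ?thesis by (simp add: LIM_zero_iff)
qed

lemma Hoelder_root: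
  assumes m: "f \<in> borel_measurable lebesgue" "g \<in> borel_measurable lebesgue"
    and i: "integrable lebesgue (\<lambda>x. \<bar>f x\<bar> ^ 3)" "integrable lebesgue (\<lambda>x. \<bar>g x\<bar> ^ 3)"
  shows "integrable lebesgue (\<lambda>x. \<bar>f x\<bar> * (g x)\<^sup>2)" "(\<integral>x. \<bar>f x\<bar> * (g x)\<^sup>2 \<partial>lebesgue) \<le> root 3 (pint 3 f * (pint 3 g)\<^sup>2)"
proof -
  show "integrable lebesgue (\<lambda>x. \<bar>f x\<bar> * (g x)\<^sup>2)" by (rule Hoelder_cube(1)[OF m i])
  have "(\<integral>x. \<bar>f x\<bar> * (g x)\<^sup>2 \<partial>lebesgue) = root 3 ((\<integral>x. \<bar>f x\<bar> * (g x)\<^sup>2 \<partial>lebesgue) ^ 3)"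
    by (rule real_root_power_cancel[symmetric]) simp_all
  also have "\<dots> \<le> root 3 (pint 3 f * (pint 3 g)\<^sup>2)"
    using Hoelder_cube(2)[OF m i] by (simp add: pint_def)
  finally show "(\<integral>x. \<bar>f x\<bar> * (g x)\<^sup>2 \<partial>lebesgue) \<le> root 3 (pint 3 f * (pint 3 g)\<^sup>2)" .
qed

lemma integrable_cube:
  fixes f :: "real ^ 'n::finite \<Rightarrow> real"
  assumes "f \<in> borel_measurable lebesgue" "integrable lebesgue (\<lambda>x. \<bar>f x\<bar> ^ 3)"
    and b: "b \<in> borel_measurable lebesgue" "\<And>x. \<bar>b x\<bar> \<le> 1"
  shows "integrable lebesgue (\<lambda>x. b x * f x ^ 3)"
proof (rule Bochner_Integration.integrable_bound[OF assms(2)])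
  show "(\<lambda>x. b x * f x ^ 3) \<in> borel_measurable lebesgue" using assms(1) b(1) by simp
  show "AE x in lebesgue. norm (b x * f x ^ 3) \<le> norm (\<bar>f x\<bar> ^ 3)"
  proof (rule AE_I2)
    fix x show "norm (b x * f x ^ 3) \<le> norm (\<bar>f x\<bar> ^ 3)"
      using mult_right_mono[OF b(2)[of x], of "\<bar>f x\<bar> ^ 3"] by (simp add: abs_mult power_abs)
  qed
qed

lemma tendsto_weighted_cube:
  fixes f :: "nat \<Rightarrow> real ^ 'n::finite \<Rightarrow> real"
  assumes c: "\<And>n. Cc (f n)" and F: "F \<in> borel_measurable lebesgue"
    and i: "\<And>n. integrable lebesgue (\<lambda>x. \<bar>f n x - F x\<bar> ^ 3)" "integrable lebesgue (\<lambda>x. \<bar>F x\<bar> ^ 3)"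
    and lim: "(\<lambda>n. pint 3 (\<lambda>x. f n x - F x)) \<longlonglongrightarrow> 0"
    and b: "b \<in> borel_measurable lebesgue" "\<And>x. \<bar>b x\<bar> \<le> 1"
  shows "(\<lambda>n. \<integral>x. b x * f n x ^ 3 \<partial>lebesgue) \<longlonglongrightarrow> (\<integral>x. b x * F x ^ 3 \<partial>lebesgue)"
proof -
  let ?d = "\<lambda>n x. f n x - F x" and ?D = "\<lambda>n. pint 3 (\<lambda>x. f n x - F x)"
  have fm: "f n \<in> borel_measurable lebesgue" for n by (rule borel_measurable_integrable[OF Cc_integrable[OF c]])
  have dm: "?d n \<in> borel_measurable lebesgue" for n using fm F by simp
  have fi: "integrable lebesgue (\<lambda>x. \<bar>f n x\<bar> ^ 3)" for n by (rule Cc_integrable[OF Cc_abs_power[OF c]]) simp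
  have "(\<lambda>n. (\<integral>x. b x * f n x ^ 3 \<partial>lebesgue) - (\<integral>x. b x * F x ^ 3 \<partial>lebesgue)) \<longlonglongrightarrow> 0"
  proof (rule Lim_null_comparison)
    show "\<forall>\<^sub>F n in sequentially. norm ((\<integral>x. b x * f n x ^ 3 \<partial>lebesgue) - (\<integral>x. b x * F x ^ 3 \<partial>lebesgue))
        \<le> ?D n + 3 * root 3 (?D n * (pint 3 F)\<^sup>2) + 3 * root 3 (pint 3 F * (?D n)\<^sup>2)"
    proof (rule always_eventually, rule allI)
      fix n
      note H1 = Hoelder_root[OF dm[of n] F i(1)[of n] i(2)] and H2 = Hoelder_root[OF F dm[of n] i(2) i(1)[of n]]
      note ib = integrable_cube[OF fm fi b, of n] integrable_cube[OF F i(2) b]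
      have pt: "\<bar>b x * f n x ^ 3 - b x * F x ^ 3\<bar> \<le> \<bar>?d n x\<bar> ^ 3 + 3 * (\<bar>?d n x\<bar> * (F x)\<^sup>2) + 3 * (\<bar>F x\<bar> * (?d n x)\<^sup>2)" for x
      proof -
        have "b x * f n x ^ 3 - b x * F x ^ 3 = b x * (?d n x ^ 3 + 3 * (?d n x * (F x)\<^sup>2) + 3 * (F x * (?d n x)\<^sup>2))"
          by (simp add: power3_eq_cube power2_eq_square algebra_simps)
        also have "\<bar>\<dots>\<bar> \<le> 1 * \<bar>?d n x ^ 3 + 3 * (?d n x * (F x)\<^sup>2) + 3 * (F x * (?d n x)\<^sup>2)\<bar>"
          unfolding abs_mult[of "b x"] by (intro mult_right_mono b) simp
        also have "\<dots> \<le> \<bar>?d n x ^ 3\<bar> + \<bar>3 * (?d n x * (F x)\<^sup>2)\<bar> + \<bar>3 * (F x * (?d n x)\<^sup>2)\<bar>"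
          unfolding mult_1 by (rule order_trans[OF abs_triangle_ineq add_right_mono[OF abs_triangle_ineq]])
        finally show ?thesis by (simp add: abs_mult power_abs)
      qed
      have "norm ((\<integral>x. b x * f n x ^ 3 \<partial>lebesgue) - (\<integral>x. b x * F x ^ 3 \<partial>lebesgue)) = \<bar>\<integral>x. b x * f n x ^ 3 - b x * F x ^ 3 \<partial>lebesgue\<bar>"
        using ib by simp
      also have "\<dots> \<le> (\<integral>x. \<bar>b x * f n x ^ 3 - b x * F x ^ 3\<bar> \<partial>lebesgue)" by (rule integral_abs_bound)
      also have "\<dots> \<le> (\<integral>x. \<bar>?d n x\<bar> ^ 3 + 3 * (\<bar>?d n x\<bar> * (F x)\<^sup>2) + 3 * (\<bar>F x\<bar> * (?d n x)\<^sup>2) \<partial>lebesgue)"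
        by (intro integral_mono pt integrable_abs Bochner_Integration.integrable_diff Bochner_Integration.integrable_add integrable_mult_right ib i H1(1) H2(1))
      also have "\<dots> = ?D n + 3 * (\<integral>x. \<bar>?d n x\<bar> * (F x)\<^sup>2 \<partial>lebesgue) + 3 * (\<integral>x. \<bar>F x\<bar> * (?d n x)\<^sup>2 \<partial>lebesgue)"
        using i(1)[of n] H1(1) H2(1) by (simp add: pint_def)
      also have "\<dots> \<le> ?D n + 3 * root 3 (?D n * (pint 3 F)\<^sup>2) + 3 * root 3 (pint 3 F * (?D n)\<^sup>2)"
        using H1(2) H2(2) by argo
      finally show "norm ((\<integral>x. b x * f n x ^ 3 \<partial>lebesgue) - (\<integral>x. b x * F x ^ 3 \<partial>lebesgue))
        \<le> ?D n + 3 * root 3 (?D n * (pint 3 F)\<^sup>2) + 3 * root 3 (pint 3 F * (?D n)\<^sup>2)" .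
    qed
    have "(\<lambda>n. ?D n + 3 * root 3 (?D n * (pint 3 F)\<^sup>2) + 3 * root 3 (pint 3 F * (?D n)\<^sup>2))
       \<longlonglongrightarrow> 0 + 3 * root 3 (0 * (pint 3 F)\<^sup>2) + 3 * root 3 (pint 3 F * 0\<^sup>2)"
      by (intro tendsto_intros lim)
    then show "(\<lambda>n. ?D n + 3 * root 3 (?D n * (pint 3 F)\<^sup>2) + 3 * root 3 (pint 3 F * (?D n)\<^sup>2)) \<longlonglongrightarrow> 0" by simp
  qed
  then show ?thesis by (simp add: LIM_zero_iff)
qed

lemma tendsto_weight_limit:
  fixes F :: "real ^ 'n::finite \<Rightarrow> real"
  assumes F: "integrable lebesgue F"
  shows "(\<lambda>m. \<integral>x. weight (real (Suc m)) (Suc 0) i x * F x \<partial>lebesgue) \<longlonglongrightarrow> (\<integral>x. F x \<partial>lebesgue)"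
proof (rule integral_dominated_convergence[where w="\<lambda>x. \<bar>F x\<bar>"])
  have wm: "weight R m i \<in> borel_measurable lebesgue" for R m
    by (rule measurable_completion) (simp add: borel_measurable_continuous_onI continuous_weight)
  show "(\<lambda>x. weight (real (Suc m)) (Suc 0) i x * F x) \<in> borel_measurable lebesgue" for m
    using wm borel_measurable_integrable[OF F] by simp
  show "AE x in lebesgue. (\<lambda>m. weight (real (Suc m)) (Suc 0) i x * F x) \<longlonglongrightarrow> F x"
  proof (rule AE_I2)
    fix x
    have "(\<lambda>m. cos (x $ i * inverse (real (Suc m))) * F x) \<longlonglongrightarrow> cos (x $ i * 0) * F x"
      by (intro tendsto_intros LIMSEQ_inverse_real_of_nat)
    then show "(\<lambda>m. weight (real (Suc m)) (Suc 0) i x * F x) \<longlonglongrightarrow> F x"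
      by (simp add: weight_1 divide_inverse)
  qed
  show "AE x in lebesgue. norm (weight (real (Suc m)) (Suc 0) i x * F x) \<le> \<bar>F x\<bar>" for m
  proof (rule AE_I2)
    fix x
    have "\<bar>weight (real (Suc m)) (Suc 0) i x\<bar> * \<bar>F x\<bar> \<le> 1 * \<bar>F x\<bar>"
      by (intro mult_right_mono weight_bounds(2)) simp_all
    then show "norm (weight (real (Suc m)) (Suc 0) i x * F x) \<le> \<bar>F x\<bar>" by (simp add: abs_mult)
  qed
  show "integrable lebesgue (\<lambda>x. \<bar>F x\<bar>)" by (rule integrable_abs[OF F])
qed (rule borel_measurable_integrable[OF F])

text \<open>With \<open>a = \<phi>\<^sub>n\<close> and \<open>b = \<phi>\<^sub>m\<close>, \<open>m \<rightarrow> \<infinity>\<close>, the residual of \<open>b\<close> tends to that of the solitary wave,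
  which is zero. So \<open>\<phi>\<^sub>n\<close> is an almost solution, uniformly in \<open>\<psi>\<close>. The nonlinear part is the form
  \<open>\<integral>(\<partial>\<^sub>1a - \<partial>\<^sub>1b)(\<partial>\<^sub>1a + \<partial>\<^sub>1b)\<partial>\<^sub>1\<psi>\<close>, bounded by the Gagliardo--Nirenberg inequality.\<close>

lemma residual_diff_bound:
  fixes a b \<psi> :: "real ^ 'n::{finite,one} \<Rightarrow> real"
  assumes dim: "CARD('n) = 2 \<or> CARD('n) = 3" and t: "test_function a" "test_function b" "test_function \<psi>"
    and K: "KP_sq a \<le> K" "KP_sq b \<le> K"
  shows "\<bar>residual a \<psi> - residual b \<psi>\<bar> \<le> (1 + sqrt (32 * K)) * sqrt (KP_sq (\<lambda>x. a x - b x)) * sqrt (KP_sq \<psi>)"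
proof -
  let ?d = "\<lambda>x. a x - b x" and ?s = "\<lambda>x. a x - (-1) * b x"
  have td: "test_function ?d" and ts: "test_function ?s"
    by (intro test_diff t, intro test_diff test_scale t)
  have pd: "partial j ?d = (\<lambda>x. partial j a x - partial j b x)" for j by (rule test_partial_diff[OF t(1,2)])
  have ps: "partial j ?s = (\<lambda>x. partial j a x - (-1) * partial j b x)" for j
    using test_partial_diff[OF t(1) test_scale[OF t(2), of "-1"]] test_partial_scale[OF t(2), where c="-1" and j=j] by simp
  have tp: "test_function (partial j a)" "test_function (partial j b)" for j by (intro test_partial t)+
  have ps2: "partial 1 (partial 1 ?s) = (\<lambda>x. partial 1 (partial 1 a) x - (-1) * partial 1 (partial 1 b) x)"
    unfolding ps using test_partial_diff[OF tp(1) test_scale[OF tp(2), of "-1"]] test_partial_scale[OF tp(2), where c="-1" and j=1] by simp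
  have pd2: "partial 1 (partial 1 ?d) = (\<lambda>x. partial 1 (partial 1 a) x - partial 1 (partial 1 b) x)"
    unfolding pd by (rule test_partial_diff[OF tp])
  have c: "Cc (partial j a)" "Cc (partial j b)" "Cc (partial j \<psi>)" "Cc (partial 1 (partial 1 a))" "Cc (partial 1 (partial 1 b))" "Cc (partial 1 (partial 1 \<psi>))" for j
    by (intro test_Cc test_partial t)+
  have p2: "pint 2 (\<lambda>x. f x - (-1) * g x) \<le> 2 * pint 2 f + 2 * pint 2 g" if "Cc f" "Cc g" for f g :: "real ^ 'n::{finite,one} \<Rightarrow> real"
    using pint_add_le[of 2 f g] that by simp
  have Ks: "KP_sq ?s \<le> 4 * K"
  proof -
    have "KP_sq ?s \<le> (\<Sum>j\<in>UNIV. 2 * pint 2 (partial j a) + 2 * pint 2 (partial j b))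
        + (2 * pint 2 (partial 1 (partial 1 a)) + 2 * pint 2 (partial 1 (partial 1 b)))"
      unfolding KP_sq_def ps ps2[unfolded ps] by (intro add_mono sum_mono p2 c)
    also have "\<dots> = 2 * KP_sq a + 2 * KP_sq b"
      by (simp add: KP_sq_def sum.distrib sum_distrib_left distrib_left)
    finally show ?thesis using K by linarith
  qed
  have K0: "K \<ge> 0" using K(1) KP_sq_nonneg[of a] by linarith
  have dl: "(\<integral>x. f x * k x \<partial>lebesgue) - (\<integral>x. g x * k x \<partial>lebesgue) = (\<integral>x. (f x - g x) * k x \<partial>lebesgue)"
    if "Cc f" "Cc g" "Cc k" for f g k :: "real ^ 'n::{finite,one} \<Rightarrow> real"
    using Cc_integral_diff[OF Cc_mult[OF that(1,3)] Cc_mult[OF that(2,3)]] by (simp add: left_diff_distrib)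
  have e: "energy_form a \<psi> - energy_form b \<psi> = energy_form ?d \<psi>"
  proof -
    have "energy_form a \<psi> - energy_form b \<psi>
      = (\<Sum>j\<in>UNIV. (\<integral>x. partial j a x * partial j \<psi> x \<partial>lebesgue) - (\<integral>x. partial j b x * partial j \<psi> x \<partial>lebesgue))
        + ((\<integral>x. partial 1 (partial 1 a) x * partial 1 (partial 1 \<psi>) x \<partial>lebesgue) - (\<integral>x. partial 1 (partial 1 b) x * partial 1 (partial 1 \<psi>) x \<partial>lebesgue))"
      unfolding energy_form_def by (simp add: sum_subtractf)
    also have "\<dots> = energy_form ?d \<psi>"
      unfolding energy_form_def pd pd2[unfolded pd] dl[OF c(1,2,3)] dl[OF c(4,5,6)] ..
    finally show ?thesis .
  qed
  let ?u = "partial 1 a" and ?v = "partial 1 b" and ?p = "partial 1 \<psi>"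
  define Z where "Z = (\<integral>x. \<bar>partial 1 ?d x * partial 1 ?s x * ?p x\<bar> \<partial>lebesgue)"
  have n: "\<bar>(\<integral>x. (?u x)\<^sup>2 * ?p x \<partial>lebesgue) - (\<integral>x. (?v x)\<^sup>2 * ?p x \<partial>lebesgue)\<bar> \<le> Z"
  proof -
    have c2: "Cc (\<lambda>x. (?u x)\<^sup>2)" "Cc (\<lambda>x. (?v x)\<^sup>2)" using Cc_power[OF c(1), of 2] Cc_power[OF c(2), of 2] by simp_all
    have "(\<integral>x. (?u x)\<^sup>2 * ?p x \<partial>lebesgue) - (\<integral>x. (?v x)\<^sup>2 * ?p x \<partial>lebesgue) = (\<integral>x. partial 1 ?d x * partial 1 ?s x * ?p x \<partial>lebesgue)"
      unfolding dl[OF c2 c(3)] pd ps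
      by (intro Bochner_Integration.integral_cong refl) (simp add: power2_eq_square algebra_simps)
    then show ?thesis unfolding Z_def by (simp add: integral_abs_bound)
  qed
  have Zb: "Z \<le> sqrt (32 * K) * sqrt (KP_sq ?d) * sqrt (KP_sq \<psi>)"
  proof -
    have "Z\<^sup>2 \<le> 8 * KP_sq ?d * KP_sq ?s * KP_sq \<psi>" unfolding Z_def by (rule trilinear_bound[OF dim td ts t(3)])
    also have "\<dots> \<le> 8 * KP_sq ?d * (4 * K) * KP_sq \<psi>"
      by (intro mult_right_mono mult_left_mono Ks) (simp_all add: KP_sq_nonneg)
    also have "\<dots> = 32 * K * KP_sq ?d * KP_sq \<psi>" by simp
    finally have "Z \<le> sqrt (32 * K * KP_sq ?d * KP_sq \<psi>)" by (rule real_le_rsqrt)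
    then show ?thesis by (simp only: real_sqrt_mult)
  qed
  have "\<bar>energy_form ?d \<psi>\<bar> \<le> sqrt (KP_sq ?d) * sqrt (KP_sq \<psi>)" by (rule energy_form_bound[OF td t(3)])
  moreover have "residual a \<psi> - residual b \<psi> = energy_form ?d \<psi> - 1/2 * ((\<integral>x. (?u x)\<^sup>2 * ?p x \<partial>lebesgue) - (\<integral>x. (?v x)\<^sup>2 * ?p x \<partial>lebesgue))"
    unfolding residual_def e[symmetric] by (simp add: diff_divide_distrib)
  moreover have "Z \<ge> 0" by (simp add: Z_def)
  ultimately have "\<bar>residual a \<psi> - residual b \<psi>\<bar> \<le> sqrt (KP_sq ?d) * sqrt (KP_sq \<psi>) + sqrt (32 * K) * sqrt (KP_sq ?d) * sqrt (KP_sq \<psi>)"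
    using n Zb by argo
  also have "\<dots> = (1 + sqrt (32 * K)) * sqrt (KP_sq ?d) * sqrt (KP_sq \<psi>)" by (simp add: distrib_right)
  finally show ?thesis .
qed

lemma L2_tendsto_cong_AE:
  assumes f: "L2_tendsto f F" and G: "G \<in> L2" and ae: "AE x in lebesgue. F x = G x"
  shows "L2_tendsto f G"
proof -
  have "L2_norm (\<lambda>x. f n x - G x) = L2_norm (\<lambda>x. f n x - F x)" for n
    unfolding L2_norm_def
    by (intro arg_cong[where f=sqrt] integral_cong_AE)
       (use L2_D(1)[OF L2_diff[OF L2_tendstoD(1)[OF f, of n] G]] L2_D(1)[OF L2_diff[OF L2_tendstoD(1)[OF f, of n] L2_tendstoD(2)[OF f]]] ae in auto)
  then show ?thesis using f G by (simp add: L2_tendsto_def)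
qed

lemma tendsto_test_integral:
  assumes f: "L2_tendsto f F" and \<psi>: "Cc \<psi>"
  shows "(\<lambda>n. \<integral>x. f n x * \<psi> x \<partial>lebesgue) \<longlonglongrightarrow> (\<integral>x. F x * \<psi> x \<partial>lebesgue)"
proof -
  have const: "L2_tendsto (\<lambda>_. \<psi>) \<psi>" using Cc_L2[OF \<psi>] by (simp add: L2_tendsto_def L2_norm_def)
  show ?thesis using tendsto_weighted_product[OF f const, of "\<lambda>_. 1" 1] by simp
qed

lemma L2_eq_AE:
  fixes F G :: "real ^ 'n::finite \<Rightarrow> real"
  assumes "F \<in> L2" "G \<in> L2" "\<And>\<psi>. test_function \<psi> \<Longrightarrow> (\<integral>x. F x * \<psi> x \<partial>lebesgue) = (\<integral>x. G x * \<psi> x \<partial>lebesgue)"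
  shows "AE x in lebesgue. F x = G x"
proof -
  have "AE x in lebesgue. F x - G x = 0"
  proof (rule L2_eq_0_if_orthogonal[OF L2_diff[OF assms(1,2)]])
    fix \<psi> :: "real ^ 'n \<Rightarrow> real" assume \<psi>: "test_function \<psi>"
    show "(\<integral>x. (F x - G x) * \<psi> x \<partial>lebesgue) = 0"
      using assms(3)[OF \<psi>] L2_product[OF assms(1) Cc_L2[OF test_Cc[OF \<psi>]]] L2_product[OF assms(2) Cc_L2[OF test_Cc[OF \<psi>]]]
      by (simp add: left_diff_distrib)
  qed
  then show ?thesis by simp
qed

lemma L2_eq_AE_partial:
  fixes F G :: "real ^ 'n::finite \<Rightarrow> real"
  assumes "F \<in> L2" "G \<in> L2"
    "\<And>\<psi>. test_function \<psi> \<Longrightarrow> (\<integral>x. F x * partial i \<psi> x \<partial>lebesgue) = (\<integral>x. G x * partial i \<psi> x \<partial>lebesgue)"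
  shows "AE x in lebesgue. F x = G x"
proof -
  have "AE x in lebesgue. F x - G x = 0"
  proof (rule L2_eq_0_if_partial_orthogonal[OF L2_diff[OF assms(1,2)], of i])
    fix \<psi> :: "real ^ 'n \<Rightarrow> real" assume \<psi>: "test_function \<psi>"
    note cp = Cc_L2[OF test_Cc[OF test_partial[OF \<psi>, of i]]]
    show "(\<integral>x. (F x - G x) * partial i \<psi> x \<partial>lebesgue) = 0"
      using assms(3)[OF \<psi>] L2_product[OF assms(1) cp] L2_product[OF assms(2) cp]
      by (simp add: left_diff_distrib)
  qed
  then show ?thesis by simp
qed

lemma test_integration_by_parts:
  assumes "test_function f" "test_function g"
  shows "(\<integral>x. partial i f x * g x \<partial>lebesgue) = - (\<integral>x. f x * partial i g x \<partial>lebesgue)"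
  using integration_by_parts[OF assms(2) test_smooth[OF assms(1)], of i] by simp

lemma KP_Cauchy:
  assumes "KP_approx \<phi> v"
  shows "\<And>n. test_function (\<phi> n)" "L2_tendsto (\<lambda>n. partial 1 (\<phi> n)) v"
    "\<And>e. e > 0 \<Longrightarrow> \<exists>M. \<forall>m\<ge>M. \<forall>n\<ge>M. KP_sq (\<lambda>x. \<phi> m x - \<phi> n x) < e"
    "\<And>j. Cauchy_pint 2 (\<lambda>n. partial j (\<phi> n))" "Cauchy_pint 2 (\<lambda>n. partial 1 (partial 1 (\<phi> n)))"
proof -
  show t: "test_function (\<phi> n)" for n using assms by (simp add: KP_approx_def)
  show "L2_tendsto (\<lambda>n. partial 1 (\<phi> n)) v" using assms by (simp add: KP_approx_def)
  show C: "\<exists>M. \<forall>m\<ge>M. \<forall>n\<ge>M. KP_sq (\<lambda>x. \<phi> m x - \<phi> n x) < e" if "e > 0" for e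
  proof -
    have "sqrt e > 0" using that by simp
    then obtain M where "\<forall>m\<ge>M. \<forall>n\<ge>M. KP_norm (\<lambda>x. \<phi> m x - \<phi> n x) < sqrt e"
      using assms unfolding KP_approx_def by blast
    then show ?thesis unfolding KP_norm_sqrt by (intro exI[of _ M]) simp
  qed
  have d: "partial j (\<lambda>x. \<phi> m x - \<phi> n x) = (\<lambda>x. partial j (\<phi> m) x - partial j (\<phi> n) x)" for j m n
    by (rule test_partial_diff[OF t t])
  have d2: "partial 1 (partial 1 (\<lambda>x. \<phi> m x - \<phi> n x)) = (\<lambda>x. partial 1 (partial 1 (\<phi> m)) x - partial 1 (partial 1 (\<phi> n)) x)" for m n
    unfolding d by (rule test_partial_diff[OF test_partial[OF t] test_partial[OF t]])
  show "Cauchy_pint 2 (\<lambda>n. partial j (\<phi> n))" for j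
    unfolding Cauchy_pint_def
  proof (intro allI impI)
    fix e :: real assume "e > 0"
    then obtain M where "\<forall>m\<ge>M. \<forall>n\<ge>M. KP_sq (\<lambda>x. \<phi> m x - \<phi> n x) < e" using C by blast
    then show "\<exists>M. \<forall>m\<ge>M. \<forall>n\<ge>M. pint 2 (\<lambda>x. partial j (\<phi> m) x - partial j (\<phi> n) x) < e"
      unfolding d[symmetric] using order_le_less_trans[OF pint_partial_le_KP_sq] by blast
  qed
  show "Cauchy_pint 2 (\<lambda>n. partial 1 (partial 1 (\<phi> n)))"
    unfolding Cauchy_pint_def
  proof (intro allI impI)
    fix e :: real assume "e > 0"
    then obtain M where "\<forall>m\<ge>M. \<forall>n\<ge>M. KP_sq (\<lambda>x. \<phi> m x - \<phi> n x) < e" using C by blast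
    then show "\<exists>M. \<forall>m\<ge>M. \<forall>n\<ge>M. pint 2 (\<lambda>x. partial 1 (partial 1 (\<phi> m)) x - partial 1 (partial 1 (\<phi> n)) x) < e"
      unfolding d2[symmetric] using order_le_less_trans[OF pint_partial2_le_KP_sq] by blast
  qed
qed

text \<open>The definition of a solitary wave picks the functions \<open>v\<^sub>j\<close> and the weak derivative by a choice, so
  nothing links them directly to a sequence. Each derivative of the approximating sequence has some
  \<open>L\<^sup>2\<close> limit by completeness, and that limit is the chosen function because both have the
  same integrals against test functions, or against their derivatives in direction 1.\<close>

lemma KP_limits:
  assumes sol: "KP_solitary_wave v"
  obtains \<phi> where "KP_approx \<phi> v" "L2_tendsto (\<lambda>n. partial 1 (partial 1 (\<phi> n))) (weak_partial 1 v)"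
    "\<And>j. j \<noteq> 1 \<Longrightarrow> L2_tendsto (\<lambda>n. partial j (\<phi> n)) (KP_comp v j)"
    "\<And>\<psi>. test_function \<psi> \<Longrightarrow> (\<integral>x. weak_partial 1 v x * \<psi> x \<partial>lebesgue) = - (\<integral>x. v x * partial 1 \<psi> x \<partial>lebesgue)"
proof -
  obtain \<phi> where app: "KP_approx \<phi> v" using sol by (auto simp: KP_solitary_wave_def KP_space_def)
  note C = KP_Cauchy[OF app]
  have cp: "Cc (partial j (\<phi> n))" "Cc (partial 1 (partial 1 (\<phi> n)))" for j n by (intro test_Cc test_partial C(1))+
  obtain w where w: "L2_tendsto (\<lambda>n. partial 1 (partial 1 (\<phi> n))) w" using L2_complete[OF cp(2) C(5)] by blast
  have ww: "(\<integral>x. w x * \<psi> x \<partial>lebesgue) = - (\<integral>x. v x * partial 1 \<psi> x \<partial>lebesgue)" if \<psi>: "test_function \<psi>" for \<psi>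
  proof (rule LIMSEQ_unique)
    show "(\<lambda>n. \<integral>x. partial 1 (partial 1 (\<phi> n)) x * \<psi> x \<partial>lebesgue) \<longlonglongrightarrow> (\<integral>x. w x * \<psi> x \<partial>lebesgue)"
      by (rule tendsto_test_integral[OF w test_Cc[OF \<psi>]])
    show "(\<lambda>n. \<integral>x. partial 1 (partial 1 (\<phi> n)) x * \<psi> x \<partial>lebesgue) \<longlonglongrightarrow> - (\<integral>x. v x * partial 1 \<psi> x \<partial>lebesgue)"
      unfolding test_integration_by_parts[OF test_partial[OF C(1)] \<psi>]
      by (intro tendsto_minus tendsto_test_integral[OF C(2)] test_Cc test_partial \<psi>)
  qed
  have "\<exists>w. w \<in> L2 \<and> (\<forall>\<psi>. test_function \<psi> \<longrightarrow> distr_of w \<psi> = distr_partial 1 (distr_of v) \<psi>)"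
    using ww L2_tendstoD(2)[OF w] by (auto simp: distr_of_def distr_partial_def)
  from someI_ex[OF this] have wp: "weak_partial 1 v \<in> L2"
    "\<And>\<psi>. test_function \<psi> \<Longrightarrow> (\<integral>x. weak_partial 1 v x * \<psi> x \<partial>lebesgue) = - (\<integral>x. v x * partial 1 \<psi> x \<partial>lebesgue)"
    unfolding weak_partial_def[symmetric] by (auto simp: distr_of_def distr_partial_def)
  have "L2_tendsto (\<lambda>n. partial 1 (partial 1 (\<phi> n))) (weak_partial 1 v)"
    by (rule L2_tendsto_cong_AE[OF w wp(1) L2_eq_AE[OF L2_tendstoD(2)[OF w] wp(1)]]) (simp add: ww wp(2))
  moreover have "L2_tendsto (\<lambda>n. partial j (\<phi> n)) (KP_comp v j)" if j: "j \<noteq> 1" for j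
  proof -
    obtain g where g: "L2_tendsto (\<lambda>n. partial j (\<phi> n)) g" using L2_complete[OF cp(1) C(4)] by blast
    then have "\<exists>g. \<exists>\<phi>. KP_approx \<phi> v \<and> L2_tendsto (\<lambda>n. partial j (\<phi> n)) g" using app by blast
    from someI_ex[OF this] have cL: "KP_comp v j \<in> L2"
      unfolding KP_comp_def[symmetric] using L2_tendstoD(2) by blast
    have "(\<integral>x. g x * partial 1 \<psi> x \<partial>lebesgue) = (\<integral>x. KP_comp v j x * partial 1 \<psi> x \<partial>lebesgue)" if \<psi>: "test_function \<psi>" for \<psi>
    proof -
      have "(\<integral>x. g x * partial 1 \<psi> x \<partial>lebesgue) = (\<integral>x. v x * partial j \<psi> x \<partial>lebesgue)"
      proof (rule LIMSEQ_unique)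
        show "(\<lambda>n. \<integral>x. partial j (\<phi> n) x * partial 1 \<psi> x \<partial>lebesgue) \<longlonglongrightarrow> (\<integral>x. g x * partial 1 \<psi> x \<partial>lebesgue)"
          by (intro tendsto_test_integral[OF g] test_Cc test_partial \<psi>)
        have "(\<integral>x. partial j (\<phi> n) x * partial 1 \<psi> x \<partial>lebesgue) = (\<integral>x. partial 1 (\<phi> n) x * partial j \<psi> x \<partial>lebesgue)" for n
          unfolding test_integration_by_parts[OF C(1) test_partial[OF \<psi>]] partial_commute[OF test_smooth[OF \<psi>], of j 1] ..
        then show "(\<lambda>n. \<integral>x. partial j (\<phi> n) x * partial 1 \<psi> x \<partial>lebesgue) \<longlonglongrightarrow> (\<integral>x. v x * partial j \<psi> x \<partial>lebesgue)"
          using tendsto_test_integral[OF C(2) test_Cc[OF test_partial[OF \<psi>, of j]]] by (simp only:)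
      qed
      moreover have "distr_partial 1 (distr_of (KP_comp v j)) \<psi> = distr_partial j (distr_of v) \<psi>"
        using sol j \<psi> by (simp add: KP_solitary_wave_def)
      ultimately show ?thesis by (simp add: distr_partial_def distr_of_def)
    qed
    from L2_tendsto_cong_AE[OF g cL L2_eq_AE_partial[OF L2_tendstoD(2)[OF g] cL this]] show ?thesis by blast
  qed
  ultimately show ?thesis using that[OF app] wp(2) by blast
qed

lemma le_if_le_epsilon:
  assumes "\<And>h. 0 < h \<Longrightarrow> h \<le> 1 \<Longrightarrow> x \<le> h * c + (y::real)"
  shows "x \<le> y"
proof -
  have "(\<lambda>n. inverse (real (Suc n)) * c + y) \<longlonglongrightarrow> 0 * c + y"
    by (intro tendsto_intros LIMSEQ_inverse_real_of_nat)
  moreover have "x \<le> inverse (real (Suc n)) * c + y" for n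
    by (rule assms) (simp_all add: inverse_le_1_iff)
  ultimately have "x \<le> 0 * c + y" by (intro LIMSEQ_le_const) auto
  then show ?thesis by simp
qed

text \<open>For fixed \<open>h\<close> the functions \<open>\<phi>\<^sub>n\<close> are eventually almost waves, so \<open>Pohozaev_almost\<close> passes to
  the limit in \<open>n\<close> with the bounded weights \<open>cos(x\<^sub>i/R)\<close> in place; then \<open>h \<rightarrow> 0\<close> removes the first error
  and \<open>R \<rightarrow> \<infinity>\<close> removes the second and turns the weights into \<open>1\<close>. The identity without \<open>i\<close> is the
  equation tested with \<open>\<phi>\<^sub>n\<close> itself.\<close>

lemma solitary_wave_identities:
  fixes v :: "real ^ 'n::{finite,one} \<Rightarrow> real"
  assumes dim: "CARD('n) = 2 \<or> CARD('n) = 3" and sol: "KP_solitary_wave v"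
  defines "c \<equiv> (\<lambda>j. if j = 1 then v else KP_comp v j)"
  defines "S \<equiv> (\<Sum>k\<in>UNIV. \<integral>x. (c k x)\<^sup>2 \<partial>lebesgue)"
    and "D \<equiv> (\<integral>x. (weak_partial 1 v x)\<^sup>2 \<partial>lebesgue)" and "T \<equiv> (\<integral>x. v x ^ 3 \<partial>lebesgue)"
  shows "S + D = 1/2 * T"
    "(- 1/2) * (S + D) + (\<integral>x. (c i x)\<^sup>2 \<partial>lebesgue) + 1/6 * T + (if i = 1 then 2 * D - 1/2 * T else 0) = 0"
    "\<And>j. c j \<in> L2" "weak_partial 1 v \<in> L2"
proof -
  define w where "w = weak_partial 1 v"
  obtain \<phi> where app: "KP_approx \<phi> v" and W: "L2_tendsto (\<lambda>n. partial 1 (partial 1 (\<phi> n))) w"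
    and Lj: "\<And>j. j \<noteq> 1 \<Longrightarrow> L2_tendsto (\<lambda>n. partial j (\<phi> n)) (KP_comp v j)"
    and wp: "\<And>\<psi>. test_function \<psi> \<Longrightarrow> (\<integral>x. w x * \<psi> x \<partial>lebesgue) = - (\<integral>x. v x * partial 1 \<psi> x \<partial>lebesgue)"
    using KP_limits[OF sol] unfolding w_def by blast
  note C = KP_Cauchy[OF app]
  have L: "L2_tendsto (\<lambda>n. partial j (\<phi> n)) (c j)" for j using C(2) Lj by (simp add: c_def)
  have c1: "c 1 = v" by (simp add: c_def)
  show cL: "c j \<in> L2" for j by (rule L2_tendstoD(2)[OF L])
  show wL: "weak_partial 1 v \<in> L2" using L2_tendstoD(2)[OF W] by (simp add: w_def)
  have cp: "Cc (partial j (\<phi> n))" "Cc (partial 1 (partial 1 (\<phi> n)))" for j n by (intro test_Cc test_partial C(1))+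
  have sq: "(\<lambda>n. \<integral>x. b x * (partial j (\<phi> n) x)\<^sup>2 \<partial>lebesgue) \<longlonglongrightarrow> (\<integral>x. b x * (c j x)\<^sup>2 \<partial>lebesgue)"
    "(\<lambda>n. \<integral>x. b x * (partial 1 (partial 1 (\<phi> n)) x)\<^sup>2 \<partial>lebesgue) \<longlonglongrightarrow> (\<integral>x. b x * (w x)\<^sup>2 \<partial>lebesgue)"
    if "b \<in> borel_measurable lebesgue" "\<And>x. \<bar>b x\<bar> \<le> 1" for b j
    using tendsto_weighted_product[OF L L that] tendsto_weighted_product[OF W W that] by (simp_all add: power2_eq_square)
  have KPlim: "(\<lambda>n. KP_sq (\<phi> n)) \<longlonglongrightarrow> S + D"
  proof -
    have "(\<lambda>n. pint 2 (partial j (\<phi> n))) \<longlonglongrightarrow> (\<integral>x. (c j x)\<^sup>2 \<partial>lebesgue)" for j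
      using sq(1)[of "\<lambda>_. 1" j] by (simp add: pint_def)
    moreover have "(\<lambda>n. pint 2 (partial 1 (partial 1 (\<phi> n)))) \<longlonglongrightarrow> D"
      using sq(2)[of "\<lambda>_. 1"] by (simp add: pint_def D_def w_def)
    ultimately show ?thesis unfolding KP_sq_def S_def by (intro tendsto_add tendsto_sum)
  qed
  obtain K where K: "K \<ge> 1" "\<And>n. KP_sq (\<phi> n) \<le> K"
  proof -
    obtain B where B: "\<And>n. norm (KP_sq (\<phi> n)) \<le> B"
      using convergent_imp_Bseq[OF convergentI[OF KPlim]] unfolding Bseq_def by blast
    show ?thesis
      by (rule that[of "max 1 B"]) (use B in \<open>auto simp: le_max_iff_disj intro: order_trans[OF abs_ge_self]\<close>)
  qed
  have vm: "v \<in> borel_measurable lebesgue" using cL[of 1] by (simp add: c1 L2_D)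
  have Cau3: "Cauchy_pint 3 (\<lambda>n. partial 1 (\<phi> n))"
    unfolding Cauchy_pint_def
  proof (intro allI impI)
    fix e :: real assume e: "e > 0"
    then have "min 1 (e ^ 4 / 64) > 0" by simp
    then obtain M where M: "\<And>m n. m \<ge> M \<Longrightarrow> n \<ge> M \<Longrightarrow> KP_sq (\<lambda>x. \<phi> m x - \<phi> n x) < min 1 (e ^ 4 / 64)" using C(3) by meson
    have "pint 3 (\<lambda>x. partial 1 (\<phi> m) x - partial 1 (\<phi> n) x) < e" if mn: "m \<ge> M" "n \<ge> M" for m n
    proof (rule power_less_imp_less_base)
      let ?d = "\<lambda>x. \<phi> m x - \<phi> n x"
      have s: "KP_sq ?d < 1" "KP_sq ?d < e ^ 4 / 64" using M[OF mn] by auto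
      have "pint 3 (\<lambda>x. partial 1 (\<phi> m) x - partial 1 (\<phi> n) x) ^ 4 = pint 3 (partial 1 ?d) ^ 4"
        by (simp add: test_partial_diff C(1))
      also have "\<dots> \<le> 64 * pint 2 (partial 1 ?d) * KP_sq ?d ^ 5"
        by (rule Gagliardo_Nirenberg[OF dim test_diff[OF C(1) C(1)]])
      also have "\<dots> \<le> 64 * KP_sq ?d * 1"
        using s(1) KP_sq_nonneg[of ?d] by (intro mult_mono mult_left_mono pint_partial_le_KP_sq power_le_one) auto
      also have "\<dots> < e ^ 4" using s(2) by simp
      finally show "pint 3 (\<lambda>x. partial 1 (\<phi> m) x - partial 1 (\<phi> n) x) ^ 4 < e ^ 4" .
    qed (use e in simp)
    then show "\<exists>N. \<forall>m\<ge>N. \<forall>n\<ge>N. pint 3 (\<lambda>x. partial 1 (\<phi> m) x - partial 1 (\<phi> n) x) < e" by blast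
  qed
  obtain r where r: "strict_mono r" "AE x in lebesgue. (\<lambda>i. partial 1 (\<phi> (r i)) x) \<longlonglongrightarrow> v x"
    using L2_tendsto_AE_subseq[OF C(2)] by blast
  note V3 = Cauchy_pint_limit[OF cp(1) _ Cau3 r vm]
  have cube: "(\<lambda>n. \<integral>x. b x * partial 1 (\<phi> n) x ^ 3 \<partial>lebesgue) \<longlonglongrightarrow> (\<integral>x. b x * v x ^ 3 \<partial>lebesgue)"
    if "b \<in> borel_measurable lebesgue" "\<And>x. \<bar>b x\<bar> \<le> 1" for b
    by (rule tendsto_weighted_cube[OF cp(1) vm V3(1) V3(2) V3(3) that]) simp_all
  have res0: "(\<lambda>m. residual (\<phi> m) \<psi>) \<longlonglongrightarrow> 0" if \<psi>: "test_function \<psi>" for \<psi>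
  proof -
    have cq: "Cc (partial j \<psi>)" "Cc (partial 1 (partial 1 \<psi>))" for j by (intro test_Cc test_partial \<psi>)+
    obtain B where B: "\<And>x. \<bar>\<psi> x\<bar> \<le> B" using Cc_bounded[OF test_Cc[OF \<psi>]] by blast
    have pm: "\<psi> \<in> borel_measurable lebesgue" by (rule borel_measurable_integrable[OF Cc_integrable[OF test_Cc[OF \<psi>]]])
    have nl: "- 1/2 * (\<integral>x. (partial 1 (\<phi> m) x)\<^sup>2 * partial 1 \<psi> x \<partial>lebesgue)
       = (\<integral>x. \<psi> x * (partial 1 (\<phi> m) x * partial 1 (partial 1 (\<phi> m)) x) \<partial>lebesgue)" for m
    proof -
      let ?u = "partial 1 (\<phi> m)"
      have tu: "test_function ?u" by (intro test_partial C(1))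
      have "partial 1 (\<lambda>x. ?u x * ?u x) x = 2 * (?u x * partial 1 ?u x)" for x
        using partial_mult[OF test_differentiable[OF tu] test_differentiable[OF tu]] by simp
      then have "(\<integral>x. ?u x * ?u x * partial 1 \<psi> x \<partial>lebesgue) = - (\<integral>x. 2 * (?u x * partial 1 ?u x) * \<psi> x \<partial>lebesgue)"
        using integration_by_parts[OF \<psi> smooth_mult[OF test_smooth[OF tu] test_smooth[OF tu]], of 1] by (simp only:)
      also have "\<dots> = - 2 * (\<integral>x. \<psi> x * (?u x * partial 1 ?u x) \<partial>lebesgue)"
      proof -
        have "2 * (?u x * partial 1 ?u x) * \<psi> x = 2 * (\<psi> x * (?u x * partial 1 ?u x))" for x by simp
        then have "(\<integral>x. 2 * (?u x * partial 1 ?u x) * \<psi> x \<partial>lebesgue) = 2 * (\<integral>x. \<psi> x * (?u x * partial 1 ?u x) \<partial>lebesgue)"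
          by (simp only: integral_mult_right_zero)
        then show ?thesis by simp
      qed
      finally show ?thesis by (simp add: power2_eq_square)
    qed
    have "residual (\<phi> m) \<psi> = energy_form (\<phi> m) \<psi> + (\<integral>x. \<psi> x * (partial 1 (\<phi> m) x * partial 1 (partial 1 (\<phi> m)) x) \<partial>lebesgue)" for m
      unfolding residual_def nl[symmetric] by simp
    moreover have "(\<lambda>m. energy_form (\<phi> m) \<psi> + (\<integral>x. \<psi> x * (partial 1 (\<phi> m) x * partial 1 (partial 1 (\<phi> m)) x) \<partial>lebesgue))
       \<longlonglongrightarrow> ((\<Sum>j\<in>UNIV. \<integral>x. c j x * partial j \<psi> x \<partial>lebesgue) + (\<integral>x. w x * partial 1 (partial 1 \<psi>) x \<partial>lebesgue)) + (\<integral>x. \<psi> x * (v x * w x) \<partial>lebesgue)"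
      unfolding energy_form_def
      by (intro tendsto_add tendsto_sum tendsto_test_integral[OF L cq(1)] tendsto_test_integral[OF W cq(2)]
          tendsto_weighted_product[OF C(2) W pm B])
    moreover have "((\<Sum>j\<in>UNIV. \<integral>x. c j x * partial j \<psi> x \<partial>lebesgue) + (\<integral>x. w x * partial 1 (partial 1 \<psi>) x \<partial>lebesgue)) + (\<integral>x. \<psi> x * (v x * w x) \<partial>lebesgue) = 0"
    proof -
      have s: "(\<Sum>j\<in>UNIV. \<integral>x. c j x * partial j \<psi> x \<partial>lebesgue)
         = (\<integral>x. v x * partial 1 \<psi> x \<partial>lebesgue) + (\<Sum>j\<in>UNIV - {1}. \<integral>x. KP_comp v j x * partial j \<psi> x \<partial>lebesgue)"
        by (subst sum.remove[of UNIV 1]) (simp_all add: c_def)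
      have w3: "(\<integral>x. w x * partial 1 (partial 1 \<psi>) x \<partial>lebesgue) = - (\<integral>x. v x * partial 1 (partial 1 (partial 1 \<psi>)) x \<partial>lebesgue)"
        by (intro wp test_partial \<psi>)
      have "- distr_partial 1 (distr_of v) \<psi> + distr_of (\<lambda>x. v x * weak_partial 1 v x) \<psi>
        + distr_partial 1 (distr_partial 1 (distr_partial 1 (distr_of v))) \<psi>
        - (\<Sum>j\<in>UNIV - {1}. distr_partial j (distr_of (KP_comp v j)) \<psi>) = 0"
        using sol \<psi> unfolding KP_solitary_wave_def by blast
      then show ?thesis unfolding s w3 by (simp add: distr_partial_def distr_of_def sum_negf w_def mult_ac)
    qed
    ultimately show ?thesis by simp
  qed
  have PS: "\<exists>M. \<forall>n\<ge>M. \<forall>\<psi>. test_function \<psi> \<longrightarrow> \<bar>residual (\<phi> n) \<psi>\<bar> \<le> e * sqrt (KP_sq \<psi>)" if e: "e > 0" for e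
  proof -
    define k where "k = 1 + sqrt (32 * K)"
    have k: "k > 0" unfolding k_def using K by (simp add: add_pos_nonneg)
    then have "(e / k)\<^sup>2 > 0" using e by simp
    then obtain M where M: "\<And>m n. m \<ge> M \<Longrightarrow> n \<ge> M \<Longrightarrow> KP_sq (\<lambda>x. \<phi> m x - \<phi> n x) < (e / k)\<^sup>2" using C(3) by meson
    have "\<bar>residual (\<phi> n) \<psi>\<bar> \<le> e * sqrt (KP_sq \<psi>)" if n: "n \<ge> M" and \<psi>: "test_function \<psi>" for n \<psi>
    proof -
      have "(\<lambda>m. \<bar>residual (\<phi> n) \<psi> - residual (\<phi> m) \<psi>\<bar>) \<longlonglongrightarrow> \<bar>residual (\<phi> n) \<psi> - 0\<bar>"
        by (intro tendsto_intros res0 \<psi>)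
      moreover have "\<bar>residual (\<phi> n) \<psi> - residual (\<phi> m) \<psi>\<bar> \<le> e * sqrt (KP_sq \<psi>)" if m: "m \<ge> M" for m
      proof -
        have "sqrt (KP_sq (\<lambda>x. \<phi> n x - \<phi> m x)) \<le> sqrt ((e / k)\<^sup>2)"
          by (rule real_sqrt_le_mono[OF less_imp_le[OF M[OF n m]]])
        also have "\<dots> = e / k" using e k by (simp add: real_sqrt_abs)
        finally have s: "sqrt (KP_sq (\<lambda>x. \<phi> n x - \<phi> m x)) \<le> e / k" .
        have "\<bar>residual (\<phi> n) \<psi> - residual (\<phi> m) \<psi>\<bar> \<le> k * sqrt (KP_sq (\<lambda>x. \<phi> n x - \<phi> m x)) * sqrt (KP_sq \<psi>)"
          unfolding k_def by (rule residual_diff_bound[OF dim C(1) C(1) \<psi> K(2) K(2)])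
        also have "\<dots> \<le> k * (e / k) * sqrt (KP_sq \<psi>)"
          using k s by (intro mult_right_mono mult_left_mono) (simp_all add: KP_sq_nonneg)
        finally show ?thesis using k by simp
      qed
      ultimately show ?thesis using Lim_bounded[of _ "\<bar>residual (\<phi> n) \<psi> - 0\<bar>" M] by simp
    qed
    then show ?thesis by blast
  qed
  show Neh: "S + D = 1/2 * T"
  proof -
    have eq: "residual (\<phi> n) (\<phi> n) = KP_sq (\<phi> n) - 1/2 * (\<integral>x. 1 * partial 1 (\<phi> n) x ^ 3 \<partial>lebesgue)" for n
      unfolding residual_def energy_form_def KP_sq_def pint_2 by (simp add: power2_eq_square power3_eq_cube)
    have "(\<lambda>n. \<bar>residual (\<phi> n) (\<phi> n)\<bar>) \<longlonglongrightarrow> \<bar>(S + D) - 1/2 * (\<integral>x. 1 * v x ^ 3 \<partial>lebesgue)\<bar>"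
      unfolding eq by (intro tendsto_intros KPlim cube) simp_all
    then have lim: "(\<lambda>n. \<bar>residual (\<phi> n) (\<phi> n)\<bar>) \<longlonglongrightarrow> \<bar>(S + D) - 1/2 * T\<bar>" by (simp add: T_def)
    have "\<bar>(S + D) - 1/2 * T\<bar> \<le> h * sqrt K + 0" if h: "0 < h" for h
    proof -
      obtain M where M: "\<And>n. n \<ge> M \<Longrightarrow> \<bar>residual (\<phi> n) (\<phi> n)\<bar> \<le> h * sqrt (KP_sq (\<phi> n))" using PS[OF h] C(1) by blast
      have "\<bar>residual (\<phi> n) (\<phi> n)\<bar> \<le> h * sqrt K" if "n \<ge> M" for n
        by (rule order_trans[OF M[OF that] mult_left_mono]) (use K(2) h in simp_all)
      then show ?thesis using Lim_bounded[OF lim, of M] by simp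
    qed
    from le_if_le_epsilon[OF this] show ?thesis by simp
  qed
  define Jl where "Jl R = (- 1/2) * ((\<Sum>k\<in>UNIV. \<integral>x. weight R (Suc 0) i x * (c k x)\<^sup>2 \<partial>lebesgue)
        + (\<integral>x. weight R (Suc 0) i x * (w x)\<^sup>2 \<partial>lebesgue))
      + (\<integral>x. weight R (Suc 0) i x * (c i x)\<^sup>2 \<partial>lebesgue) + 1/6 * (\<integral>x. weight R (Suc 0) i x * v x ^ 3 \<partial>lebesgue)
      + (if i = 1 then 2 * (\<integral>x. weight R (Suc 0) i x * (w x)\<^sup>2 \<partial>lebesgue)
           - 1/2 * (\<integral>x. weight R (Suc 0) i x * v x ^ 3 \<partial>lebesgue) else 0)" for R
  have if_tendsto: "(\<lambda>n. if P then f n else (0::real)) \<longlonglongrightarrow> (if P then l else 0)" if "f \<longlonglongrightarrow> l" for P f l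
    using that by simp
  have JR: "\<bar>Jl R\<bar> \<le> 3 * K / R" if R: "R \<ge> 1" for R
  proof -
    have wm: "weight R (Suc 0) i \<in> borel_measurable lebesgue"
      by (rule measurable_completion) (simp add: borel_measurable_continuous_onI continuous_weight)
    note W1 = wm weight_bounds(2)[OF R, of i]
    let ?J = "\<lambda>n. (- 1/2) * ((\<Sum>k\<in>UNIV. \<integral>x. weight R (Suc 0) i x * (partial k (\<phi> n) x)\<^sup>2 \<partial>lebesgue)
        + (\<integral>x. weight R (Suc 0) i x * (partial 1 (partial 1 (\<phi> n)) x)\<^sup>2 \<partial>lebesgue))
      + (\<integral>x. weight R (Suc 0) i x * (partial i (\<phi> n) x)\<^sup>2 \<partial>lebesgue)
      + 1/6 * (\<integral>x. weight R (Suc 0) i x * partial 1 (\<phi> n) x ^ 3 \<partial>lebesgue)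
      + (if i = 1 then 2 * (\<integral>x. weight R (Suc 0) i x * (partial 1 (partial 1 (\<phi> n)) x)\<^sup>2 \<partial>lebesgue)
           - 1/2 * (\<integral>x. weight R (Suc 0) i x * partial 1 (\<phi> n) x ^ 3 \<partial>lebesgue) else 0)"
    have "?J \<longlonglongrightarrow> Jl R"
      unfolding Jl_def
      by (intro tendsto_add tendsto_mult_left tendsto_sum if_tendsto tendsto_diff sq(1)[OF W1] sq(2)[OF W1] cube[OF W1])
    then have lim: "(\<lambda>n. \<bar>?J n\<bar>) \<longlonglongrightarrow> \<bar>Jl R\<bar>" by (rule tendsto_rabs)
    have "\<bar>Jl R\<bar> \<le> h * poh_const K R + 3 * K / R" if h: "0 < h" "h \<le> 1" for h
    proof -
      have "h\<^sup>2 > 0" using h by simp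
      from PS[OF this] obtain M where M: "\<And>n \<psi>. n \<ge> M \<Longrightarrow> test_function \<psi> \<Longrightarrow> \<bar>residual (\<phi> n) \<psi>\<bar> \<le> h\<^sup>2 * sqrt (KP_sq \<psi>)" by blast
      have "\<bar>?J n\<bar> \<le> h * poh_const K R + 3 * K / R" if n: "n \<ge> M" for n
      proof -
        interpret almost_wave "\<phi> n" K h
          by standard (use dim C(1) K h M[OF n] in auto)
        show ?thesis by (rule Pohozaev_almost[OF R])
      qed
      then show ?thesis using Lim_bounded[OF lim, of M] by blast
    qed
    then show ?thesis by (rule le_if_le_epsilon)
  qed
  have ic: "integrable lebesgue (\<lambda>x. (c k x)\<^sup>2)" for k by (rule L2_D(2)[OF cL])
  have iw: "integrable lebesgue (\<lambda>x. (w x)\<^sup>2)" by (rule L2_D(2)[OF L2_tendstoD(2)[OF W]])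
  have iv: "integrable lebesgue (\<lambda>x. v x ^ 3)"
    using integrable_cube[OF vm V3(2), of "\<lambda>_. 1"] by simp
  let ?Ji = "(- 1/2) * (S + D) + (\<integral>x. (c i x)\<^sup>2 \<partial>lebesgue) + 1/6 * T + (if i = 1 then 2 * D - 1/2 * T else 0)"
  have "(\<lambda>m. Jl (real (Suc m))) \<longlonglongrightarrow> ?Ji"
    unfolding Jl_def S_def D_def T_def w_def[symmetric]
    by (intro tendsto_add tendsto_mult_left tendsto_sum if_tendsto tendsto_diff tendsto_weight_limit ic iw iv)
  then have 1: "(\<lambda>m. \<bar>Jl (real (Suc m))\<bar>) \<longlonglongrightarrow> \<bar>?Ji\<bar>" by (rule tendsto_rabs)
  have 2: "(\<lambda>m. 3 * K * inverse (real (Suc m))) \<longlonglongrightarrow> 3 * K * 0"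
    by (intro tendsto_intros LIMSEQ_inverse_real_of_nat)
  have "\<bar>?Ji\<bar> \<le> 3 * K * 0"
    by (rule LIMSEQ_le[OF 1 2]) (use JR in \<open>auto simp: divide_inverse\<close>)
  then show "?Ji = 0" by simp
qed

theorem theorem2:
  fixes v :: "real ^ 'n::{finite,one} \<Rightarrow> real" and N :: real
  assumes "N = real CARD('n)" and "N = 2 \<or> N = 3"
    and "KP_solitary_wave v"
  shows "\<forall>\<sigma> \<in> sphere (0 :: real ^ 'n::{finite,one}) 1.
    v_infty 1 v \<sigma> = (7 - 2 * N) * Gamma (N / 2) / (2 * (2 * N - 5) * pi powr (N / 2))
        * (1 - N * (\<sigma> $ 1)\<^sup>2) * KP_energy v
    \<and> v_infty 1 v \<sigma> = (7 - 2 * N) * Gamma (N / 2) / (4 * pi powr (N / 2))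
        * (1 - N * (\<sigma> $ 1)\<^sup>2) * KP_action v"
proof -
  have dim: "CARD('n) = 2 \<or> CARD('n) = 3" using assms(1,2) by auto
  note I = solitary_wave_identities[OF dim assms(3)]
  define a D T P where "a = (\<integral>x. (v x)\<^sup>2 \<partial>lebesgue)" and "D = (\<integral>x. (weak_partial 1 v x)\<^sup>2 \<partial>lebesgue)"
    and "T = (\<integral>x. v x ^ 3 \<partial>lebesgue)" and "P = (\<Sum>j\<in>UNIV - {1}. \<integral>x. (KP_comp v j x)\<^sup>2 \<partial>lebesgue)"
  have S: "(\<Sum>k\<in>UNIV. \<integral>x. ((if k = 1 then v else KP_comp v k) x)\<^sup>2 \<partial>lebesgue) = a + P"
    by (subst sum.remove[of UNIV 1]) (simp_all add: a_def P_def)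
  have Neh: "a + P + D = 1/2 * T" using I(1) unfolding S D_def[symmetric] T_def[symmetric] .
  have i1: "(- 1/2) * (a + P + D) + a + 1/6 * T + (2 * D - 1/2 * T) = 0"
    using I(2)[of 1] unfolding S D_def[symmetric] T_def[symmetric] by (simp add: a_def)
  have ij: "(\<integral>x. (KP_comp v j x)\<^sup>2 \<partial>lebesgue) = T / 12" if "j \<noteq> 1" for j
  proof -
    have "(- 1/2) * (a + P + D) + (\<integral>x. (KP_comp v j x)\<^sup>2 \<partial>lebesgue) + 1/6 * T + 0 = 0"
      using I(2)[of j] that unfolding S D_def[symmetric] T_def[symmetric] by simp
    then show ?thesis using Neh by argo
  qed
  have "P = (\<Sum>j\<in>UNIV - {1::'n}. T / 12)" unfolding P_def by (intro sum.cong refl ij) auto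
  then have P: "P = (N - 1) * (T / 12)" using assms(1) dim by (auto simp: card_Diff_singleton)
  have "D = N * (T / 12) \<and> a = (7 - 2 * N) * (T / 12)"
    using assms(2)
  proof
    assume N: "N = 2"
    have "P = T / 12" using P unfolding N by simp
    then have "D = T / 6" "a = T / 4" using Neh i1 by argo+
    then show ?thesis unfolding N by simp
  next
    assume N: "N = 3"
    have "P = T / 6" using P unfolding N by simp
    then have "D = T / 4" "a = T / 12" using Neh i1 by argo+
    then show ?thesis unfolding N by simp
  qed
  then have D: "D = N * (T / 12)" and a: "a = (7 - 2 * N) * (T / 12)" by blast+
  have "(\<integral>x. (weak_partial 1 v x)\<^sup>2 + (\<Sum>j\<in>UNIV - {1}. (KP_comp v j x)\<^sup>2) \<partial>lebesgue) = D + P"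
  proof -
    have c: "integrable lebesgue (\<lambda>x. (KP_comp v j x)\<^sup>2)" if "j \<in> UNIV - {1}" for j
      using L2_D(2)[OF I(3)[of j]] that by simp
    have "(\<integral>x. (weak_partial 1 v x)\<^sup>2 + (\<Sum>j\<in>UNIV - {1}. (KP_comp v j x)\<^sup>2) \<partial>lebesgue)
        = (\<integral>x. (weak_partial 1 v x)\<^sup>2 \<partial>lebesgue) + (\<integral>x. (\<Sum>j\<in>UNIV - {1}. (KP_comp v j x)\<^sup>2) \<partial>lebesgue)"
      by (rule Bochner_Integration.integral_add[OF L2_D(2)[OF I(4)] Bochner_Integration.integrable_sum[OF c]])
    also have "(\<integral>x. (\<Sum>j\<in>UNIV - {1}. (KP_comp v j x)\<^sup>2) \<partial>lebesgue) = P"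
      unfolding P_def by (rule Bochner_Integration.integral_sum[OF c])
    finally show ?thesis unfolding D_def .
  qed
  then have "KP_energy v = 1/2 * (D + P) - 1/6 * T" by (simp add: KP_energy_def T_def)
  then have E: "KP_energy v = (2 * N - 5) * (T / 24)" unfolding D P by (simp add: field_simps)
  have A: "KP_action v = T / 12"
    unfolding KP_action_def E a_def[symmetric] a by (simp add: field_simps)
  have N5: "2 * N - 5 \<noteq> 0" using assms(2) by auto
  show ?thesis
  proof
    fix \<sigma> :: "real ^ 'n::{finite,one}"
    let ?q = "1 - N * (\<sigma> $ 1)\<^sup>2"
    have v: "v_infty 1 v \<sigma> = Gamma (N / 2) / (4 * pi powr (N / 2)) * ?q * ((7 - 2 * N) * (T / 12))"
      unfolding v_infty_1 assms(1)[symmetric] a_def[symmetric] a ..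
    have "(7 - 2 * N) * Gamma (N / 2) / (2 * (2 * N - 5) * pi powr (N / 2)) * ?q * ((2 * N - 5) * (T / 24))
       = Gamma (N / 2) / (4 * pi powr (N / 2)) * ?q * ((7 - 2 * N) * (T / 12))"
    proof -
      have "x * G / (2 * y * p) * q * (y * (t / 24)) = G / (4 * p) * q * (x * (t / 12))" if "y \<noteq> 0" for x y G p q t :: real
        using that by (cases "p = 0") (simp_all add: field_simps)
      from this[OF N5] show ?thesis .
    qed
    moreover have "(7 - 2 * N) * Gamma (N / 2) / (4 * pi powr (N / 2)) * ?q * (T / 12)
       = Gamma (N / 2) / (4 * pi powr (N / 2)) * ?q * ((7 - 2 * N) * (T / 12))" by simp
    ultimately show "v_infty 1 v \<sigma> = (7 - 2 * N) * Gamma (N / 2) / (2 * (2 * N - 5) * pi powr (N / 2)) * ?q * KP_energy v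
      \<and> v_infty 1 v \<sigma> = (7 - 2 * N) * Gamma (N / 2) / (4 * pi powr (N / 2)) * ?q * KP_action v"
      unfolding v E A by (simp only:)
  qed
qed

end
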